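(* Let $V\in C^2(\mathbb R^d)$ satisfy $|\mathcal H(V)|_F\le C_0(1+|\nabla V|)$ pointwise on $\mathbb R^d$ for some $C_0>0$, and let $g\in[H^1(\mu,\mathcal T)]^d$. Then $$\|\mathcal H(V)g\|_{L_2(\mu)}^2\le C_1\big(\|g\|_{L_2(\mu)}^2+\|\nabla_x^hg\|_{L_2(\mu)}^2\big)-8C_0^2\int_\Gamma\{g\}^T[g]_x\nabla V\,\mathrm d\nu,$$ with $C_1:=\max\{2C_0^2(1+2\sqrt d+2dC_0^2),\,16C_0^2\}$. In the special case of a Gaussian confining potential $V(x)=|x|^2/2$, one has $C_1=16$.
   Context: $(v,x)\in\mathbb R^d\times\mathbb R^d$, $E(v,x)=V(x)+\frac12|v|^2$, $\mathrm d\mu=\mathrm e^{-E}\mathrm dv\,\mathrm dx$; $\mathcal H(V)$ is the Hessian of $V$ and $|\cdot|_F$ the Frobenius norm. $\mathcal T$ is a subdivision (mesh) of $\mathbb R^d\times\mathbb R^d$ into finite and infinite polytopic (simplicial, box-type or prismatic, or products thereof) elements $T$, and $H^1(\mu,\mathcal T)=\{w\in L_2(\mu):\int_T|\nabla_{v,x}w|^2\,\mathrm d\mu<+\infty\ \text{for all }T\in\mathcal T\}$, the gradient being taken element-wise. $\nabla_x^h$ is the element-wise gradient in $x$ ($\nabla_x^hg$ is the Jacobian of $g$ in $x$). $\Gamma=\bigcup_{T}\partial T$, $\mathrm d\nu=\mathrm e^{-E}\mathrm ds$ with $\mathrm ds$ the Hausdorff surface measure on $\Gamma$; the unit outward normal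 of an element is $\mathbf n=(n_v^T,n_x^T)^T$. On an interface $F=\partial T^+\cap\partial T^-$, $\{g\}=\frac12(g^++g^-)$ and $[g]_x=g^+\otimes n_x^++g^-\otimes n_x^-$ ($d\times d$ matrix), $g^\pm$ being the traces from $T^\pm$.
   Formalization: The Gaussian claim C_1=16 fails for general d; taking C_0=1, the growth bound is stated for d=1, the value C_1=16 for d≤2, and the estimate with constant 16 for d≤3. The mesh is read as locally finite with convex elements, and the integral over Γ is assumed to exist. *)

theory Defs
  imports "HOL-Analysis.Analysis"
begin

text \<open>The usual normalisation: the \<open>n\<close>-dimensional measure is Lebesgue measure on
  \<open>n\<close>-dimensional affine subspaces. Covering sets have to be bounded because
  \<^const>\<open>diameter\<close> is unspecified on unbounded sets.\<close>

definition hausdorff_pre :: "nat \<Rightarrow> real \<Rightarrow> 'a::euclidean_space set \<Rightarrow> ennreal" where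
  "hausdorff_pre n \<delta> A =
     (INF C \<in> {C :: nat \<Rightarrow> 'a set. A \<subseteq> (\<Union>i. C i) \<and> (\<forall>i. bounded (C i) \<and> diameter (C i) \<le> \<delta>)}.
        \<Sum>i. if C i = {} then 0
             else ennreal (unit_ball_vol (real n) * (diameter (C i) / 2) ^ n))"

definition hausdorff_outer :: "nat \<Rightarrow> 'a::euclidean_space set \<Rightarrow> ennreal" where
  "hausdorff_outer n A = (SUP \<delta> \<in> {0<..}. hausdorff_pre n \<delta> A)"

definition hausdorff_measure :: "nat \<Rightarrow> 'a::euclidean_space measure" where
  "hausdorff_measure n = measure_of UNIV (sets borel) (hausdorff_outer n)"

definition surface_measure :: "'a::euclidean_space measure" where
  "surface_measure = hausdorff_measure (DIM('a) - 1)"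

text \<open>Elements are closed convex polyhedra with interior points, bounded or unbounded; hanging
  nodes are allowed. Local finiteness is part of the notion of a mesh: without it a face of one
  element may be a limit of other elements without being shared with any of them.\<close>

definition mesh :: "'a::euclidean_space set set \<Rightarrow> bool" where
  "mesh \<T> \<longleftrightarrow>
     \<Union>\<T> = UNIV \<and>
     (\<forall>T\<in>\<T>. polyhedron T \<and> interior T \<noteq> {}) \<and>
     pairwise (\<lambda>S T. interior S \<inter> interior T = {}) \<T> \<and>
     (\<forall>K. compact K \<longrightarrow> finite {T \<in> \<T>. T \<inter> K \<noteq> {}})"

definition skeleton :: "'a::euclidean_space set set \<Rightarrow> 'a set" where
  "skeleton \<T> = (\<Union>T\<in>\<T>. frontier T)"

text \<open>On a facet of a convex polyhedron the unit outward normal is the only unit vector of the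
  normal cone. The value \<open>0\<close> is taken only on lower-dimensional faces.\<close>

definition outward_normal :: "'a::euclidean_space set \<Rightarrow> 'a \<Rightarrow> 'a" where
  "outward_normal T z =
     (let N = (\<lambda>n. norm n = 1 \<and> (\<forall>y\<in>T. n \<bullet> (y - z) \<le> 0))
      in if \<exists>!n. N n then THE n. N n else 0)"

definition C1_function :: "('a::euclidean_space \<Rightarrow> real) \<Rightarrow> ('a \<Rightarrow> 'a) \<Rightarrow> bool" where
  "C1_function f Df \<longleftrightarrow> (\<forall>z. GDERIV f z :> Df z) \<and> continuous_on UNIV Df"

definition weak_gradient_on ::
    "'a::euclidean_space set \<Rightarrow> ('a \<Rightarrow> real) \<Rightarrow> ('a \<Rightarrow> 'a) \<Rightarrow> bool" where
  "weak_gradient_on S w G \<longleftrightarrow>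
     (\<forall>K. compact K \<and> K \<subseteq> S \<longrightarrow> set_integrable lborel K w \<and> set_integrable lborel K G) \<and>
     (\<forall>\<phi> D\<phi>. C1_function \<phi> D\<phi> \<and> compact (closure {z. \<phi> z \<noteq> 0}) \<and> closure {z. \<phi> z \<noteq> 0} \<subseteq> S \<longrightarrow>
        (LINT z:S|lborel. w z *\<^sub>R D\<phi> z) = - (LINT z:S|lborel. \<phi> z *\<^sub>R G z))"

definition broken_gradient ::
    "'a::euclidean_space set set \<Rightarrow> ('a \<Rightarrow> real) \<Rightarrow> ('a \<Rightarrow> 'a) \<Rightarrow> bool" where
  "broken_gradient \<T> w G \<longleftrightarrow>
     G \<in> borel_measurable borel \<and> (\<forall>T\<in>\<T>. weak_gradient_on (interior T) w G)"

text \<open>The element-wise gradient, determined up to a Lebesgue null set.\<close>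

definition hgrad :: "'a::euclidean_space set set \<Rightarrow> ('a \<Rightarrow> real) \<Rightarrow> 'a \<Rightarrow> 'a" where
  "hgrad \<T> w = (SOME G. broken_gradient \<T> w G)"

text \<open>\<open>u\<close> is the trace on \<open>\<partial>T\<close> of \<open>w\<close>, whose weak gradient in \<open>T\<close> is \<open>G\<close>: the extension by
  continuity of the restriction operator, from functions that are \<open>C\<^sup>1\<close> up to the boundary to
  \<open>H\<^sup>1\<close>. Convergence on bounded pieces suffices because \<open>T\<close> may be unbounded; there the weight
  \<open>exp (-E)\<close> is bounded above and away from zero, so it can be omitted.\<close>

definition is_trace ::
    "'a::euclidean_space set \<Rightarrow> ('a \<Rightarrow> real) \<Rightarrow> ('a \<Rightarrow> 'a) \<Rightarrow> ('a \<Rightarrow> real) \<Rightarrow> bool" where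
  "is_trace T w G u \<longleftrightarrow>
     set_borel_measurable borel (frontier T) u \<and>
     (\<exists>\<phi> D\<phi>. (\<forall>k::nat. C1_function (\<phi> k) (D\<phi> k)) \<and>
        (\<forall>R>0.
          ((\<lambda>k. \<integral>\<^sup>+z\<in>T \<inter> cball 0 R.
              ennreal ((\<phi> k z - w z)\<^sup>2 + (norm (D\<phi> k z - G z))\<^sup>2) \<partial>lborel) \<longlonglongrightarrow> 0) \<and>
          ((\<lambda>k. \<integral>\<^sup>+z\<in>frontier T \<inter> cball 0 R.
              ennreal ((\<phi> k z - u z)\<^sup>2) \<partial>surface_measure) \<longlonglongrightarrow> 0)))"

text \<open>Points of phase space are pairs \<open>(v, x)\<close>.\<close>

type_synonym 'd phase = "(real ^ 'd) \<times> (real ^ 'd)"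

definition energy :: "(real ^ 'd \<Rightarrow> real) \<Rightarrow> 'd::finite phase \<Rightarrow> real" where
  "energy V = (\<lambda>(v, x). V x + (norm v)\<^sup>2 / 2)"

definition mu :: "(real ^ 'd \<Rightarrow> real) \<Rightarrow> 'd::finite phase measure" where
  "mu V = density lborel (\<lambda>z. ennreal (exp (- energy V z)))"

text \<open>Integrals against this measure are taken over the skeleton only.\<close>

definition nu :: "(real ^ 'd \<Rightarrow> real) \<Rightarrow> 'd::finite phase measure" where
  "nu V = density surface_measure (\<lambda>z. ennreal (exp (- energy V z)))"

text \<open>The squared \<open>L\<^sub>2\<close> norm, possibly infinite. On matrices \<^const>\<open>norm\<close> is the Frobenius norm.\<close>

definition L2_sq :: "'a measure \<Rightarrow> ('a \<Rightarrow> 'b::real_normed_vector) \<Rightarrow> ennreal" where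
  "L2_sq M f = (\<integral>\<^sup>+z. ennreal ((norm (f z))\<^sup>2) \<partial>M)"

definition H1_broken ::
    "(real ^ 'd \<Rightarrow> real) \<Rightarrow> 'd::finite phase set set \<Rightarrow> ('d phase \<Rightarrow> real) set" where
  "H1_broken V \<T> =
     {w. w \<in> borel_measurable borel \<and> L2_sq (mu V) w < \<infinity> \<and>
         (\<exists>G. broken_gradient \<T> w G \<and>
              (\<forall>T\<in>\<T>. (\<integral>\<^sup>+z\<in>T. ennreal ((norm (G z))\<^sup>2) \<partial>mu V) < \<infinity>))}"

definition hgrad_x ::
    "'d::finite phase set set \<Rightarrow> ('d phase \<Rightarrow> real ^ 'd) \<Rightarrow> 'd phase \<Rightarrow> real ^ 'd ^ 'd" where
  "hgrad_x \<T> g z = (\<chi> i. snd (hgrad \<T> (\<lambda>y. g y $ i) z))"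

text \<open>Given \<open>V\<close>, the gradient \<open>DV\<close> and the Hessian \<open>HV\<close> are unique.\<close>

definition C2_function ::
    "(real ^ 'd \<Rightarrow> real) \<Rightarrow> (real ^ 'd \<Rightarrow> real ^ 'd) \<Rightarrow> (real ^ 'd \<Rightarrow> real ^ 'd ^ 'd) \<Rightarrow> bool" where
  "C2_function V DV HV \<longleftrightarrow>
     (\<forall>x. GDERIV V x :> DV x) \<and>
     (\<forall>x. (DV has_derivative (\<lambda>h. HV x *v h)) (at x)) \<and>
     continuous_on UNIV HV"

definition tensor :: "real ^ 'm \<Rightarrow> real ^ 'n \<Rightarrow> real ^ 'n ^ 'm" where
  "tensor a b = (\<chi> i j. a $ i * b $ j)"

text \<open>\<open>tr T\<close> is the trace of a function from the element \<open>T\<close>. A point in the relative interior of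
  an interface \<open>\<partial>T\<^sup>+ \<inter> \<partial>T\<^sup>-\<close> of codimension one lies on the boundaries of \<open>T\<^sup>+\<close> and \<open>T\<^sup>-\<close> and of no
  other element, so there the sums below have exactly these two terms. All remaining points of
  the skeleton form a null set of the surface measure.\<close>

definition avg ::
    "'d::finite phase set set \<Rightarrow> ('d phase set \<Rightarrow> 'd phase \<Rightarrow> real ^ 'd) \<Rightarrow> 'd phase \<Rightarrow> real ^ 'd" where
  "avg \<T> tr z = (1 / 2) *\<^sub>R (\<Sum>T\<in>{T \<in> \<T>. z \<in> frontier T}. tr T z)"

definition jump_x ::
    "'d::finite phase set set \<Rightarrow> ('d phase set \<Rightarrow> 'd phase \<Rightarrow> real ^ 'd) \<Rightarrow> 'd phase \<Rightarrow> real ^ 'd ^ 'd"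
  where
  "jump_x \<T> tr z =
     (\<Sum>T\<in>{T \<in> \<T>. z \<in> frontier T}. tensor (tr T z) (snd (outward_normal T z)))"

definition C1_const :: "nat \<Rightarrow> real \<Rightarrow> real" where
  "C1_const d C0 =
     max (2 * C0\<^sup>2 * (1 + 2 * sqrt (real d) + 2 * real d * C0\<^sup>2)) (16 * C0\<^sup>2)"

end

theory Submission
  imports Defs
begin

text \<open>Since \<open>\<nabla>\<^sub>x (exp (-E)) = - exp (-E) \<nabla>V\<close>, element-wise integration by parts gives
  \<open>\<integral> |\<nabla>V|\<^sup>2 |g|\<^sup>2 d\<mu> = \<integral> \<Delta>V |g|\<^sup>2 + 2 g\<^sup>T (\<nabla>\<^sub>x g) \<nabla>V d\<mu> - 2 \<integral>\<^sub>\<Gamma> {g}\<^sup>T [g]\<^sub>x \<nabla>V d\<nu>\<close>, because on an interface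
  \<open>(|g\<^sup>+|\<^sup>2 - |g\<^sup>-|\<^sup>2) n\<^sub>x\<^sup>+ \<cdot> \<nabla>V = 2 {g}\<^sup>T [g]\<^sub>x \<nabla>V\<close>. Adding \<open>4 C\<^sub>0\<^sup>2\<close> times this identity to the integral
  of \<open>|H(V) g|\<^sup>2\<close> leaves a pointwise quadratic inequality in \<open>|\<nabla>V|\<close>, \<open>|g|\<close> and \<open>|\<nabla>\<^sub>x g|\<close>.
  The identity is first proved with the cut-off \<open>(1 - |z|\<^sup>2 / R\<^sup>2)\<^sub>+\<^sup>2\<close>, whose gradient is bounded by a
  multiple of its square root; the resulting coercive estimate shows \<open>|\<nabla>V| |g| \<in> L\<^sub>2(\<mu>)\<close>, and dominated
  convergence removes the cut-off.

  Gauss's theorem on a polyhedron comes from differentiating the integral over translates of the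
  polyhedron, whose indicator is a product of half-space indicators. That the surface measure
  of a hyperplane is Lebesgue measure with the right constant is the isodiametric inequality in one
  direction and Vitali's covering theorem in the other.\<close>

text \<open>The obstacle is that |grad V| |g| is not known to be square integrable, so no term of
  the identity may be absorbed into another before a cut-off is in place. The weight 4 C0^2 leaves
  room for the absorption: of the four copies of C0^2 |grad V|^2 |g|^2 that it provides, one pays
  for the Hessian bound C0^2 (1 + |grad V|)^2, one for the cross term, and two for what is linear in
  |grad V|. The cross term produces the 16 C0^2 in front of |grad_x g|^2; the Laplacian, at most
  sqrt d times the Frobenius norm, brings the dimension into C1. If |grad_x g| is not in L2(mu), the
  right-hand side is infinite.

  Traces are limits of C1 functions, so Gauss's theorem is needed only for those; the limit is taken
  in products of two L2-convergent sequences, inside the elements and on their frontiers.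

  For the Gaussian potential the Hessian has Frobenius norm sqrt d, so C0 = 1 is admissible only for
  d = 1. The constant 16 is reached for d up to 3 from |H(V) g| = |g| and trace d.\<close>

section \<open>Steiner symmetrization and the isodiametric inequality\<close>


text \<open>Fubini in the direction \<open>b\<close> without coordinates: the slab meets every line parallel to \<open>b\<close> in a
  segment of length \<open>1\<close>.\<close>

lemma nn_integral_lborel_slab:
  fixes h :: "'a::euclidean_space \<Rightarrow> ennreal"
  assumes [measurable]: "h \<in> borel_measurable borel" and b: "norm b = 1"
  shows "(\<integral>\<^sup>+z. h z \<partial>lborel) =
    (\<integral>\<^sup>+z. indicator {z. z \<bullet> b \<in> {0..<1}} z * (\<integral>\<^sup>+t. h (z + t *\<^sub>R b) \<partial>lborel) \<partial>lborel)"
proof -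
  have bb: "b \<bullet> b = 1" using b by (simp add: dot_square_norm)
  have "(\<integral>\<^sup>+z. indicator {z. z \<bullet> b \<in> {0..<1}} z * (\<integral>\<^sup>+t. h (z + t *\<^sub>R b) \<partial>lborel) \<partial>lborel)
     = (\<integral>\<^sup>+z. (\<integral>\<^sup>+t. indicator {z. z \<bullet> b \<in> {0..<1}} z * h (z + t *\<^sub>R b) \<partial>lborel) \<partial>lborel)"
    by (intro nn_integral_cong nn_integral_cmult[symmetric]) measurable
  also have "\<dots> = (\<integral>\<^sup>+t. (\<integral>\<^sup>+z. indicator {z. z \<bullet> b \<in> {0..<1}} z * h (z + t *\<^sub>R b) \<partial>lborel) \<partial>lborel)"
    by (intro lborel_pair.Fubini') measurable
  also have "\<dots> = (\<integral>\<^sup>+t. (\<integral>\<^sup>+z. indicator {z. (z - t *\<^sub>R b) \<bullet> b \<in> {0..<1}} z * h z \<partial>lborel) \<partial>lborel)"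
  proof (rule nn_integral_cong)
    fix t :: real
    have "(\<integral>\<^sup>+z. indicator {z. (z - t *\<^sub>R b) \<bullet> b \<in> {0..<1}} z * h z \<partial>lborel)
       = (\<integral>\<^sup>+z. indicator {z. (z - t *\<^sub>R b) \<bullet> b \<in> {0..<1}} z * h z \<partial>(distr lborel borel ((+) (t *\<^sub>R b))))"
      by (simp add: lborel_distr_plus)
    also have "\<dots> = (\<integral>\<^sup>+z. indicator {z. z \<bullet> b \<in> {0..<1}} z * h (z + t *\<^sub>R b) \<partial>lborel)"
      by (subst nn_integral_distr) (auto intro!: nn_integral_cong simp: indicator_def add.commute)
    finally show "(\<integral>\<^sup>+z. indicator {z. z \<bullet> b \<in> {0..<1}} z * h (z + t *\<^sub>R b) \<partial>lborel)
       = (\<integral>\<^sup>+z. indicator {z. (z - t *\<^sub>R b) \<bullet> b \<in> {0..<1}} z * h z \<partial>lborel)" ..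
  qed
  also have "\<dots> = (\<integral>\<^sup>+z. (\<integral>\<^sup>+t. indicator {z. (z - t *\<^sub>R b) \<bullet> b \<in> {0..<1}} z * h z \<partial>lborel) \<partial>lborel)"
    by (intro lborel_pair.Fubini') measurable
  also have "\<dots> = (\<integral>\<^sup>+z. h z \<partial>lborel)"
  proof (rule nn_integral_cong)
    fix z :: 'a
    have "(\<integral>\<^sup>+t. indicator {z. (z - t *\<^sub>R b) \<bullet> b \<in> {0..<1}} z * h z \<partial>lborel)
       = (\<integral>\<^sup>+t. h z * indicator {z \<bullet> b - 1 <.. z \<bullet> b} t \<partial>lborel)"
      by (intro nn_integral_cong) (auto simp: indicator_def inner_diff_left bb)
    also have "\<dots> = h z"
      by (subst nn_integral_cmult_indicator) auto
    finally show "(\<integral>\<^sup>+t. indicator {z. (z - t *\<^sub>R b) \<bullet> b \<in> {0..<1}} z * h z \<partial>lborel) = h z" .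
  qed
  finally show ?thesis ..
qed

definition chord_length :: "'a::euclidean_space \<Rightarrow> 'a set \<Rightarrow> 'a \<Rightarrow> ennreal" where
  "chord_length b A z = emeasure lborel {t::real. z + t *\<^sub>R b \<in> A}"

text \<open>The strict inequality makes every chord an open segment centred on the hyperplane
  orthogonal to \<open>b\<close>. Lines that meet \<open>A\<close> in a null set contribute no
  point, so a point of the symmetrized set always comes with a nonempty chord of
  \<open>A\<close>.\<close>

definition steiner :: "'a::euclidean_space \<Rightarrow> 'a set \<Rightarrow> 'a set" where
  "steiner b A = {z. ennreal (2 * \<bar>z \<bullet> b\<bar>) < chord_length b A z}"

definition reflection :: "'a::real_inner \<Rightarrow> 'a \<Rightarrow> 'a" where
  "reflection b z = z - (2 * (z \<bullet> b)) *\<^sub>R b"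

lemma chord_length_eq_nn_integral:
  fixes b :: "'a::euclidean_space"
  assumes [measurable]: "A \<in> sets borel"
  shows "chord_length b A z = (\<integral>\<^sup>+t. indicator A (z + t *\<^sub>R b) \<partial>lborel)"
proof -
  have m: "{t::real. z + t *\<^sub>R b \<in> A} \<in> sets borel" by measurable
  have "chord_length b A z = (\<integral>\<^sup>+t. indicator {t::real. z + t *\<^sub>R b \<in> A} t \<partial>lborel)"
    unfolding chord_length_def using m by (subst nn_integral_indicator) auto
  thus ?thesis by (simp add: indicator_def)
qed

lemma measurable_chord_length [measurable]:
  fixes b :: "'a::euclidean_space"
  assumes [measurable]: "A \<in> sets borel"
  shows "chord_length b A \<in> borel_measurable borel"
proof -
  have "(\<lambda>z. \<integral>\<^sup>+t. indicator A (z + t *\<^sub>R b) \<partial>lborel) \<in> borel_measurable borel"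
    by measurable
  moreover have "chord_length b A = (\<lambda>z. \<integral>\<^sup>+t. indicator A (z + t *\<^sub>R b) \<partial>lborel)"
    using chord_length_eq_nn_integral[OF assms] by blast
  ultimately show ?thesis by simp
qed

lemma steiner_measurable [measurable]:
  assumes [measurable]: "A \<in> sets borel"
  shows "steiner b A \<in> sets borel"
  unfolding steiner_def by measurable

lemma chord_length_add:
  fixes b :: "'a::euclidean_space"
  assumes [measurable]: "A \<in> sets borel"
  shows "chord_length b A (z + s *\<^sub>R b) = chord_length b A z"
proof -
  have "chord_length b A (z + s *\<^sub>R b) = (\<integral>\<^sup>+t. indicator A (z + (s + 1 * t) *\<^sub>R b) \<partial>lborel)"
    by (simp add: chord_length_eq_nn_integral algebra_simps)
  also have "\<dots> = chord_length b A z"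
    unfolding chord_length_eq_nn_integral[OF assms]
    by (subst nn_integral_real_affine[of "\<lambda>t. indicator A (z + t *\<^sub>R b)" 1 s]) simp_all
  finally show ?thesis .
qed

lemma emeasure_eq_slab_chord_length:
  fixes b :: "'a::euclidean_space"
  assumes A[measurable]: "A \<in> sets borel" and b: "norm b = 1"
  shows "emeasure lborel A =
    (\<integral>\<^sup>+z. indicator {z. z \<bullet> b \<in> {0..<1}} z * chord_length b A z \<partial>lborel)"
proof -
  have "emeasure lborel A = (\<integral>\<^sup>+z. indicator A z \<partial>lborel)" by simp
  also have "\<dots> = (\<integral>\<^sup>+z. indicator {z. z \<bullet> b \<in> {0..<1}} z * chord_length b A z \<partial>lborel)"
    using nn_integral_lborel_slab[OF _ b, of "indicator A"]
    by (simp add: chord_length_eq_nn_integral)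
  finally show ?thesis .
qed

lemma chord_length_steiner:
  fixes b :: "'a::euclidean_space"
  assumes A[measurable]: "A \<in> sets borel" and b: "norm b = 1"
  shows "chord_length b (steiner b A) z = chord_length b A z"
proof -
  have bb: "b \<bullet> b = 1" using b by (simp add: dot_square_norm)
  have "{t. z + t *\<^sub>R b \<in> steiner b A} = {t. ennreal (2 * \<bar>z \<bullet> b + t\<bar>) < chord_length b A z}"
    by (simp add: steiner_def chord_length_add inner_add_left bb)
  also have "emeasure lborel \<dots> = chord_length b A z"
  proof (cases "chord_length b A z")
    case (real r)
    have "{t. ennreal (2 * \<bar>z \<bullet> b + t\<bar>) < chord_length b A z} = {- (z \<bullet> b) - r / 2 <..< - (z \<bullet> b) + r / 2}"
      using real by (auto simp: ennreal_less_iff abs_real_def field_simps split: if_splits)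
    thus ?thesis using real by simp
  qed simp
  finally show ?thesis by (simp add: chord_length_def)
qed

lemma emeasure_steiner:
  fixes b :: "'a::euclidean_space"
  assumes [measurable]: "A \<in> sets borel" and b: "norm b = 1"
  shows "emeasure lborel (steiner b A) = emeasure lborel A"
  using emeasure_eq_slab_chord_length[OF assms]
    emeasure_eq_slab_chord_length[OF steiner_measurable[OF assms(1)] b, of b]
  by (simp add: chord_length_steiner[OF assms])

lemma emeasure_lborel_le_diff:
  fixes S :: "real set"
  assumes "S \<noteq> {}" and "\<And>s. s \<in> S \<Longrightarrow> a \<le> s" and "\<And>s. s \<in> S \<Longrightarrow> s \<le> b"
  shows "emeasure lborel S \<le> ennreal (Sup S - Inf S)"
proof -
  have bdd: "bdd_above S" "bdd_below S" using assms by (meson bdd_aboveI bdd_belowI)+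
  have "S \<subseteq> {Inf S..Sup S}" using bdd by (auto intro: cInf_lower cSup_upper)
  hence "emeasure lborel S \<le> emeasure lborel {Inf S..Sup S}" by (intro emeasure_mono) auto
  also have "Inf S \<le> Sup S" using assms(1) bdd by (rule cInf_le_cSup)
  hence "emeasure lborel {Inf S..Sup S} = ennreal (Sup S - Inf S)" by simp
  finally show ?thesis .
qed

text \<open>Each measure is at most \<open>Sup - Inf\<close>. Regrouped, the sum of the two is (Sup
  S - Inf S') + (Sup S' - Inf S); the brackets are at most M - \<beta> and M + \<beta>, so the shift
  cancels.\<close>

lemma chord_sum_le:
  fixes S S' :: "real set"
  assumes ne: "S \<noteq> {}" "S' \<noteq> {}"
    and M: "\<And>s s'. s \<in> S \<Longrightarrow> s' \<in> S' \<Longrightarrow> \<bar>\<beta> + s - s'\<bar> \<le> M"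
  shows "emeasure lborel S + emeasure lborel S' \<le> ennreal (2 * M)"
proof -
  obtain s0 s0' where s0: "s0 \<in> S" "s0' \<in> S'" using ne by auto
  have b1: "s0' - \<beta> - M \<le> s" "s \<le> s0' - \<beta> + M" if "s \<in> S" for s using M[OF that s0(2)] by auto
  have b2: "s0 + \<beta> - M \<le> s" "s \<le> s0 + \<beta> + M" if "s \<in> S'" for s using M[OF s0(1) that] by auto
  have 1: "Sup S \<le> Inf S' - \<beta> + M"
  proof (rule cSup_least[OF ne(1)])
    fix s assume s: "s \<in> S"
    have "s + \<beta> - M \<le> Inf S'" by (rule cInf_greatest[OF ne(2)]) (use M[OF s] in fastforce)
    thus "s \<le> Inf S' - \<beta> + M" by simp
  qed
  have 2: "Sup S' \<le> Inf S + \<beta> + M"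
  proof (rule cSup_least[OF ne(2)])
    fix s assume s: "s \<in> S'"
    have "s - \<beta> - M \<le> Inf S" by (rule cInf_greatest[OF ne(1)]) (use M[OF _ s] in fastforce)
    thus "s \<le> Inf S + \<beta> + M" by simp
  qed
  have i: "Inf S \<le> Sup S" "Inf S' \<le> Sup S'"
    using ne b1 b2 by (auto intro!: cInf_le_cSup bdd_aboveI bdd_belowI)
  have "emeasure lborel S + emeasure lborel S' \<le> ennreal (Sup S - Inf S) + ennreal (Sup S' - Inf S')"
    using ne b1 b2 by (intro add_mono emeasure_lborel_le_diff) auto
  also have "\<dots> = ennreal (Sup S - Inf S + (Sup S' - Inf S'))"
    using i by (subst ennreal_plus) auto
  also have "\<dots> \<le> ennreal (2 * M)" using 1 2 by (intro ennreal_leI) auto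
  finally show ?thesis .
qed

text \<open>The part of z - z' orthogonal to \<open>b\<close> is the same for all pairs of points on
  the two chords of \<open>A\<close>. Hence the components along \<open>b\<close> of such pairs
  differ by at most M = sqrt (D^2 - |orthogonal part|^2), and \<open>chord_sum_le\<close> turns this
  into a bound by M for the two centred segments, in particular for the component \<beta> of z - z'
  itself.\<close>

lemma steiner_norm_diff_le:
  fixes b :: "'a::euclidean_space"
  assumes A: "A \<in> sets borel" and b: "norm b = 1"
    and D: "\<And>z z'. z \<in> A \<Longrightarrow> z' \<in> A \<Longrightarrow> norm (z - z') \<le> D"
    and z: "z \<in> steiner b A" "z' \<in> steiner b A"
  shows "norm (z - z') \<le> D"
proof -
  have bb: "b \<bullet> b = 1" using b by (simp add: dot_square_norm)
  let ?S = "{t. z + t *\<^sub>R b \<in> A}" and ?S' = "{t. z' + t *\<^sub>R b \<in> A}"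
  define \<beta> where "\<beta> = (z - z') \<bullet> b"
  have l: "ennreal (2 * \<bar>z \<bullet> b\<bar>) < emeasure lborel ?S" "ennreal (2 * \<bar>z' \<bullet> b\<bar>) < emeasure lborel ?S'"
    using z by (auto simp: steiner_def chord_length_def)
  have ne: "?S \<noteq> {}" "?S' \<noteq> {}" using l by (auto simp del: Collect_empty_eq)
  have key: "(\<beta> + s - s')\<^sup>2 + (norm (z - z'))\<^sup>2 - \<beta>\<^sup>2 \<le> D\<^sup>2" if "s \<in> ?S" "s' \<in> ?S'" for s s'
  proof -
    have "norm (z + s *\<^sub>R b - (z' + s' *\<^sub>R b)) \<le> D" using D that by auto
    hence "(norm (z + s *\<^sub>R b - (z' + s' *\<^sub>R b)))\<^sup>2 \<le> D\<^sup>2" by (intro power_mono) auto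
    also have "z + s *\<^sub>R b - (z' + s' *\<^sub>R b) = (z - z') + (s - s') *\<^sub>R b" by (simp add: algebra_simps)
    also have "(norm \<dots>)\<^sup>2 = (norm (z - z'))\<^sup>2 + 2 * (s - s') * \<beta> + (s - s')\<^sup>2"
      unfolding power2_norm_eq_inner \<beta>_def by (simp add: inner_simps inner_commute bb power2_eq_square algebra_simps)
    finally show ?thesis by (simp add: power2_eq_square algebra_simps)
  qed
  obtain s s' where "s \<in> ?S" "s' \<in> ?S'" using ne by blast
  hence D0: "0 \<le> D" using D[of "z + s *\<^sub>R b" "z + s *\<^sub>R b"] by auto
  define M where "M = sqrt (D\<^sup>2 - (norm (z - z'))\<^sup>2 + \<beta>\<^sup>2)"
  have M: "\<bar>\<beta> + s - s'\<bar> \<le> M" if "s \<in> ?S" "s' \<in> ?S'" for s s'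
    unfolding M_def using key[OF that] by (intro real_le_rsqrt) auto
  have "ennreal (2 * \<bar>z \<bullet> b\<bar> + 2 * \<bar>z' \<bullet> b\<bar>) = ennreal (2 * \<bar>z \<bullet> b\<bar>) + ennreal (2 * \<bar>z' \<bullet> b\<bar>)"
    by (subst ennreal_plus) auto
  also have "\<dots> \<le> emeasure lborel ?S + emeasure lborel ?S'" using l by (intro add_mono) auto
  also have "\<dots> \<le> ennreal (2 * M)" by (rule chord_sum_le[OF ne M])
  finally have "2 * \<bar>z \<bullet> b\<bar> + 2 * \<bar>z' \<bullet> b\<bar> \<le> 2 * M"
    using M ne by (subst (asm) ennreal_le_iff) (force simp: order_trans[OF abs_ge_zero])+
  hence "\<bar>\<beta>\<bar> \<le> M" by (simp add: \<beta>_def inner_diff_left)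
  moreover have "0 \<le> D\<^sup>2 - (norm (z - z'))\<^sup>2 + \<beta>\<^sup>2"
    using key \<open>s \<in> ?S\<close> \<open>s' \<in> ?S'\<close> by (smt (verit) zero_le_power2)
  ultimately have "\<beta>\<^sup>2 \<le> D\<^sup>2 - (norm (z - z'))\<^sup>2 + \<beta>\<^sup>2"
    unfolding M_def by (metis abs_ge_zero power2_abs power_mono real_sqrt_pow2)
  hence "(norm (z - z'))\<^sup>2 \<le> D\<^sup>2" by simp
  thus ?thesis using D0 by (rule power2_le_imp_le)
qed

lemma steiner_reflection_same:
  fixes b :: "'a::euclidean_space"
  assumes A: "A \<in> sets borel" and b: "norm b = 1" and z: "z \<in> steiner b A"
  shows "reflection b z \<in> steiner b A"
proof -
  have bb: "b \<bullet> b = 1" using b by (simp add: dot_square_norm)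
  have "chord_length b A (reflection b z) = chord_length b A z"
    using chord_length_add[OF A, of b z "- 2 * (z \<bullet> b)"] by (simp add: reflection_def)
  thus ?thesis using z by (simp add: steiner_def reflection_def inner_diff_left bb)
qed

text \<open>Reflection in \<open>c\<close> commutes with translation along \<open>b\<close>, so the
  lines through a point and through its mirror image meet \<open>A\<close> at the same parameters.
  Symmetries gained in earlier directions therefore survive the symmetrization along
  \<open>b\<close>.\<close>

lemma steiner_reflection_orthogonal:
  fixes b c :: "'a::euclidean_space"
  assumes c: "norm c = 1" "b \<bullet> c = 0" and R: "\<And>z. z \<in> A \<Longrightarrow> reflection c z \<in> A"
    and z: "z \<in> steiner b A"
  shows "reflection c z \<in> steiner b A"
proof -
  have cc: "c \<bullet> c = 1" using c by (simp add: dot_square_norm)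
  have inv: "reflection c (reflection c y) = y" for y
    by (simp add: reflection_def inner_diff_left cc)
  have "{t. reflection c z + t *\<^sub>R b \<in> A} = {t. z + t *\<^sub>R b \<in> A}"
  proof -
    have "reflection c z + t *\<^sub>R b = reflection c (z + t *\<^sub>R b)" for t
      using c by (simp add: reflection_def inner_add_left algebra_simps)
    moreover have "reflection c y \<in> A \<longleftrightarrow> y \<in> A" for y using R inv by metis
    ultimately show ?thesis by simp
  qed
  hence "chord_length b A (reflection c z) = chord_length b A z" by (simp add: chord_length_def)
  moreover have "reflection c z \<bullet> b = z \<bullet> b" using c by (simp add: reflection_def inner_diff_left inner_commute[of c])
  ultimately show ?thesis using z by (simp add: steiner_def)
qed

lemma steiner_symmetrization:
  fixes A B :: "'a::euclidean_space set"
  assumes "finite B" "B \<subseteq> Basis" and A: "A \<in> sets borel"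
    and D: "\<And>z z'. z \<in> A \<Longrightarrow> z' \<in> A \<Longrightarrow> norm (z - z') \<le> D"
  shows "\<exists>A'\<in>sets borel. emeasure lborel A' = emeasure lborel A \<and>
    (\<forall>z\<in>A'. \<forall>z'\<in>A'. norm (z - z') \<le> D) \<and> (\<forall>c\<in>B. \<forall>z\<in>A'. reflection c z \<in> A')"
  using assms(1,2)
proof (induction B rule: finite_induct)
  case empty
  have "(\<forall>z\<in>A. \<forall>z'\<in>A. norm (z - z') \<le> D)" using D by auto
  thus ?case using A by auto
next
  case (insert b B)
  then obtain A' where A': "A' \<in> sets borel" "emeasure lborel A' = emeasure lborel A"
    "\<forall>z\<in>A'. \<forall>z'\<in>A'. norm (z - z') \<le> D" "\<forall>c\<in>B. \<forall>z\<in>A'. reflection c z \<in> A'" by auto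
  have b: "norm b = 1" using insert by auto
  have "reflection c z \<in> steiner b A'" if "c \<in> insert b B" "z \<in> steiner b A'" for c z
  proof (cases "c = b")
    case True
    thus ?thesis using steiner_reflection_same A' b that by auto
  next
    case False
    hence "c \<in> B" "norm c = 1" "b \<bullet> c = 0" using that insert by (auto simp: inner_not_same_Basis)
    thus ?thesis using steiner_reflection_orthogonal[of c b A' z] A' that by auto
  qed
  thus ?case using A' b steiner_norm_diff_le[OF A'(1) b, of D]
    by (intro bexI[of _ "steiner b A'"]) (auto simp: emeasure_steiner)
qed

text \<open>A set of diameter D need not fit into a ball of radius D / 2, as an equilateral triangle
  shows. After symmetrization in all coordinate directions it does: the composition of all
  coordinate reflections maps z to - z, so 2 |z| is a distance between two points of the
  set.\<close>

theorem isodiametric: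
  fixes A :: "'a::euclidean_space set"
  assumes A: "A \<in> sets borel" and D: "\<And>z z'. z \<in> A \<Longrightarrow> z' \<in> A \<Longrightarrow> norm (z - z') \<le> D"
    and "0 \<le> D"
  shows "emeasure lborel A \<le> ennreal (unit_ball_vol (real DIM('a)) * (D / 2) ^ DIM('a))"
proof -
  have "\<exists>A'\<in>sets (borel :: 'a measure). emeasure lborel A' = emeasure lborel A \<and>
    (\<forall>z\<in>A'. \<forall>z'\<in>A'. norm (z - z') \<le> D) \<and> (\<forall>c\<in>Basis. \<forall>z\<in>A'. reflection c z \<in> A')"
    by (rule steiner_symmetrization[OF finite_Basis order_refl A]) (rule D)
  then obtain A' :: "'a set" where "A' \<in> sets borel" "emeasure lborel A' = emeasure lborel A \<and>
    (\<forall>z\<in>A'. \<forall>z'\<in>A'. norm (z - z') \<le> D) \<and> (\<forall>c\<in>Basis. \<forall>z\<in>A'. reflection c z \<in> A')"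
    by (rule bexE)
  then have A': "A' \<in> sets borel" "emeasure lborel A' = emeasure lborel A"
    "\<And>z z'. z\<in>A' \<Longrightarrow> z'\<in>A' \<Longrightarrow> norm (z - z') \<le> D" "\<And>c z. c\<in>Basis \<Longrightarrow> z\<in>A' \<Longrightarrow> reflection c z \<in> A'"
    by auto
  have sym: "z - (\<Sum>c\<in>B. (2 * (z \<bullet> c)) *\<^sub>R c) \<in> A'" if "finite B" "B \<subseteq> Basis" "z \<in> A'" for B z
    using that
  proof (induction B rule: finite_induct)
    case (insert b B)
    let ?y = "z - (\<Sum>c\<in>B. (2 * (z \<bullet> c)) *\<^sub>R c)"
    have "(\<Sum>c\<in>B. (2 * (z \<bullet> c)) * (c \<bullet> b)) = 0"
      using insert by (intro sum.neutral) (metis inner_not_same_Basis insert_subset mult_zero_right subset_iff)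
    hence "?y \<bullet> b = z \<bullet> b" by (simp add: inner_diff_left inner_sum_left)
    hence "reflection b ?y = z - (\<Sum>c\<in>insert b B. (2 * (z \<bullet> c)) *\<^sub>R c)"
      using insert by (simp add: reflection_def)
    thus ?case using insert A'(4)[of b ?y] by auto
  qed auto
  have "A' \<subseteq> cball 0 (D / 2)"
  proof
    fix z assume z: "z \<in> A'"
    have "(\<Sum>c\<in>Basis. (2 * (z \<bullet> c)) *\<^sub>R c) = 2 *\<^sub>R (\<Sum>c\<in>Basis. (z \<bullet> c) *\<^sub>R c)"
      by (simp add: scaleR_sum_right)
    hence "z - (\<Sum>c\<in>Basis. (2 * (z \<bullet> c)) *\<^sub>R c) = - z"
      by (simp add: euclidean_representation scaleR_2)
    hence "- z \<in> A'" using sym[OF finite_Basis order_refl z] by simp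
    hence "norm (z - (- z)) \<le> D" using A'(3) z by blast
    hence "2 * norm z \<le> D" by (simp add: scaleR_2[symmetric] del: scaleR_2)
    thus "z \<in> cball 0 (D / 2)" by simp
  qed
  hence "emeasure lborel A' \<le> emeasure lborel (cball (0::'a) (D / 2))" by (intro emeasure_mono) auto
  thus ?thesis using A'(2) \<open>0 \<le> D\<close> by (simp add: emeasure_cball)
qed

section \<open>Hausdorff measure and Lebesgue measure\<close>


text \<open>The case distinction matters for n = 0, where the empty set would otherwise cost 1
  because a zeroth power is 1.\<close>

definition hausdorff_size :: "nat \<Rightarrow> 'a::euclidean_space set \<Rightarrow> ennreal" where
  "hausdorff_size n C =
     (if C = {} then 0 else ennreal (unit_ball_vol (real n) * (diameter C / 2) ^ n))"

lemma hausdorff_size_empty [simp]: "hausdorff_size n {} = 0"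
  by (simp add: hausdorff_size_def)

section \<open>Covers and countable subadditivity\<close>

lemma hausdorff_pre_le:
  assumes "A \<subseteq> (\<Union>i. C i)" "\<And>i. bounded (C i)" "\<And>i. diameter (C i) \<le> \<delta>"
  shows "hausdorff_pre n \<delta> A \<le> (\<Sum>i::nat. hausdorff_size n (C i))"
  unfolding hausdorff_pre_def hausdorff_size_def[symmetric] by (rule INF_lower) (use assms in auto)

lemma hausdorff_pre_greatest:
  assumes "\<And>C. A \<subseteq> (\<Union>i. C i) \<Longrightarrow> (\<And>i. bounded (C i)) \<Longrightarrow> (\<And>i. diameter (C i) \<le> \<delta>) \<Longrightarrow>
    x \<le> (\<Sum>i::nat. hausdorff_size n (C i))"
  shows "x \<le> hausdorff_pre n \<delta> A"
  unfolding hausdorff_pre_def hausdorff_size_def[symmetric] by (rule INF_greatest) (use assms in auto)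

lemma hausdorff_pre_close:
  assumes "hausdorff_pre n \<delta> A < x"
  obtains C :: "nat \<Rightarrow> 'a::euclidean_space set"
  where "A \<subseteq> (\<Union>i. C i)" "\<And>i. bounded (C i)" "\<And>i. diameter (C i) \<le> \<delta>"
    "(\<Sum>i. hausdorff_size n (C i)) < x"
  using assms unfolding hausdorff_pre_def hausdorff_size_def[symmetric] INF_less_iff by auto

lemma hausdorff_pre_empty: "0 < \<delta> \<Longrightarrow> hausdorff_pre n \<delta> {} = 0"
  using hausdorff_pre_le[of "{}" "\<lambda>_. {}" \<delta> n] by simp

lemma hausdorff_pre_mono: "A \<subseteq> B \<Longrightarrow> hausdorff_pre n \<delta> A \<le> hausdorff_pre n \<delta> B"
  by (rule hausdorff_pre_greatest, rule hausdorff_pre_le) auto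

lemma hausdorff_pre_antimono: "\<delta>' \<le> \<delta> \<Longrightarrow> hausdorff_pre n \<delta> A \<le> hausdorff_pre n \<delta>' A"
  by (rule hausdorff_pre_greatest, rule hausdorff_pre_le) (auto intro: order_trans)

lemma hausdorff_pre_UN_le:
  "hausdorff_pre n \<delta> (\<Union>i. A i) \<le> (\<Sum>i::nat. hausdorff_pre n \<delta> (A i))"
proof (rule ennreal_le_epsilon)
  fix e :: real assume e: "0 < e" and fin: "(\<Sum>i. hausdorff_pre n \<delta> (A i)) < top"
  then have *: "\<And>i. hausdorff_pre n \<delta> (A i) < hausdorff_pre n \<delta> (A i) + e * (1/2)^Suc i"
    by (auto simp add: less_top dest!: ennreal_suminf_lessD)
  have "\<exists>C. A i \<subseteq> (\<Union>j. C j) \<and> (\<forall>j. bounded (C j)) \<and> (\<forall>j. diameter (C j) \<le> \<delta>) \<and>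
      (\<Sum>j::nat. hausdorff_size n (C j)) \<le> hausdorff_pre n \<delta> (A i) + e * (1/2)^Suc i" for i
    using hausdorff_pre_close[OF *[of i]] by (metis less_imp_le)
  then obtain C where C: "\<And>i. A i \<subseteq> (\<Union>j. C i j)" "\<And>i j. bounded (C i j)"
      "\<And>i j. diameter (C i j) \<le> \<delta>"
      "\<And>i. (\<Sum>j::nat. hausdorff_size n (C i j)) \<le> hausdorff_pre n \<delta> (A i) + e * (1/2)^Suc i"
    by metis
  define D where "D = case_prod C o prod_decode"
  have "(\<Union>i. A i) \<subseteq> (\<Union>i. D i)"
    using C(1) by (auto simp add: D_def subset_eq) (metis prod.case prod_encode_inverse)
  hence "hausdorff_pre n \<delta> (\<Union>i. A i) \<le> (\<Sum>i. hausdorff_size n (D i))"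
    using C by (intro hausdorff_pre_le) (auto simp: D_def split: prod.split)
  also have "\<dots> = (\<Sum>i. hausdorff_size n (case_prod C (prod_decode i)))" by (simp add: D_def)
  also have "\<dots> = (\<Sum>i. \<Sum>j. hausdorff_size n (C i j))"
    by (rule suminf_ennreal_2dimen[of _ "\<lambda>p. hausdorff_size n (case_prod C p)"]) auto
  also have "\<dots> \<le> (\<Sum>i. hausdorff_pre n \<delta> (A i) + e * (1/2) ^ Suc i)"
    by (intro suminf_le allI C) auto
  also have "... = (\<Sum>i. hausdorff_pre n \<delta> (A i)) + (\<Sum>i. ennreal e * ennreal ((1/2) ^ Suc i))"
    using \<open>0 < e\<close> by (subst suminf_add[symmetric])
      (auto simp del: ennreal_suminf_cmult simp add: ennreal_mult[symmetric])
  also have "\<dots> = (\<Sum>i. hausdorff_pre n \<delta> (A i)) + e"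
    unfolding ennreal_suminf_cmult
    by (subst suminf_ennreal_eq[OF zero_le_power power_half_series]) auto
  finally show "hausdorff_pre n \<delta> (\<Union>i. A i) \<le> (\<Sum>i. hausdorff_pre n \<delta> (A i)) + e" .
qed

lemma hausdorff_outer_mono: "A \<subseteq> B \<Longrightarrow> hausdorff_outer n A \<le> hausdorff_outer n B"
  unfolding hausdorff_outer_def by (intro SUP_mono) (auto intro: hausdorff_pre_mono)

lemma hausdorff_outer_empty: "hausdorff_outer n {} = 0"
  unfolding hausdorff_outer_def by (intro antisym SUP_least) (auto simp: hausdorff_pre_empty)

lemma hausdorff_outer_UN_le:
  "hausdorff_outer n (\<Union>i. A i) \<le> (\<Sum>i::nat. hausdorff_outer n (A i))"
proof -
  have "hausdorff_pre n \<delta> (\<Union>i. A i) \<le> (\<Sum>i::nat. hausdorff_outer n (A i))" if "\<delta> > 0" for \<delta>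
  proof -
    have "hausdorff_pre n \<delta> (\<Union>i. A i) \<le> (\<Sum>i::nat. hausdorff_pre n \<delta> (A i))"
      by (rule hausdorff_pre_UN_le)
    also have "\<dots> \<le> (\<Sum>i::nat. hausdorff_outer n (A i))"
      unfolding hausdorff_outer_def using that by (intro suminf_le SUP_upper) auto
    finally show ?thesis .
  qed
  thus ?thesis by (subst hausdorff_outer_def) (auto intro: SUP_least)
qed

lemma outer_measure_space_hausdorff: "outer_measure_space (Pow UNIV) (hausdorff_outer n)"
  unfolding outer_measure_space_def positive_def increasing_def countably_subadditive_def
  by (auto simp: hausdorff_outer_empty intro: hausdorff_outer_mono hausdorff_outer_UN_le)

lemma hausdorff_outer_Un_le:
  "hausdorff_outer n (A \<union> B) \<le> hausdorff_outer n A + hausdorff_outer n B"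
proof -
  interpret algebra UNIV "Pow (UNIV::'a set)" by (rule algebra_Pow)
  have "subadditive (Pow UNIV) (hausdorff_outer n :: 'a set \<Rightarrow> _)"
    using outer_measure_space_hausdorff[of n, unfolded outer_measure_space_def]
    by (intro countably_subadditive_subadditive) auto
  hence "\<And>x y. x \<inter> y = {} \<Longrightarrow> hausdorff_outer n (x \<union> y) \<le> hausdorff_outer n x + hausdorff_outer n (y :: 'a set)"
    by (auto simp: subadditive_def)
  from this[of A "B - A"] have "hausdorff_outer n (A \<union> B) \<le> hausdorff_outer n A + hausdorff_outer n (B - A)"
    by simp
  also have "\<dots> \<le> hausdorff_outer n A + hausdorff_outer n B"
    by (intro add_mono hausdorff_outer_mono) auto
  finally show ?thesis .
qed

lemma hausdorff_outer_ge_pre: "0 < \<delta> \<Longrightarrow> hausdorff_pre n \<delta> A \<le> hausdorff_outer n A"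
  unfolding hausdorff_outer_def by (rule SUP_upper) auto

section \<open>Additivity on separated sets and measurability of closed sets\<close>

lemma hausdorff_outer_small:
  assumes "0 < \<epsilon>"
  shows "hausdorff_outer n A = (SUP \<delta>\<in>{0<..<\<epsilon>}. hausdorff_pre n \<delta> A)"
  unfolding hausdorff_outer_def
proof (rule SUP_eq)
  fix \<delta> :: real assume "\<delta> \<in> {0<..}"
  thus "\<exists>j\<in>{0<..<\<epsilon>}. hausdorff_pre n \<delta> A \<le> hausdorff_pre n j A"
    using assms by (intro bexI[of _ "min \<delta> (\<epsilon> / 2)"] hausdorff_pre_antimono) auto
qed auto

text \<open>A set of diameter at most \<delta> cannot meet both \<open>A\<close> and
  \<open>B\<close>, so every cover of the union splits into a cover of \<open>A\<close> and a cover
  of \<open>B\<close> that share no nonempty member.\<close>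

lemma hausdorff_pre_Un_separated:
  assumes sep: "\<And>x y. x \<in> A \<Longrightarrow> y \<in> B \<Longrightarrow> \<delta> < dist x y"
  shows "hausdorff_pre n \<delta> A + hausdorff_pre n \<delta> B \<le> hausdorff_pre n \<delta> (A \<union> B)"
proof (rule hausdorff_pre_greatest)
  fix C :: "nat \<Rightarrow> 'a set"
  assume C: "A \<union> B \<subseteq> (\<Union>i. C i)" "\<And>i. bounded (C i)" "\<And>i. diameter (C i) \<le> \<delta>"
  define CA where "CA i = (if C i \<inter> A = {} then {} else C i)" for i
  define CB where "CB i = (if C i \<inter> B = {} then {} else C i)" for i
  have \<delta>: "0 \<le> \<delta>" using C(3)[of 0] diameter_ge_0[OF C(2)[of 0]] by simp
  have "hausdorff_pre n \<delta> A + hausdorff_pre n \<delta> B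
     \<le> (\<Sum>i. hausdorff_size n (CA i)) + (\<Sum>i. hausdorff_size n (CB i))"
    using C \<delta> by (intro add_mono hausdorff_pre_le) (fastforce simp: CA_def CB_def split: if_splits)+
  also have "\<dots> = (\<Sum>i. hausdorff_size n (CA i) + hausdorff_size n (CB i))"
    by (rule suminf_add) auto
  also have "\<dots> \<le> (\<Sum>i. hausdorff_size n (C i))"
  proof (intro suminf_le)
    fix i
    have "C i \<inter> A = {} \<or> C i \<inter> B = {}"
      using sep diameter_bounded_bound[OF C(2)[of i]] C(3)[of i] by fastforce
    thus "hausdorff_size n (CA i) + hausdorff_size n (CB i) \<le> hausdorff_size n (C i)"
      by (auto simp: CA_def CB_def)
  qed auto
  finally show "hausdorff_pre n \<delta> A + hausdorff_pre n \<delta> B \<le> (\<Sum>i. hausdorff_size n (C i))" .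
qed

lemma hausdorff_outer_Un_separated:
  assumes "0 < \<epsilon>" and sep: "\<And>x y. x \<in> A \<Longrightarrow> y \<in> B \<Longrightarrow> \<epsilon> \<le> dist x y"
  shows "hausdorff_outer n A + hausdorff_outer n B \<le> hausdorff_outer n (A \<union> B)"
proof -
  have "hausdorff_outer n A + hausdorff_outer n B
     = (SUP \<delta>\<in>{0<..<\<epsilon>}. hausdorff_pre n \<delta> A + hausdorff_pre n \<delta> B)"
    unfolding hausdorff_outer_small[OF assms(1)]
  proof (rule SUP_add_directed_ennreal[symmetric])
    fix i j assume "i \<in> {0<..<\<epsilon>}" "j \<in> {0<..<\<epsilon>}"
    thus "\<exists>k\<in>{0<..<\<epsilon>}. hausdorff_pre n i A + hausdorff_pre n j B \<le> hausdorff_pre n k A + hausdorff_pre n k B"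
      by (intro bexI[of _ "min i j"] add_mono hausdorff_pre_antimono) auto
  qed
  also have "\<dots> \<le> hausdorff_outer n (A \<union> B)"
    unfolding hausdorff_outer_small[OF assms(1)]
    using sep by (intro SUP_mono) (force intro!: hausdorff_pre_Un_separated)
  finally show ?thesis .
qed

text \<open>Caratheodory's criterion: the layers at distance between \<open>1 / (k + 2)\<close> and \<open>1 / (k + 1)\<close>
  from \<open>F\<close> have summable outer measure, because those of equal parity are separated.\<close>

lemma closed_lambda_system_hausdorff:
  fixes F :: "'a::euclidean_space set"
  assumes F: "closed F"
  shows "F \<in> lambda_system UNIV (Pow UNIV) (hausdorff_outer n)"
proof -
  let ?H = "hausdorff_outer n :: 'a set \<Rightarrow> ennreal"
  have ge: "?H (X \<inter> F) + ?H (X - F) \<le> ?H X" if ne: "F \<noteq> {}" and fin: "?H X < \<infinity>" for X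
  proof -
    define d where "d x = infdist x F" for x
    have d0: "0 \<le> d x" for x by (simp add: d_def infdist_nonneg)
    have d_tri: "d x \<le> d y + dist x y" for x y by (simp add: d_def infdist_triangle)
    have dF: "d x = 0" if "x \<in> F" for x using that by (simp add: d_def)
    have dpos: "0 < d x" if "x \<notin> F" for x
      using that d0[of x] in_closed_iff_infdist_zero[OF F ne, of x] by (auto simp: d_def)
    define Y where "Y k = {x\<in>X. 1 / (real k + 1) \<le> d x}" for k
    define R where "R k = {x\<in>X. 1 / (real k + 2) \<le> d x \<and> d x < 1 / (real k + 1)}" for k
    have sepR: "?H (\<Union>i<m. R (2 * i + p)) + ?H (R (2 * m + p))
      \<le> ?H ((\<Union>i<m. R (2 * i + p)) \<union> R (2 * m + p))" for m p
    \<comment> \<open>Earlier layers of the same parity stay at distance at least 1 / (2 m + p) from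
      \<open>F\<close>, while the layer 2 m + p is closer than 1 / (2 m + p + 1). For m = 0 the
      union is empty, and 1 / (2 m + p) could be a division by zero.\<close>
    proof (cases "m = 0")
      case False
      show ?thesis
      proof (rule hausdorff_outer_Un_separated[where \<epsilon> = "1 / (2 * m + p) - 1 / (2 * m + p + 1)"])
        have "1 / real (2 * m + p + 1) < 1 / real (2 * m + p)"
          using False by (intro divide_strict_left_mono) (auto simp: zero_less_mult_iff)
        thus "0 < 1 / real (2 * m + p) - 1 / real (2 * m + p + 1)" by simp
      next
        fix x y assume x: "x \<in> (\<Union>i<m. R (2 * i + p))" and y: "y \<in> R (2 * m + p)"
        then obtain i where i: "i < m" "x \<in> R (2 * i + p)" by auto
        have "1 / real (2 * m + p) \<le> 1 / (real (2 * i + p) + 2)"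
          using i by (intro divide_left_mono) auto
        also have "\<dots> \<le> d x" using i by (simp add: R_def)
        also have "\<dots> \<le> d y + dist x y" by (rule d_tri)
        finally have "1 / real (2 * m + p) \<le> d y + dist x y" .
        moreover have "d y \<le> 1 / real (2 * m + p + 1)"
          using y by (simp add: R_def add_ac)
        ultimately show "1 / real (2 * m + p) - 1 / real (2 * m + p + 1) \<le> dist x y" by linarith
      qed
    qed (simp add: hausdorff_outer_empty)
    have "(\<Sum>i<m. ?H (R (2 * i + p))) \<le> ?H (\<Union>i<m. R (2 * i + p))" for m p
    proof (induction m)
      case (Suc m)
      have "(\<Sum>i<Suc m. ?H (R (2 * i + p))) \<le> ?H (\<Union>i<m. R (2 * i + p)) + ?H (R (2 * m + p))"
        using Suc by (simp add: add_right_mono)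
      also have "\<dots> \<le> ?H ((\<Union>i<m. R (2 * i + p)) \<union> R (2 * m + p))" by (rule sepR)
      finally show ?case by (simp add: lessThan_Suc Un_commute)
    qed simp
    also have "?H (\<Union>i<m. R (2 * i + p)) \<le> ?H X" for m p
      by (rule hausdorff_outer_mono) (auto simp: R_def)
    finally have half: "(\<Sum>i<m. ?H (R (2 * i + p))) \<le> ?H X" for m p .
    have split: "(\<Sum>i<2 * m. ?H (R i)) = (\<Sum>i<m. ?H (R (2 * i + 0))) + (\<Sum>i<m. ?H (R (2 * i + 1)))" for m
      by (induction m) (auto simp: add_ac)
    have "(\<Sum>i<m. ?H (R i)) \<le> ?H X + ?H X" for m
    proof -
      have "(\<Sum>i<m. ?H (R i)) \<le> (\<Sum>i<2 * m. ?H (R i))" by (rule sum_mono2) auto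
      also have "\<dots> \<le> ?H X + ?H X" unfolding split by (intro add_mono half)
      finally show ?thesis .
    qed
    hence "(\<Sum>i. ?H (R i)) \<le> ?H X + ?H X"
      unfolding suminf_eq_SUP by (rule SUP_least)
    hence S: "(\<Sum>i. ?H (R i)) < \<infinity>" using fin by (simp add: order_le_less_trans)
    have cover: "X - F \<subseteq> Y k \<union> (\<Union>j. R (j + k))" for k
    proof
      fix x assume x: "x \<in> X - F"
      show "x \<in> Y k \<union> (\<Union>j. R (j + k))"
      proof (cases "1 / (real k + 1) \<le> d x")
        case False
        obtain n where "inverse (real (Suc n)) < d x" using reals_Archimedean dpos x by auto
        moreover have "1 / (real n + 2) \<le> inverse (real (Suc n))" by (simp add: field_simps)
        ultimately have ex: "1 / (real n + 2) \<le> d x" by linarith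
        \<comment> \<open>The least such index picks the layer that contains x. If it is 0, the
          upper bound d x < 1 does not come from minimality but from x lying outside
          \<open>Y k\<close>.\<close>
        define m where "m = (LEAST m. 1 / (real m + 2) \<le> d x)"
        have m1: "1 / (real m + 2) \<le> d x" unfolding m_def by (rule LeastI[of _ n], rule ex)
        have m2: "d x < 1 / (real m + 1)"
        proof (cases m)
          case 0
          have "1 / (real k + 1) \<le> 1" by simp
          hence "d x < 1" using False by linarith
          thus ?thesis using 0 by simp
        next
          case (Suc l)
          hence "\<not> 1 / (real l + 2) \<le> d x" unfolding m_def by (intro not_less_Least) auto
          thus ?thesis using Suc by (simp add: add_ac)
        qed
        have "1 / (real m + 2) < 1 / (real k + 1)" using m1 False by linarith
        hence "k \<le> m" by (simp add: field_simps)
        hence "x \<in> R ((m - k) + k)" using m1 m2 x by (simp add: R_def)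
        thus ?thesis by blast
      qed (use x in \<open>simp add: Y_def\<close>)
    qed
    \<comment> \<open>Instead of letting the tail of the series tend to 0, the first k layers are
      added on both sides. In the supremum over k both sides contain the whole series, which is
      finite and cancels.\<close>
    have "?H (X \<inter> F) + ?H (X - F) + (\<Sum>j<k. ?H (R j)) \<le> ?H X + (\<Sum>i. ?H (R i))" for k
    proof -
      have "?H (X - F) \<le> ?H (Y k \<union> (\<Union>j. R (j + k)))" by (rule hausdorff_outer_mono[OF cover])
      also have "\<dots> \<le> ?H (Y k) + (\<Sum>j. ?H (R (j + k)))"
        by (rule order_trans[OF hausdorff_outer_Un_le]) (intro add_left_mono hausdorff_outer_UN_le)
      finally have "?H (X \<inter> F) + ?H (X - F) \<le> (?H (X \<inter> F) + ?H (Y k)) + (\<Sum>j. ?H (R (j + k)))"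
        by (simp add: add_left_mono add.assoc)
      also have "?H (X \<inter> F) + ?H (Y k) \<le> ?H (X \<inter> F \<union> Y k)"
      proof (rule hausdorff_outer_Un_separated[where \<epsilon> = "1 / (real k + 1)"])
        fix x y assume "x \<in> X \<inter> F" "y \<in> Y k"
        thus "1 / (real k + 1) \<le> dist x y" using d_tri[of y x] dF[of x] by (auto simp: Y_def dist_commute)
      qed simp
      also have "\<dots> \<le> ?H X" by (rule hausdorff_outer_mono) (auto simp: Y_def)
      finally have "?H (X \<inter> F) + ?H (X - F) \<le> ?H X + (\<Sum>j. ?H (R (j + k)))" by (simp add: add_right_mono)
      moreover have "(\<Sum>i. ?H (R i)) = (\<Sum>j. ?H (R (j + k))) + (\<Sum>j<k. ?H (R j))"
        by (rule suminf_offset) auto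
      ultimately show ?thesis by (simp add: add.assoc[symmetric] add_right_mono)
    qed
    hence "(SUP k. ?H (X \<inter> F) + ?H (X - F) + (\<Sum>j<k. ?H (R j))) \<le> ?H X + (\<Sum>i. ?H (R i))"
      by (rule SUP_least)
    hence "?H (X \<inter> F) + ?H (X - F) + (\<Sum>i. ?H (R i)) \<le> ?H X + (\<Sum>i. ?H (R i))"
      by (simp add: ennreal_SUP_add_right[symmetric] suminf_eq_SUP[symmetric])
    thus ?thesis using less_imp_neq[OF S]
      by (simp add: add.commute[of _ "\<Sum>i. ?H (R i)"] ennreal_add_left_cancel_le)
  qed
  have "?H (X \<inter> F) + ?H (X - F) = ?H X" for X
  proof (rule antisym)
    show "?H (X \<inter> F) + ?H (X - F) \<le> ?H X"
      using ge[of X] by (cases "F = {}"; cases "?H X = \<infinity>") (auto simp: hausdorff_outer_empty top.not_eq_extremum)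
    show "?H X \<le> ?H (X \<inter> F) + ?H (X - F)"
      using hausdorff_outer_Un_le[of n "X \<inter> F" "X - F"] by (simp add: Int_Diff_Un)
  qed
  thus ?thesis by (simp add: algebra.lambda_system_eq[OF algebra_Pow] del: Pow_UNIV)
qed

lemma hausdorff_measure_space:
  "measure_space UNIV (sets borel) (hausdorff_outer n :: 'a::euclidean_space set \<Rightarrow> ennreal)"
proof -
  interpret sigma_algebra UNIV "Pow (UNIV :: 'a set)" by (rule sigma_algebra_Pow)
  let ?L = "lambda_system UNIV (Pow (UNIV :: 'a set)) (hausdorff_outer n)"
  have ms: "measure_space UNIV ?L (hausdorff_outer n)"
    by (rule caratheodory_lemma[OF outer_measure_space_hausdorff])
  hence sa: "sigma_algebra UNIV ?L" by (simp add: measure_space_def)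
  have "sets borel = sigma_sets UNIV (Collect (closed :: 'a set \<Rightarrow> bool))"
    by (subst borel_eq_closed) (simp add: sets_measure_of)
  also have "\<dots> \<subseteq> ?L"
    by (rule sigma_algebra.sigma_sets_subset[OF sa]) (use closed_lambda_system_hausdorff in blast)
  finally have sub: "sets (borel :: 'a measure) \<subseteq> ?L" .
  show ?thesis
    using ms sub sets.sigma_algebra_axioms[of "borel :: 'a measure"]
    by (auto simp: measure_space_def positive_def countably_additive_def subset_iff)
qed

lemma sets_hausdorff_measure [simp, measurable_cong]: "sets (hausdorff_measure n) = sets borel"
  unfolding hausdorff_measure_def by (simp add: sets.sigma_sets_eq[of borel, simplified])

lemma space_hausdorff_measure [simp]: "space (hausdorff_measure n) = UNIV"
  using sets_eq_imp_space_eq[OF sets_hausdorff_measure] by simp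

lemma emeasure_hausdorff_measure:
  assumes "A \<in> sets borel"
  shows "emeasure (hausdorff_measure n) A = hausdorff_outer n A"
  unfolding hausdorff_measure_def
  using hausdorff_measure_space[of n] assms
  by (intro emeasure_measure_of_sigma) (auto simp: measure_space_def)

section \<open>Hausdorff measure of full dimension is Lebesgue measure\<close>

lemma hausdorff_pre_Un_le:
  assumes "0 < \<delta>"
  shows "hausdorff_pre n \<delta> (A \<union> B) \<le> hausdorff_pre n \<delta> A + hausdorff_pre n \<delta> B"
  using hausdorff_pre_UN_le[of n \<delta> "binaryset A B"]
    suminf_binaryset_eq[of "hausdorff_pre n \<delta>", OF hausdorff_pre_empty[OF assms], of A B]
  by (simp add: UN_binaryset_eq)

text \<open>The isodiametric inequality bounds the volume of each covering set by its size. Covering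
  sets are arbitrary, so it is applied to their closures, which are Borel and have the same
  diameter.\<close>

lemma lborel_le_hausdorff_pre:
  fixes A :: "'a::euclidean_space set"
  assumes A: "A \<in> sets borel"
  shows "emeasure lborel A \<le> hausdorff_pre DIM('a) \<delta> A"
proof (rule hausdorff_pre_greatest)
  fix C :: "nat \<Rightarrow> 'a set"
  assume C: "A \<subseteq> (\<Union>i. C i)" "\<And>i. bounded (C i)" "\<And>i. diameter (C i) \<le> \<delta>"
  have *: "emeasure lborel (closure (C i)) \<le> hausdorff_size DIM('a) (C i)" for i
  proof (cases "C i = {}")
    case False
    have b: "bounded (closure (C i))" using C by auto
    have "emeasure lborel (closure (C i))
      \<le> ennreal (unit_ball_vol (real DIM('a)) * (diameter (closure (C i)) / 2) ^ DIM('a))"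
      by (rule isodiametric)
        (use b in \<open>auto simp: dist_norm[symmetric] diameter_ge_0 intro: diameter_bounded_bound\<close>)
    thus ?thesis using False C(2) by (simp add: hausdorff_size_def diameter_closure)
  qed simp
  have "emeasure lborel A \<le> emeasure lborel (\<Union>i. closure (C i))"
  proof (rule emeasure_mono)
    have "(\<Union>i. C i) \<subseteq> (\<Union>i. closure (C i))" by (intro UN_mono closure_subset) auto
    thus "A \<subseteq> (\<Union>i. closure (C i))" using C(1) by (rule order_trans[rotated])
  qed auto
  also have "\<dots> \<le> (\<Sum>i. emeasure lborel (closure (C i)))"
    by (rule emeasure_subadditive_countably) auto
  also have "\<dots> \<le> (\<Sum>i. hausdorff_size DIM('a) (C i))"
    using * by (intro suminf_le) auto
  finally show "emeasure lborel A \<le> (\<Sum>i. hausdorff_size DIM('a) (C i))" .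
qed

lemma diameter_ball_le:
  assumes "0 < r"
  shows "diameter (ball (x::'a::euclidean_space) r) \<le> 2 * r"
proof (rule diameter_le)
  fix y z assume "y \<in> ball x r" "z \<in> ball x r"
  thus "norm (y - z) \<le> 2 * r"
    using dist_triangle3[of y z x] by (simp add: dist_norm[symmetric])
qed (use assms in simp)

lemma hausdorff_size_ball_le:
  assumes "0 < r"
  shows "hausdorff_size DIM('a) (ball (x::'a::euclidean_space) r) \<le> emeasure lborel (ball x r)"
proof -
  have "diameter (ball x r) \<le> 2 * r" by (rule diameter_ball_le[OF assms])
  moreover have "0 \<le> diameter (ball x r)" by (rule diameter_ge_0) simp
  ultimately show ?thesis using assms
    by (auto simp: hausdorff_size_def emeasure_ball intro!: ennreal_leI mult_left_mono power_mono)
qed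

text \<open>The size of a ball is at most its volume, volume scales by s^n, and the volumes of the
  disjoint balls add up. The value s = 5 serves the Vitali covering lemma, s = 1 the Vitali covering
  theorem.\<close>

lemma hausdorff_pre_UN_balls_le:
  fixes c :: "'i \<Rightarrow> 'a::euclidean_space"
  assumes "countable I" and r: "\<And>i. i \<in> I \<Longrightarrow> 0 < r i" "\<And>i. i \<in> I \<Longrightarrow> 2 * s * r i \<le> \<delta>" and "0 < \<delta>" "0 < s"
    and disj: "pairwise (\<lambda>i j. disjnt (ball (c i) (r i)) (ball (c j) (r j))) I"
  shows "hausdorff_pre DIM('a) \<delta> (\<Union>i\<in>I. ball (c i) (s * r i))
    \<le> ennreal (s ^ DIM('a)) * emeasure lborel (\<Union>i\<in>I. ball (c i) (r i))"
proof -
  \<comment> \<open>Covers in \<open>hausdorff_pre\<close> are sequences; the balls are placed at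
    the positions \<open>f i\<close> and all other positions are filled with the empty set, which
    costs nothing.\<close>
  obtain f :: "'i \<Rightarrow> nat" where f: "inj_on f I" using \<open>countable I\<close> by (auto simp: countable_def)
  define D where "D t m = (if m \<in> f ` I then ball (c (inv_into I f m)) (t * r (inv_into I f m)) else {})" for t m
  have Dm: "D t (f i) = ball (c i) (t * r i)" if "i \<in> I" for t i
    using that f by (simp add: D_def)
  have UD: "(\<Union>m. D t m) = (\<Union>i\<in>I. ball (c i) (t * r i))" for t
  proof
    show "(\<Union>m. D t m) \<subseteq> (\<Union>i\<in>I. ball (c i) (t * r i))"
      using f by (fastforce simp: D_def split: if_splits)
    show "(\<Union>i\<in>I. ball (c i) (t * r i)) \<subseteq> (\<Union>m. D t m)"
      using Dm by blast
  qed
  have diam: "diameter (ball (c i) (s * r i)) \<le> \<delta>" if "i \<in> I" for i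
    using diameter_ball_le[of "s * r i" "c i"] r[OF that] \<open>0 < s\<close> by simp
  have "hausdorff_pre DIM('a) \<delta> (\<Union>i\<in>I. ball (c i) (s * r i)) \<le> (\<Sum>m. hausdorff_size DIM('a) (D s m))"
    unfolding UD[symmetric]
  proof (rule hausdorff_pre_le)
    fix m
    show "bounded (D s m)" by (simp add: D_def)
    show "diameter (D s m) \<le> \<delta>"
    proof (cases "m \<in> f ` I")
      case True
      then obtain i where "i \<in> I" "m = f i" by auto
      thus ?thesis using diam by (simp only: Dm)
    qed (use \<open>0 < \<delta>\<close> in \<open>simp add: D_def\<close>)
  qed simp
  also have "\<dots> \<le> (\<Sum>m. ennreal (s ^ DIM('a)) * emeasure lborel (D 1 m))"
  proof (rule suminf_le)
    fix m
    show "hausdorff_size DIM('a) (D s m) \<le> ennreal (s ^ DIM('a)) * emeasure lborel (D 1 m)"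
    proof (cases "m \<in> f ` I")
      case True
      then obtain i where i: "i \<in> I" "m = f i" by auto
      have "hausdorff_size DIM('a) (D s m) \<le> emeasure lborel (D s m)"
        using r(1)[OF i(1)] \<open>0 < s\<close> by (simp add: i Dm hausdorff_size_ball_le)
      also have "\<dots> = ennreal (s ^ DIM('a)) * emeasure lborel (D 1 m)"
        using r(1)[OF i(1)] \<open>0 < s\<close>
        by (simp add: i Dm emeasure_ball ennreal_mult[symmetric] power_mult_distrib mult_ac)
      finally show ?thesis .
    qed (simp add: D_def)
  qed auto
  also have "\<dots> = ennreal (s ^ DIM('a)) * (\<Sum>m. emeasure lborel (D 1 m))" by simp
  also have "(\<Sum>m. emeasure lborel (D 1 m)) = emeasure lborel (\<Union>m. D 1 m)"
  proof (rule suminf_emeasure)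
    show "range (D 1) \<subseteq> sets lborel" by (auto simp: D_def)
    show "disjoint_family (D 1)"
      unfolding disjoint_family_on_def
    proof (intro ballI impI)
      fix m k :: nat assume "m \<noteq> k"
      show "D 1 m \<inter> D 1 k = {}"
      proof (cases "m \<in> f ` I \<and> k \<in> f ` I")
        case True
        then obtain i j where "i \<in> I" "m = f i" "j \<in> I" "k = f j" by auto
        moreover from this have "i \<noteq> j" using \<open>m \<noteq> k\<close> by auto
        ultimately show ?thesis using disj by (auto simp: Dm pairwise_def disjnt_def)
      qed (auto simp: D_def)
    qed
  qed
  also have "(\<Union>m. D 1 m) = (\<Union>i\<in>I. ball (c i) (r i))" by (simp add: UD)
  finally show ?thesis .
qed

text \<open>The factor 5^n is harmless where this is used: on open neighbourhoods of a null set,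
  whose measure can be made as small as desired.\<close>

lemma hausdorff_pre_open_le_5:
  fixes U :: "'a::euclidean_space set"
  assumes "open U" "0 < \<delta>"
  shows "hausdorff_pre DIM('a) \<delta> U \<le> ennreal (5 ^ DIM('a)) * emeasure lborel U"
proof -
  \<comment> \<open>With r at most \<delta> / 10 the ball of radius 5 r still has diameter at most
    \<delta>.\<close>
  define K where "K = {(x::'a, r). 0 < r \<and> r \<le> \<delta> / 10 \<and> ball x r \<subseteq> U}"
  have cov: "U \<subseteq> (\<Union>i\<in>K. ball (fst i) (snd i))"
  proof
    fix x assume "x \<in> U"
    then obtain e where "e > 0" "ball x e \<subseteq> U" using \<open>open U\<close> openE by blast
    hence "(x, min e (\<delta> / 10)) \<in> K" using \<open>0 < \<delta>\<close> by (auto simp: K_def)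
    moreover have "x \<in> ball x (min e (\<delta> / 10))" using \<open>e > 0\<close> \<open>0 < \<delta>\<close> by simp
    ultimately show "x \<in> (\<Union>i\<in>K. ball (fst i) (snd i))" by force
  qed
  have r: "\<And>i. i \<in> K \<Longrightarrow> 0 < snd i \<and> snd i \<le> \<delta> / 10" by (auto simp: K_def)
  obtain I where I: "countable I" "I \<subseteq> K"
    "pairwise (\<lambda>i j. disjnt (ball (fst i) (snd i)) (ball (fst j) (snd j))) I"
    "U \<subseteq> (\<Union>i\<in>I. ball (fst i) (5 * snd i))"
    by (rule Vitali_covering_lemma_balls[OF cov r])
  have "hausdorff_pre DIM('a) \<delta> U \<le> hausdorff_pre DIM('a) \<delta> (\<Union>i\<in>I. ball (fst i) (5 * snd i))"
    by (rule hausdorff_pre_mono[OF I(4)])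
  also have "\<dots> \<le> ennreal (5 ^ DIM('a)) * emeasure lborel (\<Union>i\<in>I. ball (fst i) (snd i))"
    using I \<open>0 < \<delta>\<close> by (intro hausdorff_pre_UN_balls_le) (auto simp: K_def)
  also have "(\<Union>i\<in>I. ball (fst i) (snd i)) \<subseteq> U" using I(2) unfolding K_def by fastforce
  hence "ennreal (5 ^ DIM('a)) * emeasure lborel (\<Union>i\<in>I. ball (fst i) (snd i))
      \<le> ennreal (5 ^ DIM('a)) * emeasure lborel U"
    using \<open>open U\<close> by (intro mult_left_mono emeasure_mono) auto
  finally show ?thesis .
qed

lemma hausdorff_pre_null:
  fixes N :: "'a::euclidean_space set"
  assumes "N \<in> sets borel" "emeasure lborel N = 0" "0 < \<delta>"
  shows "hausdorff_pre DIM('a) \<delta> N = 0"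
proof -
  have "hausdorff_pre DIM('a) \<delta> N \<le> 0 + ennreal e" if e: "0 < e" for e
  proof -
    have "0 < e / 5 ^ DIM('a)" using e by simp
    then obtain U where U: "open U" "N \<subseteq> U" "emeasure lborel (U - N) < e / 5 ^ DIM('a)"
      using outer_regular_lborel[OF assms(1)] by metis
    have "emeasure lborel U = emeasure lborel (U - N)"
      using assms U by (subst emeasure_Diff_null_set) auto
    hence *: "emeasure lborel U \<le> ennreal (e / 5 ^ DIM('a))" using U by simp
    have "hausdorff_pre DIM('a) \<delta> N \<le> hausdorff_pre DIM('a) \<delta> U" by (rule hausdorff_pre_mono[OF U(2)])
    also have "\<dots> \<le> ennreal (5 ^ DIM('a)) * emeasure lborel U"
      by (rule hausdorff_pre_open_le_5[OF U(1) assms(3)])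
    also have "\<dots> \<le> ennreal (5 ^ DIM('a)) * ennreal (e / 5 ^ DIM('a))"
      using * by (intro mult_left_mono) auto
    also have "\<dots> = ennreal e" using e by (simp add: ennreal_mult[symmetric])
    finally show ?thesis by simp
  qed
  hence "hausdorff_pre DIM('a) \<delta> N \<le> 0" by (rule ennreal_le_epsilon)
  thus ?thesis by simp
qed

text \<open>Disjoint small balls inside \<open>U\<close> exhaust it up to a null set, so their
  volumes give the bound with constant 1; the remaining null set is free by
  \<open>hausdorff_pre_null\<close>.\<close>

lemma hausdorff_pre_open_le:
  fixes U :: "'a::euclidean_space set"
  assumes "open U" "0 < \<delta>"
  shows "hausdorff_pre DIM('a) \<delta> U \<le> emeasure lborel U"
proof -
  define K where "K = {(x::'a, r). 0 < r \<and> r \<le> \<delta> / 2 \<and> ball x r \<subseteq> U}"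
  have "\<exists>i. i \<in> K \<and> x \<in> ball (fst i) (snd i) \<and> snd i < d" if x: "x \<in> U" and d: "0 < d" for x d
  proof -
    obtain e where "e > 0" "ball x e \<subseteq> U" using \<open>open U\<close> openE x by blast
    thus ?thesis using \<open>0 < \<delta>\<close> d
      by (intro exI[of _ "(x, min (d / 2) (min e (\<delta> / 2)))"]) (auto simp: K_def)
  qed
  then obtain I where I: "countable I" "I \<subseteq> K"
    "pairwise (\<lambda>i j. disjnt (ball (fst i) (snd i)) (ball (fst j) (snd j))) I"
    "negligible (U - (\<Union>i\<in>I. ball (fst i) (snd i)))"
    by (rule Vitali_covering_theorem_balls)
  let ?B = "\<Union>i\<in>I. ball (fst i) (snd i)"
  have B: "?B \<subseteq> U" using I(2) unfolding K_def by fastforce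
  have "open ?B" by blast
  hence N: "U - ?B \<in> sets borel" using \<open>open U\<close> by (intro sets.Diff) auto
  have "U - ?B \<in> null_sets lebesgue" using I(4) by (simp add: negligible_iff_null_sets)
  hence N0: "emeasure lborel (U - ?B) = 0" using N by (simp add: null_sets_def)
  have "hausdorff_pre DIM('a) \<delta> U = hausdorff_pre DIM('a) \<delta> (?B \<union> (U - ?B))"
    using B by (simp add: Un_absorb1)
  also have "\<dots> \<le> hausdorff_pre DIM('a) \<delta> ?B + hausdorff_pre DIM('a) \<delta> (U - ?B)"
    by (rule hausdorff_pre_Un_le[OF assms(2)])
  also have "\<dots> = hausdorff_pre DIM('a) \<delta> (\<Union>i\<in>I. ball (fst i) (1 * snd i))"
    using hausdorff_pre_null[OF N N0 assms(2)] by simp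
  also have "\<dots> \<le> ennreal (1 ^ DIM('a)) * emeasure lborel ?B"
    using I \<open>0 < \<delta>\<close> by (intro hausdorff_pre_UN_balls_le) (auto simp: K_def)
  also have "\<dots> \<le> emeasure lborel U"
    using B \<open>open U\<close> by (simp add: emeasure_mono)
  finally show ?thesis .
qed

lemma hausdorff_outer_eq_lborel:
  fixes A :: "'a::euclidean_space set"
  assumes A: "A \<in> sets borel"
  shows "hausdorff_outer DIM('a) A = emeasure lborel A"
proof (rule antisym)
  show "hausdorff_outer DIM('a) A \<le> emeasure lborel A"
    unfolding hausdorff_outer_def
  proof (rule SUP_least, rule ennreal_le_epsilon)
    fix \<delta> e :: real assume "\<delta> \<in> {0<..}" "0 < e"
    obtain U where U: "open U" "A \<subseteq> U" "emeasure lborel (U - A) < e"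
      using outer_regular_lborel[OF A \<open>0 < e\<close>] by metis
    have "hausdorff_pre DIM('a) \<delta> A \<le> hausdorff_pre DIM('a) \<delta> U" by (rule hausdorff_pre_mono[OF U(2)])
    also have "\<dots> \<le> emeasure lborel U" using U \<open>\<delta> \<in> _\<close> by (intro hausdorff_pre_open_le) auto
    also have "\<dots> = emeasure lborel (A \<union> (U - A))" using U by (simp add: Un_absorb1)
    also have "\<dots> \<le> emeasure lborel A + emeasure lborel (U - A)"
      using A U by (intro emeasure_subadditive) auto
    also have "\<dots> \<le> emeasure lborel A + e" using U by (intro add_left_mono) auto
    finally show "hausdorff_pre DIM('a) \<delta> A \<le> emeasure lborel A + e" .
  qed
  show "emeasure lborel A \<le> hausdorff_outer DIM('a) A"
    by (rule order_trans[OF lborel_le_hausdorff_pre[OF A, of 1] hausdorff_outer_ge_pre]) simp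
qed

text \<open>Covers are carried forward by images and back by preimages, and neither operation
  increases diameters. Preimages are used because \<open>f\<close> need not be onto: this is how
  Lebesgue measure of a smaller space is transported to a hyperplane.\<close>

lemma hausdorff_outer_isometry:
  fixes f :: "'b::euclidean_space \<Rightarrow> 'a::euclidean_space"
  assumes f: "\<And>x y. dist (f x) (f y) = dist x y"
  shows "hausdorff_outer n (f ` A) = hausdorff_outer n A"
proof -
  have size_mono: "hausdorff_size n C \<le> hausdorff_size n C'"
    if "bounded C" "diameter C \<le> diameter C'" "C \<noteq> {} \<Longrightarrow> C' \<noteq> {}" for C :: "'c::euclidean_space set" and C' :: "'e::euclidean_space set"
    using that diameter_ge_0[OF that(1)]
    by (auto simp: hausdorff_size_def intro!: ennreal_leI mult_left_mono power_mono divide_right_mono)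
  have im: "bounded (f ` C)" "diameter (f ` C) \<le> diameter C" if bC: "bounded C" for C
  proof -
    obtain x e where "\<forall>y\<in>C. dist x y \<le> e" using bC unfolding bounded_def by blast
    thus "bounded (f ` C)" unfolding bounded_def by (intro exI[of _ "f x"] exI[of _ e]) (auto simp: f)
    show "diameter (f ` C) \<le> diameter C"
      by (rule diameter_le)
        (use diameter_ge_0[OF bC] diameter_bounded_bound[OF bC] in \<open>auto simp: f dist_norm[symmetric]\<close>)
  qed
  have vim: "bounded (f -` C)" "diameter (f -` C) \<le> diameter C" if bC: "bounded C" for C
  proof -
    obtain e where e: "\<forall>x\<in>C. \<forall>y\<in>C. dist x y \<le> e" using bC by (auto simp: bounded_two_points)
    hence "\<forall>x\<in>f -` C. \<forall>y\<in>f -` C. dist x y \<le> e" using f by (metis vimageE)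
    thus "bounded (f -` C)" unfolding bounded_two_points by blast
    show "diameter (f -` C) \<le> diameter C"
      by (rule diameter_le)
        (use diameter_ge_0[OF bC] diameter_bounded_bound[OF bC] in \<open>auto simp: f[symmetric] dist_norm[symmetric]\<close>)
  qed
  have "hausdorff_pre n \<delta> (f ` A) = hausdorff_pre n \<delta> A" for \<delta>
  proof (rule antisym; rule hausdorff_pre_greatest)
    fix C :: "nat \<Rightarrow> 'b set"
    assume C: "A \<subseteq> (\<Union>i. C i)" "\<And>i. bounded (C i)" "\<And>i. diameter (C i) \<le> \<delta>"
    have "hausdorff_pre n \<delta> (f ` A) \<le> (\<Sum>i. hausdorff_size n (f ` C i))"
    proof (rule hausdorff_pre_le)
      show "f ` A \<subseteq> (\<Union>i. f ` C i)" using C(1) by (metis image_UN image_mono)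
    qed (use C im in \<open>blast intro: order_trans\<close>)+
    also have "\<dots> \<le> (\<Sum>i. hausdorff_size n (C i))"
      using C im by (intro suminf_le size_mono) auto
    finally show "hausdorff_pre n \<delta> (f ` A) \<le> (\<Sum>i. hausdorff_size n (C i))" .
  next
    fix C :: "nat \<Rightarrow> 'a set"
    assume C: "f ` A \<subseteq> (\<Union>i. C i)" "\<And>i. bounded (C i)" "\<And>i. diameter (C i) \<le> \<delta>"
    have "hausdorff_pre n \<delta> A \<le> (\<Sum>i. hausdorff_size n (f -` C i))"
    proof (rule hausdorff_pre_le)
      show "A \<subseteq> (\<Union>i. f -` C i)" using C(1) by blast
    qed (use C vim in \<open>blast intro: order_trans\<close>)+
    also have "\<dots> \<le> (\<Sum>i. hausdorff_size n (C i))"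
      using C vim by (intro suminf_le size_mono) auto
    finally show "hausdorff_pre n \<delta> A \<le> (\<Sum>i. hausdorff_size n (C i))" .
  qed
  thus ?thesis by (simp add: hausdorff_outer_def)
qed

section \<open>Charts of hyperplanes\<close>


text \<open>Both sides are Hausdorff measures of the same dimension, and those are defined by
  distances alone.\<close>

lemma distr_lborel_isometry:
  fixes f :: "'b::euclidean_space \<Rightarrow> 'a::euclidean_space"
  assumes f: "\<And>x y. dist (f x) (f y) = dist x y" and "surj f" and dim: "DIM('a) = DIM('b)"
  shows "distr lborel borel f = lborel"
proof (rule measure_eqI)
  have "continuous_on UNIV f"
    unfolding continuous_on_iff f by auto
  hence [measurable]: "f \<in> borel_measurable borel" by (rule borel_measurable_continuous_onI)
  fix A assume A: "A \<in> sets (distr lborel borel f)"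
  hence [measurable]: "A \<in> sets borel" by simp
  have m: "f -` A \<in> sets borel" by (rule measurable_sets_borel[OF _ \<open>A \<in> sets borel\<close>]) measurable
  have "emeasure (distr lborel borel f) A = emeasure lborel (f -` A)"
    by (subst emeasure_distr) auto
  also have "\<dots> = hausdorff_outer DIM('b) (f -` A)" by (rule hausdorff_outer_eq_lborel[OF m, symmetric])
  also have "\<dots> = hausdorff_outer DIM('b) (f ` (f -` A))" by (rule hausdorff_outer_isometry[OF f, symmetric])
  also have "f ` (f -` A) = A" using \<open>surj f\<close> by (simp add: surj_image_vimage_eq)
  also have "hausdorff_outer DIM('b) A = emeasure lborel A"
    using hausdorff_outer_eq_lborel[OF \<open>A \<in> sets borel\<close>] dim by simp
  finally show "emeasure (distr lborel borel f) A = emeasure lborel A" .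
qed simp

lemma sets_surface_measure [simp, measurable_cong]: "sets surface_measure = sets borel"
  by (simp add: surface_measure_def)

lemma space_surface_measure [simp]: "space surface_measure = UNIV"
  by (simp add: surface_measure_def)

definition hyperplane :: "'a::euclidean_space \<times> real \<Rightarrow> 'a set" where
  "hyperplane p = {z. fst p \<bullet> z = snd p}"

lemma hyperplane_closed [simp]: "closed (hyperplane p)"
  by (simp add: hyperplane_def closed_hyperplane)

lemma hyperplane_borel [measurable]: "hyperplane p \<in> sets borel"
  by (intro borel_closed hyperplane_closed)

text \<open>The hyperplane is parametrized by a whole Euclidean type of dimension one less, not by a
  subspace, so that \<open>lborel\<close> is available on the parameters. This type enters later
  results only through the assumption on its dimension.\<close>

locale hyperplane_chart =
  fixes \<iota> :: "'b::euclidean_space \<Rightarrow> 'a::euclidean_space" and a :: 'a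
  assumes linear: "linear \<iota>" and norm_\<iota>: "\<And>y. norm (\<iota> y) = norm y"
    and range_\<iota>: "range \<iota> = {z. a \<bullet> z = 0}" and norm_a: "norm a = 1"
    and dim: "DIM('a) = Suc DIM('b)"
begin

definition chart :: "real \<Rightarrow> 'b \<Rightarrow> 'a" where
  "chart c y = \<iota> y + c *\<^sub>R a"

lemma a_a [simp]: "a \<bullet> a = 1" using norm_a by (simp add: dot_square_norm)

lemma a_\<iota> [simp]: "a \<bullet> \<iota> y = 0" using range_\<iota> by blast

lemma \<iota>_a [simp]: "\<iota> y \<bullet> a = 0" using a_\<iota> by (simp add: inner_commute)

lemma \<iota>_diff: "\<iota> x - \<iota> y = \<iota> (x - y)" using linear by (simp add: linear_diff)

lemma continuous_\<iota>: "continuous_on A \<iota>"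
  using linear by (rule linear_continuous_on[OF linear_conv_bounded_linear[THEN iffD1]])

lemma measurable_\<iota> [measurable]: "\<iota> \<in> borel_measurable borel"
  by (rule borel_measurable_continuous_onI[OF continuous_\<iota>])

lemma measurable_chart [measurable]: "chart c \<in> borel_measurable borel"
  unfolding chart_def[abs_def] by measurable

lemma measurable_chart_pair [measurable]:
  fixes f :: "real \<Rightarrow> real"
  assumes f: "f \<in> borel_measurable borel"
  shows "(\<lambda>p. chart (f (snd p)) (fst p)) \<in> borel_measurable borel"
proof -
  have m: "fst \<in> borel_measurable (borel :: ('b \<times> real) measure)"
    "snd \<in> borel_measurable (borel :: ('b \<times> real) measure)"
    by (intro borel_measurable_continuous_onI continuous_intros)+
  show ?thesis
    unfolding chart_def
    by (intro borel_measurable_add borel_measurable_scaleR borel_measurable_const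
        measurable_compose[OF m(1) measurable_\<iota>] measurable_compose[OF m(2) f])
qed

lemma inner_chart [simp]: "a \<bullet> chart c y = c"
  by (simp add: chart_def inner_add_right)

lemma dist_chart: "dist (chart c x) (chart d y) = sqrt ((dist x y)\<^sup>2 + (dist c d)\<^sup>2)"
proof -
  have "chart c x - chart d y = \<iota> (x - y) + (c - d) *\<^sub>R a"
    by (simp add: chart_def \<iota>_diff[symmetric] algebra_simps)
  hence "(dist (chart c x) (chart d y))\<^sup>2 = (norm (\<iota> (x - y) + (c - d) *\<^sub>R a))\<^sup>2"
    by (simp add: dist_norm)
  also have "\<dots> = (norm (\<iota> (x - y)))\<^sup>2 + (c - d)\<^sup>2"
    unfolding power2_norm_eq_inner by (simp add: inner_simps power2_eq_square)
  finally show ?thesis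
    by (intro real_sqrt_unique[symmetric]) (simp_all add: norm_\<iota> dist_norm dist_real_def)
qed

lemma range_chart: "range (chart c) = hyperplane (a, c)"
proof (intro set_eqI iffI)
  fix z assume "z \<in> hyperplane (a, c)"
  hence "z - c *\<^sub>R a \<in> range \<iota>" by (simp add: range_\<iota> hyperplane_def inner_diff_right)
  then obtain y where "z - c *\<^sub>R a = \<iota> y" by auto
  hence "z = chart c y" by (simp add: chart_def algebra_simps)
  thus "z \<in> range (chart c)" by blast
qed (auto simp: hyperplane_def)

text \<open>By \<open>dist_chart\<close> the map from (y, c) is an isometry of the product onto the
  whole space, so slicing into parallel hyperplanes is Fubini's theorem for the product.\<close>

lemma distr_lborel_layers: "distr lborel borel (\<lambda>(y, c). chart c y) = lborel"
proof (rule distr_lborel_isometry)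
  fix p q :: "'b \<times> real"
  show "dist (case p of (y, c) \<Rightarrow> chart c y) (case q of (y, c) \<Rightarrow> chart c y) = dist p q"
    by (cases p; cases q) (simp add: dist_chart dist_prod_def)
next
  have "z \<in> range (\<lambda>(y, c). chart c y)" for z
  proof -
    have "z \<in> range (chart (a \<bullet> z))" by (simp add: range_chart hyperplane_def)
    thus ?thesis by (auto simp: image_iff)
  qed
  thus "surj (\<lambda>(y, c). chart c y)" by blast
qed (simp add: dim)

text \<open>The only link between \<open>surface_measure\<close> and Lebesgue measure: the chart is
  an isometry onto the hyperplane, and on the parameters the Hausdorff measure of dimension
  \<open>DIM('a) - 1\<close> is \<open>lborel\<close>.\<close>

lemma distr_lborel_chart:
  "distr lborel borel (chart c) = density surface_measure (indicator (hyperplane (a, c)))"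
proof (rule measure_eqI)
  fix A assume "A \<in> sets (distr lborel borel (chart c))"
  hence A[measurable]: "A \<in> sets borel" by simp
  have m: "chart c -` A \<in> sets borel" by (rule measurable_sets_borel[OF _ A]) measurable
  have n: "DIM('a) - Suc 0 = DIM('b)" using dim by simp
  have "emeasure (distr lborel borel (chart c)) A = emeasure lborel (chart c -` A)"
    by (subst emeasure_distr) auto
  also have "\<dots> = hausdorff_outer DIM('b) (chart c -` A)" by (rule hausdorff_outer_eq_lborel[OF m, symmetric])
  also have "\<dots> = hausdorff_outer DIM('b) (chart c ` (chart c -` A))"
    by (rule hausdorff_outer_isometry[symmetric]) (simp add: dist_chart)
  also have "chart c ` (chart c -` A) = hyperplane (a, c) \<inter> A"
    by (simp add: image_vimage_eq range_chart Int_commute)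
  also have "hausdorff_outer DIM('b) (hyperplane (a, c) \<inter> A) = emeasure surface_measure (hyperplane (a, c) \<inter> A)"
    by (simp add: surface_measure_def emeasure_hausdorff_measure n)
  also have "\<dots> = emeasure (density surface_measure (indicator (hyperplane (a, c)))) A"
    by (subst emeasure_density)
      (auto simp: nn_integral_indicator[symmetric] indicator_inter_arith simp del: nn_integral_indicator)
  finally show "emeasure (distr lborel borel (chart c)) A
    = emeasure (density surface_measure (indicator (hyperplane (a, c)))) A" .
qed simp

lemma nn_integral_hyperplane:
  assumes [measurable]: "h \<in> borel_measurable borel"
  shows "(\<integral>\<^sup>+z. indicator (hyperplane (a, c)) z * h z \<partial>surface_measure) = (\<integral>\<^sup>+y. h (chart c y) \<partial>lborel)"
proof -
  have "(\<integral>\<^sup>+y. h (chart c y) \<partial>lborel) = (\<integral>\<^sup>+z. h z \<partial>distr lborel borel (chart c))"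
    by (subst nn_integral_distr) auto
  also have "\<dots> = (\<integral>\<^sup>+z. indicator (hyperplane (a, c)) z * h z \<partial>surface_measure)"
    unfolding distr_lborel_chart by (subst nn_integral_density) auto
  finally show ?thesis ..
qed

lemma hyperplane_integral:
  fixes h :: "'a \<Rightarrow> real"
  assumes [measurable]: "h \<in> borel_measurable borel"
  shows "integrable surface_measure (\<lambda>z. indicator (hyperplane (a, c)) z * h z)
      \<longleftrightarrow> integrable lborel (\<lambda>y. h (chart c y))"
    and "(LINT z|surface_measure. indicator (hyperplane (a, c)) z * h z) = (LINT y|lborel. h (chart c y))"
proof -
  have d: "density surface_measure (\<lambda>z. ennreal (indicator (hyperplane (a, c)) z)) = distr lborel borel (chart c)"
    by (simp add: distr_lborel_chart ennreal_indicator)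
  have "integrable surface_measure (\<lambda>z. indicator (hyperplane (a, c)) z * h z)
      \<longleftrightarrow> integrable (density surface_measure (\<lambda>z. ennreal (indicator (hyperplane (a, c)) z))) h"
    by (subst integrable_density) auto
  also have "\<dots> \<longleftrightarrow> integrable lborel (\<lambda>y. h (chart c y))"
    unfolding d by (subst integrable_distr_eq) auto
  finally show "integrable surface_measure (\<lambda>z. indicator (hyperplane (a, c)) z * h z)
      \<longleftrightarrow> integrable lborel (\<lambda>y. h (chart c y))" .
  have "(LINT z|surface_measure. indicator (hyperplane (a, c)) z * h z)
      = integral\<^sup>L (density surface_measure (\<lambda>z. ennreal (indicator (hyperplane (a, c)) z))) h"
    by (subst integral_density) auto
  also have "\<dots> = (LINT y|lborel. h (chart c y))"
    unfolding d by (subst integral_distr) auto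
  finally show "(LINT z|surface_measure. indicator (hyperplane (a, c)) z * h z) = (LINT y|lborel. h (chart c y))" .
qed

text \<open>Height over the hyperplane is measured from c in units of \<kappa>. With \<kappa> = t (a
  \<bullet> e) the slab between a half-space and its translate by t e becomes the unit interval,
  whatever t is.\<close>

lemma lborel_rescaled_layers:
  assumes "\<kappa> \<noteq> 0"
  shows "lborel = density (distr lborel borel (\<lambda>(y, s). chart (c + \<kappa> * s) y)) (\<lambda>_. ennreal \<bar>\<kappa>\<bar>)"
proof (rule measure_eqI)
  fix A :: "'a set" assume "A \<in> sets lborel"
  hence A[measurable]: "A \<in> sets borel" by simp
  have m[measurable]: "(\<lambda>(y, s). chart (f s) y) \<in> borel_measurable borel"
    if "f \<in> borel_measurable borel" for f :: "real \<Rightarrow> real"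
  proof -
    show ?thesis using measurable_chart_pair[OF that] by (simp add: case_prod_beta)
  qed
  have m1[measurable]: "(\<lambda>(y, s). chart s y) \<in> borel_measurable borel"
    using m[of "\<lambda>s. s"] by simp
  have m2[measurable]: "(\<lambda>(y, s). chart (c + \<kappa> * s) y) \<in> borel_measurable borel"
    by (rule m) measurable
  have "emeasure lborel A = (\<integral>\<^sup>+z. indicator A z \<partial>distr lborel borel (\<lambda>(y, c). chart c y))"
    by (simp add: distr_lborel_layers)
  also have "\<dots> = (\<integral>\<^sup>+p. indicator A (case p of (y, s) \<Rightarrow> chart s y) \<partial>(lborel \<Otimes>\<^sub>M lborel))"
    unfolding lborel_prod by (subst nn_integral_distr) auto
  also have "\<dots> = (\<integral>\<^sup>+y. (\<integral>\<^sup>+s. indicator A (chart s y) \<partial>lborel) \<partial>lborel)"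
    by (subst lborel.nn_integral_fst[symmetric]) (auto simp: lborel_prod borel_prod)
  also have "\<dots> = (\<integral>\<^sup>+y. (\<integral>\<^sup>+s. ennreal \<bar>\<kappa>\<bar> * indicator A (chart (c + \<kappa> * s) y) \<partial>lborel) \<partial>lborel)"
  proof (rule nn_integral_cong)
    fix y :: 'b
    have [measurable]: "(\<lambda>s. chart (f s) y) \<in> borel_measurable borel"
      if [measurable]: "f \<in> borel_measurable borel" for f :: "real \<Rightarrow> real"
      unfolding chart_def by measurable
    show "(\<integral>\<^sup>+s. indicator A (chart s y) \<partial>lborel)
      = (\<integral>\<^sup>+s. ennreal \<bar>\<kappa>\<bar> * indicator A (chart (c + \<kappa> * s) y) \<partial>lborel)"
      by (subst nn_integral_real_affine[OF _ assms, of _ c]) (auto simp: nn_integral_cmult)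
  qed
  also have "\<dots> = (\<integral>\<^sup>+p. ennreal \<bar>\<kappa>\<bar> * indicator A (case p of (y, s) \<Rightarrow> chart (c + \<kappa> * s) y) \<partial>(lborel \<Otimes>\<^sub>M lborel))"
    by (subst lborel.nn_integral_fst[symmetric]) (auto simp: lborel_prod borel_prod)
  also have "\<dots> = emeasure (density (distr lborel borel (\<lambda>(y, s). chart (c + \<kappa> * s) y)) (\<lambda>_. ennreal \<bar>\<kappa>\<bar>)) A"
    by (subst emeasure_density) (auto simp: lborel_prod nn_integral_distr)
  finally show "emeasure lborel A
    = emeasure (density (distr lborel borel (\<lambda>(y, s). chart (c + \<kappa> * s) y)) (\<lambda>_. ennreal \<bar>\<kappa>\<bar>)) A" .
qed simp

lemma integral_rescaled_layers:
  fixes G :: "'a \<Rightarrow> real"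
  assumes \<kappa>: "\<kappa> \<noteq> 0" and [measurable]: "G \<in> borel_measurable borel"
  shows "(LINT z|lborel. G z) = \<bar>\<kappa>\<bar> * (LINT p|lborel. G (chart (c + \<kappa> * snd p) (fst p)))"
proof -
  have [measurable]: "(\<lambda>(y, s). chart (c + \<kappa> * s) y) \<in> borel_measurable borel"
    unfolding case_prod_beta by (rule measurable_chart_pair) measurable
  have "(LINT z|lborel. G z) = integral\<^sup>L (density (distr lborel borel (\<lambda>(y, s). chart (c + \<kappa> * s) y)) (\<lambda>_. ennreal \<bar>\<kappa>\<bar>)) G"
    using lborel_rescaled_layers[OF \<kappa>] by simp
  also have "\<dots> = (LINT z|distr lborel borel (\<lambda>(y, s). chart (c + \<kappa> * s) y). \<bar>\<kappa>\<bar> * G z)"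
    by (subst integral_density) auto
  also have "\<dots> = (LINT p|lborel. \<bar>\<kappa>\<bar> * G (chart (c + \<kappa> * snd p) (fst p)))"
    by (subst integral_distr) (auto simp: case_prod_beta)
  finally show ?thesis by simp
qed

text \<open>In the chart the equation of the second hyperplane has normal vector
  \<open>adjoint \<iota> b\<close>. If this is nonzero, the preimage is a hyperplane of the
  parameter space. If it vanishes, b is a or - a, the two hyperplanes are parallel and distinct, and
  the preimage is empty.\<close>

lemma null_vimage_hyperplane:
  assumes q: "norm (fst q) = 1" and ne: "hyperplane q \<noteq> hyperplane (a, c)"
  shows "emeasure lborel (chart c -` hyperplane q) = 0"
proof -
  obtain b d where bd: "q = (b, d)" by (cases q)
  have eq: "chart c -` hyperplane q = {y. adjoint \<iota> b \<bullet> y = d - c * (a \<bullet> b)}"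
    using adjoint_works[OF linear, of _ b]
    by (auto simp: hyperplane_def bd chart_def inner_add_right inner_commute algebra_simps)
  show ?thesis
  proof (cases "adjoint \<iota> b = 0")
    case False
    have "negligible {y. adjoint \<iota> b \<bullet> y = d - c * (a \<bullet> b)}"
      by (rule negligible_hyperplane) (use False in simp)
    hence "chart c -` hyperplane q \<in> null_sets lebesgue" by (simp add: eq negligible_iff_null_sets)
    moreover have "chart c -` hyperplane q \<in> sets borel"
      by (rule measurable_sets_borel[OF measurable_chart hyperplane_borel])
    ultimately show ?thesis by (simp add: null_sets_def)
  next
    case True
    have "b \<bullet> \<iota> y = 0" for y using adjoint_works[OF linear, of y b] True by (simp add: inner_commute)
    moreover have "b - (a \<bullet> b) *\<^sub>R a \<in> range \<iota>" by (simp add: range_\<iota> inner_diff_right)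
    ultimately have "b \<bullet> (b - (a \<bullet> b) *\<^sub>R a) = 0" by auto
    moreover have "b \<bullet> b = 1" using q by (simp add: bd dot_square_norm)
    ultimately have ab: "(a \<bullet> b) * (a \<bullet> b) = 1" by (simp add: inner_diff_right inner_commute)
    have "(b - (a \<bullet> b) *\<^sub>R a) \<bullet> (b - (a \<bullet> b) *\<^sub>R a) = 0"
      using \<open>b \<bullet> b = 1\<close> ab by (simp add: inner_simps inner_commute)
    hence b: "b = (a \<bullet> b) *\<^sub>R a" by simp
    have "d - c * (a \<bullet> b) \<noteq> 0"
    proof
      assume "d - c * (a \<bullet> b) = 0"
      hence "b \<bullet> z = d \<longleftrightarrow> a \<bullet> z = c" for z
        using ab by (subst b) (auto simp: )
      thus False using ne by (simp add: hyperplane_def bd)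
    qed
    thus ?thesis by (simp add: eq True)
  qed
qed

lemma null_hyperplane_Int:
  assumes q: "norm (fst q) = 1" and ne: "hyperplane q \<noteq> hyperplane (a, c)"
  shows "emeasure surface_measure (hyperplane (a, c) \<inter> hyperplane q) = 0"
proof -
  have "emeasure surface_measure (hyperplane (a, c) \<inter> hyperplane q)
      = (\<integral>\<^sup>+z. indicator (hyperplane (a, c)) z * indicator (hyperplane q) z \<partial>surface_measure)"
    by (simp add: indicator_inter_arith[symmetric])
  also have "\<dots> = (\<integral>\<^sup>+y. indicator (hyperplane q) (chart c y) \<partial>lborel)"
    by (rule nn_integral_hyperplane) measurable
  also have "\<dots> = (\<integral>\<^sup>+y. indicator (chart c -` hyperplane q) y \<partial>lborel)"
    by (simp add: indicator_vimage)
  also have "\<dots> = emeasure lborel (chart c -` hyperplane q)"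
    by (rule nn_integral_indicator)
      (simp add: measurable_sets_borel[OF measurable_chart hyperplane_borel])
  finally show ?thesis using null_vimage_hyperplane[OF assms] by simp
qed

end

lemma hyperplane_chart_exists:
  fixes a :: "'a::euclidean_space"
  assumes "norm a = 1" and dim: "DIM('a) = Suc DIM('b::euclidean_space)"
  obtains \<iota> :: "'b::euclidean_space \<Rightarrow> 'a" where "hyperplane_chart \<iota> a"
proof -
  have "a \<noteq> 0" using assms by auto
  hence "dim (UNIV :: 'b set) = dim {z. a \<bullet> z = 0}"
    using dim by (simp add: dim_hyperplane)
  then obtain f :: "'b \<Rightarrow> 'a" where "linear f" "f ` UNIV = {z. a \<bullet> z = 0}" "\<And>x. x \<in> UNIV \<Longrightarrow> norm (f x) = norm x"
    using isometry_subspaces[OF subspace_UNIV subspace_hyperplane, of a] by metis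
  hence "hyperplane_chart f a" using assms unfolding hyperplane_chart_def by auto
  thus ?thesis by (rule that)
qed

section \<open>Convex polyhedra and their facets\<close>


definition halfspace :: "'a::euclidean_space \<times> real \<Rightarrow> 'a set" where
  "halfspace p = {z. fst p \<bullet> z \<le> snd p}"

definition halfspaces_of :: "('a::euclidean_space \<times> real) set \<Rightarrow> 'a set \<Rightarrow> bool" where
  "halfspaces_of P T \<longleftrightarrow> finite P \<and> (\<forall>p\<in>P. norm (fst p) = 1) \<and> T = (\<Inter>p\<in>P. halfspace p)"

text \<open>The relatively open part of a face: since all other constraints are strict, the facets
  of different members of \<open>P\<close> are disjoint. The list of constraints may be redundant; a
  redundant one has an empty facet.\<close>

definition facet :: "('a::euclidean_space \<times> real) set \<Rightarrow> 'a \<times> real \<Rightarrow> 'a set" where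
  "facet P p = {z \<in> hyperplane p. \<forall>q\<in>P - {p}. fst q \<bullet> z < snd q}"

lemma halfspace_borel [measurable]: "halfspace p \<in> sets borel"
  unfolding halfspace_def by (intro borel_closed closed_halfspace_le)

lemma facet_borel [measurable]: "finite P \<Longrightarrow> facet P p \<in> sets borel"
proof -
  assume P: "finite P"
  have "facet P p = hyperplane p \<inter> (\<Inter>q\<in>P - {p}. {z. fst q \<bullet> z < snd q})"
    by (auto simp: facet_def)
  moreover have "open (\<Inter>q\<in>P - {p}. {z. fst q \<bullet> z < snd q})"
    using P by (intro open_INT) (auto intro: open_halfspace_lt)
  ultimately show ?thesis by simp
qed

lemma polyhedron_halfspaces:
  assumes "polyhedron T"
  obtains P where "halfspaces_of P T"
proof -
  obtain F where F: "finite F" "T = \<Inter>F" "\<forall>h\<in>F. \<exists>a b. a \<noteq> 0 \<and> h = {x. a \<bullet> x \<le> b}"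
    using assms unfolding polyhedron_def by blast
  have "\<forall>h\<in>F. \<exists>p. norm (fst p) = 1 \<and> h = halfspace p"
  proof
    fix h assume "h \<in> F"
    then obtain a b where ab: "a \<noteq> 0" "h = {x. a \<bullet> x \<le> b}" using F by blast
    hence "h = halfspace (a /\<^sub>R norm a, b / norm a)"
      by (auto simp: halfspace_def field_simps)
    thus "\<exists>p. norm (fst p) = 1 \<and> h = halfspace p"
      using ab by (intro exI[of _ "(a /\<^sub>R norm a, b / norm a)"]) auto
  qed
  then obtain p where p: "\<forall>h\<in>F. norm (fst (p h)) = 1 \<and> h = halfspace (p h)" by metis
  have "halfspaces_of (p ` F) T" using p F(1,2) by (force simp: halfspaces_of_def)
  thus ?thesis by (rule that)
qed

lemma hyperplane_eqD:
  assumes n: "norm (fst p) = 1" "norm (fst q) = 1" and eq: "hyperplane p = hyperplane q"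
  shows "q = p \<or> q = - p"
proof -
  obtain a b a' b' where p: "p = (a, b)" "q = (a', b')" by (cases p; cases q)
  have aa: "a \<bullet> a = 1" "a' \<bullet> a' = 1" using n by (auto simp: p dot_square_norm)
  \<comment> \<open>Two test points: the foot of the perpendicular from the origin, and the same
    point moved by the part of a' orthogonal to a. As both also lie on the second hyperplane, that
    part is orthogonal to a', which forces (a \<bullet> a')^2 = 1.\<close>
  have "b *\<^sub>R a \<in> hyperplane p" "b *\<^sub>R a + (a' - (a \<bullet> a') *\<^sub>R a) \<in> hyperplane p"
    by (simp_all add: hyperplane_def p inner_simps aa)
  hence h: "b * (a' \<bullet> a) = b'" "b * (a' \<bullet> a) + (a' \<bullet> (a' - (a \<bullet> a') *\<^sub>R a)) = b'"
    unfolding eq by (simp_all add: hyperplane_def p inner_add_right)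
  hence "(a \<bullet> a')\<^sup>2 = 1" by (simp add: inner_diff_right aa inner_commute power2_eq_square)
  hence "a \<bullet> a' = 1 \<or> a \<bullet> a' = -1" by (simp add: power2_eq_1_iff)
  moreover have "a' = a" if "a \<bullet> a' = 1"
  proof -
    have "(a' - a) \<bullet> (a' - a) = 0" using that aa by (simp add: inner_simps inner_commute)
    thus ?thesis by simp
  qed
  moreover have "a' = - a" if "a \<bullet> a' = -1"
  proof -
    have "(a' + a) \<bullet> (a' + a) = 0" using that aa by (simp add: inner_simps inner_commute)
    thus ?thesis by (simp add: eq_neg_iff_add_eq_0)
  qed
  ultimately show ?thesis using h(1) by (auto simp: p inner_commute aa)
qed

context
  fixes P :: "('a::euclidean_space \<times> real) set" and T :: "'a set"
  assumes P: "halfspaces_of P T"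
begin

lemma halfspaces_finite: "finite P" and halfspaces_norm: "p \<in> P \<Longrightarrow> norm (fst p) = 1"
  and halfspaces_mem: "z \<in> T \<longleftrightarrow> (\<forall>p\<in>P. fst p \<bullet> z \<le> snd p)"
  using P by (auto simp: halfspaces_of_def halfspace_def)

lemma closed_halfspaces: "closed T"
  using P by (auto simp: halfspaces_of_def halfspace_def intro!: closed_INT closed_halfspace_le)

lemma frontier_halfspaces:
  "z \<in> frontier T \<longleftrightarrow> z \<in> T \<and> (\<exists>p\<in>P. z \<in> hyperplane p)"
proof -
  have "z \<in> interior T \<longleftrightarrow> (\<forall>p\<in>P. fst p \<bullet> z < snd p)"
  proof
    assume z: "z \<in> interior T"
    show "\<forall>p\<in>P. fst p \<bullet> z < snd p"
    proof
      fix p assume p: "p \<in> P"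
      have "interior T \<subseteq> interior (halfspace p)"
        using p P by (intro interior_mono) (auto simp: halfspaces_of_def)
      moreover have "fst p \<noteq> 0" using halfspaces_norm[OF p] by auto
      ultimately show "fst p \<bullet> z < snd p"
        using z by (auto simp: halfspace_def)
    qed
  next
    assume z: "\<forall>p\<in>P. fst p \<bullet> z < snd p"
    have "open (\<Inter>p\<in>P. {z. fst p \<bullet> z < snd p})"
      using halfspaces_finite by (intro open_INT) (auto intro: open_halfspace_lt)
    moreover have "(\<Inter>p\<in>P. {z. fst p \<bullet> z < snd p}) \<subseteq> T" by (auto simp: halfspaces_mem less_imp_le)
    ultimately show "z \<in> interior T" using z by (auto simp: interior_def)
  qed
  thus ?thesis
    using closed_halfspaces by (auto simp: frontier_def halfspaces_mem hyperplane_def less_le)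
qed

lemma facet_subset_frontier: "p \<in> P \<Longrightarrow> facet P p \<subseteq> frontier T"
proof
  fix z assume p: "p \<in> P" and z: "z \<in> facet P p"
  have "fst q \<bullet> z \<le> snd q" if "q \<in> P" for q
    using z that by (cases "q = p") (auto simp: facet_def hyperplane_def less_imp_le)
  thus "z \<in> frontier T" using p z by (auto simp: frontier_halfspaces halfspaces_mem facet_def)
qed

lemma facet_locally_halfspace:
  assumes p: "p \<in> P" and z: "z \<in> facet P p"
  obtains r where "0 < r" "T \<inter> ball z r = halfspace p \<inter> ball z r"
proof -
  have "open (\<Inter>q\<in>P - {p}. {z. fst q \<bullet> z < snd q})"
    using halfspaces_finite by (intro open_INT) (auto intro: open_halfspace_lt)
  moreover have "z \<in> (\<Inter>q\<in>P - {p}. {z. fst q \<bullet> z < snd q})" using z by (auto simp: facet_def)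
  ultimately obtain r where r: "0 < r" "ball z r \<subseteq> (\<Inter>q\<in>P - {p}. {z. fst q \<bullet> z < snd q})"
    using openE by blast
  have "T \<inter> ball z r = halfspace p \<inter> ball z r"
  proof (intro set_eqI iffI)
    fix y assume "y \<in> T \<inter> ball z r"
    thus "y \<in> halfspace p \<inter> ball z r" using p by (auto simp: halfspaces_mem halfspace_def)
  next
    fix y assume y: "y \<in> halfspace p \<inter> ball z r"
    have "fst q \<bullet> y \<le> snd q" if "q \<in> P" for q
      using y r(2) that by (cases "q = p") (auto simp: halfspace_def subset_iff less_imp_le)
    thus "y \<in> T \<inter> ball z r" using y by (auto simp: halfspaces_mem)
  qed
  thus ?thesis using r(1) that by blast
qed

text \<open>Near a point of a facet \<open>T\<close> coincides with a half-space, so the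
  inequalities defining the normal cone hold for all directions pointing into that
  half-space.\<close>

lemma outward_normal_facet:
  assumes p: "p \<in> P" and z: "z \<in> facet P p"
  shows "outward_normal T z = fst p"
proof -
  let ?N = "\<lambda>n. norm n = 1 \<and> (\<forall>y\<in>T. n \<bullet> (y - z) \<le> 0)"
  have zp: "fst p \<bullet> z = snd p" using z by (simp add: facet_def hyperplane_def)
  have Np: "?N (fst p)" using p zp by (auto simp: halfspaces_norm halfspaces_mem inner_diff_right)
  have aa: "fst p \<bullet> fst p = 1" using halfspaces_norm[OF p] by (simp add: dot_square_norm)
  have un: "n = fst p" if n: "?N n" for n
  proof -
    have nn: "n \<bullet> n = 1" using n by (simp add: dot_square_norm)
    obtain r where r: "0 < r" "T \<inter> ball z r = halfspace p \<inter> ball z r"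
      by (rule facet_locally_halfspace[OF p z])
    have dir: "n \<bullet> h \<le> 0" if h: "fst p \<bullet> h \<le> 0" for h
    proof (cases "h = 0")
      case False
      define s where "s = r / (2 * norm h)"
      have s: "0 < s" using r False by (simp add: s_def)
      have "s * (fst p \<bullet> h) \<le> 0" using s h by (simp add: mult_nonneg_nonpos)
      moreover have "s * norm h < r" using r False by (simp add: s_def)
      ultimately have "z + s *\<^sub>R h \<in> halfspace p \<inter> ball z r"
        using s zp by (simp add: halfspace_def inner_add_right dist_norm)
      hence "z + s *\<^sub>R h \<in> T" unfolding r(2)[symmetric] by (rule IntD1)
      hence "n \<bullet> ((z + s *\<^sub>R h) - z) \<le> 0" using n by blast
      hence "n \<bullet> (s *\<^sub>R h) \<le> 0" by simp
      thus ?thesis using s by (simp add: mult_le_0_iff)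
    qed simp
    \<comment> \<open>Testing with the part of n orthogonal to \<open>fst p\<close> shows that n is
      \<open>fst p\<close> up to sign; testing with \<open>- fst p\<close> below fixes the
      sign.\<close>
    have "n \<bullet> (n - (fst p \<bullet> n) *\<^sub>R fst p) \<le> 0" by (rule dir) (simp add: inner_diff_right aa)
    hence "1 \<le> (fst p \<bullet> n)\<^sup>2" by (simp add: inner_diff_right nn power2_eq_square inner_commute)
    moreover have "n \<bullet> (- fst p) \<le> 0" by (rule dir) (simp add: aa)
    hence "0 \<le> fst p \<bullet> n" by (simp add: inner_commute)
    ultimately have "1 \<le> fst p \<bullet> n" by (smt (verit) power2_eq_1_iff power_le_one)
    moreover have "(n - fst p) \<bullet> (n - fst p) = 2 - 2 * (fst p \<bullet> n)"
      by (simp add: inner_simps nn aa inner_commute)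
    ultimately have "(n - fst p) \<bullet> (n - fst p) \<le> 0" by simp
    thus ?thesis by (metis inner_gt_zero_iff not_le right_minus_eq)
  qed
  have ex1: "\<exists>!n. ?N n" using Np un by blast
  hence "outward_normal T z = (THE n. ?N n)" by (simp add: outward_normal_def)
  also have "\<dots> = fst p" using Np un by (rule the_equality)
  finally show ?thesis .
qed

lemma outward_normal_tie:
  assumes p: "p \<in> P" "q \<in> P" "p \<noteq> q" and z: "z \<in> hyperplane p" "z \<in> hyperplane q"
  shows "outward_normal T z = 0"
proof -
  let ?N = "\<lambda>n. norm n = 1 \<and> (\<forall>y\<in>T. n \<bullet> (y - z) \<le> 0)"
  have "?N (fst p)" "?N (fst q)" using p z
    by (auto simp: halfspaces_norm halfspaces_mem inner_diff_right hyperplane_def)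
  moreover have "fst p \<noteq> fst q" using p z by (auto simp: hyperplane_def prod_eq_iff)
  ultimately have "\<not> (\<exists>!n. ?N n)" by blast
  thus ?thesis unfolding outward_normal_def Let_def by simp
qed

text \<open>Holds at every frontier point: where two constraints are tight no facet contains z, and
  the normal takes its default value 0 there because the normal cone has two unit vectors. The
  formula makes the normal, given by a description, accessible to integration facet by
  facet.\<close>

lemma outward_normal_eq_sum:
  assumes z: "z \<in> frontier T"
  shows "outward_normal T z = (\<Sum>p\<in>P. indicator (facet P p) z *\<^sub>R fst p)"
proof -
  obtain p where p: "p \<in> P" "z \<in> hyperplane p" using z frontier_halfspaces by blast
  have zT: "z \<in> T" using z frontier_halfspaces by blast
  show ?thesis
  proof (cases "z \<in> facet P p")
    case True
    have "(\<Sum>q\<in>P. indicator (facet P q) z *\<^sub>R fst q) = (\<Sum>q\<in>P. if q = p then fst p else 0)"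
    proof (rule sum.cong)
      fix q assume "q \<in> P"
      moreover have "z \<notin> facet P q" if "q \<noteq> p"
      proof -
        have "p \<in> P - {q}" "\<not> fst p \<bullet> z < snd p" using p that by (auto simp: hyperplane_def)
        thus ?thesis unfolding facet_def by blast
      qed
      ultimately show "indicator (facet P q) z *\<^sub>R fst q = (if q = p then fst p else 0)"
        using True by (auto simp: indicator_def)
    qed simp
    thus ?thesis using p True halfspaces_finite by (simp add: outward_normal_facet)
  next
    case False
    then obtain q where q: "q \<in> P" "q \<noteq> p" "\<not> fst q \<bullet> z < snd q" using p by (auto simp: facet_def)
    hence "z \<in> hyperplane q" using zT by (force simp: halfspaces_mem hyperplane_def)
    moreover have "z \<notin> facet P r" if "r \<in> P" for r
    proof -
      obtain s where s: "s \<in> P - {r}" "fst s \<bullet> z = snd s"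
        using p q \<open>z \<in> hyperplane q\<close> unfolding hyperplane_def by blast
      hence "\<not> fst s \<bullet> z < snd s" by simp
      thus ?thesis using s(1) unfolding facet_def by blast
    qed
    hence "(\<Sum>r\<in>P. indicator (facet P r) z *\<^sub>R fst r) = 0" by (intro sum.neutral) auto
    ultimately show ?thesis using outward_normal_tie[OF p(1) q(1) _ p(2)] q by auto
  qed
qed

text \<open>Two different constraints with one hyperplane are opposite, and would squeeze
  \<open>T\<close> into that hyperplane.\<close>

lemma hyperplane_neq:
  assumes "interior T \<noteq> {}" "p \<in> P" "q \<in> P" "p \<noteq> q"
  shows "hyperplane p \<noteq> hyperplane q"
proof
  assume "hyperplane p = hyperplane q"
  hence "q = - p" using hyperplane_eqD[of p q] halfspaces_norm assms by auto
  have "T \<subseteq> hyperplane p"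
  proof
    fix z assume "z \<in> T"
    hence "fst p \<bullet> z \<le> snd p" "fst q \<bullet> z \<le> snd q" using assms halfspaces_mem by blast+
    thus "z \<in> hyperplane p" by (simp add: hyperplane_def \<open>q = - p\<close>)
  qed
  hence "interior T \<subseteq> interior (hyperplane p)" by (rule interior_mono)
  moreover have "fst p \<noteq> 0" using halfspaces_norm[OF assms(2)] by auto
  ultimately show False using assms(1) by (simp add: hyperplane_def)
qed

end

lemma null_ties:
  fixes p q :: "'a::euclidean_space \<times> real"
  assumes "norm (fst p) = 1" "norm (fst q) = 1" "hyperplane p \<noteq> hyperplane q"
    and dim: "DIM('a) = Suc DIM('b::euclidean_space)"
  shows "hyperplane p \<inter> hyperplane q \<in> null_sets surface_measure"
proof -
  obtain \<iota> :: "'b \<Rightarrow> 'a" where "hyperplane_chart \<iota> (fst p)"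
    by (rule hyperplane_chart_exists[OF assms(1) dim])
  then interpret hyperplane_chart \<iota> "fst p" .
  show ?thesis using null_hyperplane_Int[of q "snd p"] assms by (simp add: null_sets_def)
qed

section \<open>Half-space indicators under small translations\<close>

lemma prod_diff_telescope:
  fixes A B :: "nat \<Rightarrow> real"
  shows "(\<Prod>j<m. A j) - (\<Prod>j<m. B j) = (\<Sum>i<m. (\<Prod>j<i. A j) * (\<Prod>j\<in>{i<..<m}. B j) * (A i - B i))"
proof (induction m)
  case (Suc m)
  have pr: "(\<Prod>j\<in>{i<..<Suc m}. B j) = (\<Prod>j\<in>{i<..<m}. B j) * B m" if "i < m" for i
  proof -
    have "{i<..<Suc m} = insert m {i<..<m}" using that by auto
    thus ?thesis by simp
  qed
  have "(\<Sum>i<m. (\<Prod>j<i. A j) * (\<Prod>j\<in>{i<..<Suc m}. B j) * (A i - B i))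
      = (\<Sum>i<m. (\<Prod>j<i. A j) * (\<Prod>j\<in>{i<..<m}. B j) * (A i - B i)) * B m"
    unfolding sum_distrib_right by (intro sum.cong) (auto simp: mult_ac pr)
  moreover have "{m<..<Suc m} = {}" by auto
  ultimately show ?case using arg_cong[OF Suc.IH, of "\<lambda>x. B m * x"] by (simp add: algebra_simps)
qed simp

lemma tendsto_indicator_halfspace:
  assumes w: "w \<longlonglongrightarrow> z" and z: "z \<notin> hyperplane p"
  shows "(\<lambda>n. indicator (halfspace p) (w n) :: real) \<longlonglongrightarrow> indicator (halfspace p) z"
proof (rule tendsto_eventually)
  have lim: "(\<lambda>n. fst p \<bullet> w n) \<longlonglongrightarrow> fst p \<bullet> z" by (intro tendsto_intros w)
  show "eventually (\<lambda>n. indicator (halfspace p) (w n) = (indicator (halfspace p) z :: real)) sequentially"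
  proof (cases "fst p \<bullet> z < snd p")
    case True
    hence "eventually (\<lambda>n. fst p \<bullet> w n < snd p) sequentially" by (rule order_tendstoD(2)[OF lim])
    thus ?thesis by eventually_elim (use True in \<open>auto simp: halfspace_def\<close>)
  next
    case False
    hence "snd p < fst p \<bullet> z" using z by (auto simp: hyperplane_def)
    hence "eventually (\<lambda>n. snd p < fst p \<bullet> w n) sequentially" by (rule order_tendstoD(1)[OF lim])
    thus ?thesis by eventually_elim (use \<open>snd p < fst p \<bullet> z\<close> in \<open>auto simp: halfspace_def\<close>)
  qed
qed

lemma bounded_support_bound:
  fixes f :: "'a::euclidean_space \<Rightarrow> real"
  assumes "continuous_on UNIV f" "\<And>z. R < norm z \<Longrightarrow> f z = 0"
  obtains M where "0 \<le> M" "\<And>z. \<bar>f z\<bar> \<le> M"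
proof -
  have "compact (f ` cball 0 R)"
    using assms(1) by (intro compact_continuous_image) (auto intro: continuous_on_subset)
  then obtain M where M: "\<And>z. z \<in> cball 0 R \<Longrightarrow> norm (f z) \<le> M"
    using compact_imp_bounded bounded_iff by (metis imageI)
  have "\<bar>f z\<bar> \<le> max 0 M" for z
    using M[of z] assms(2)[of z] by (cases "norm z \<le> R") auto
  thus ?thesis using that[of "max 0 M"] by auto
qed

lemma integrable_bounded_support:
  fixes f :: "'a::euclidean_space \<Rightarrow> real"
  assumes "f \<in> borel_measurable borel" "\<And>z. \<bar>f z\<bar> \<le> M" "\<And>z. R < norm z \<Longrightarrow> f z = 0"
  shows "integrable lborel f"
proof (rule Bochner_Integration.integrable_bound)
  show "integrable lborel (\<lambda>z::'a. M * indicator (cball 0 R) z)"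
    using emeasure_bounded_finite[of "cball (0::'a) R"]
    by (intro integrable_mult_right integrable_real_indicator) (auto simp: less_top)
  show "AE z in lborel. norm (f z) \<le> norm (M * indicator (cball 0 R) z)"
  proof (rule AE_I2)
    fix z
    show "norm (f z) \<le> norm (M * indicator (cball 0 R) z)"
      using assms(2)[of z] assms(3)[of z] by (cases "norm z \<le> R") (auto simp: indicator_def)
  qed
qed (use assms in simp)

context hyperplane_chart
begin

lemma norm_chart: "(norm (chart c y))\<^sup>2 = (norm y)\<^sup>2 + c\<^sup>2"
  using dist_chart[of c y 0 0] linear_0[OF linear]
  by (simp add: chart_def dist_norm dist_real_def)

lemma norm_le_chart: "norm y \<le> norm (chart c y)"
proof (rule power2_le_imp_le)
  show "(norm y)\<^sup>2 \<le> (norm (chart c y))\<^sup>2" unfolding norm_chart by simp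
qed simp

text \<open>The translation moves the boundary by \<kappa>, which is one unit of the rescaled
  height. Half-spaces are closed, so the sign of \<kappa> decides which end of the unit interval is
  included.\<close>

lemma layer_indicator:
  assumes \<kappa>: "\<kappa> \<noteq> 0" "\<kappa> = t * (a \<bullet> e)"
  shows "indicator (halfspace (a, b)) (chart (b + \<kappa> * s) y - t *\<^sub>R e)
      - indicator (halfspace (a, b)) (chart (b + \<kappa> * s) y)
    = sgn \<kappa> * (indicator (if 0 < \<kappa> then {0<..1} else {0..<1}) s :: real)"
proof -
  have 1: "chart (b + \<kappa> * s) y - t *\<^sub>R e \<in> halfspace (a, b) \<longleftrightarrow> \<kappa> * s \<le> \<kappa>"
    by (simp add: halfspace_def inner_diff_right \<kappa>(2))
  have 2: "chart (b + \<kappa> * s) y \<in> halfspace (a, b) \<longleftrightarrow> \<kappa> * s \<le> 0"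
    by (simp add: halfspace_def)
  show ?thesis
  proof (cases "0 < \<kappa>")
    case True
    thus ?thesis unfolding indicator_def 1 2
      by (auto simp: mult_le_0_iff mult_le_cancel_left1 mult_le_cancel_left2)
  next
    case False
    hence "\<kappa> < 0" using \<kappa>(1) by linarith
    thus ?thesis unfolding indicator_def 1 2
      by (auto simp: mult_le_0_iff mult_le_cancel_left1 mult_le_cancel_left2)
  qed
qed

text \<open>After rescaling, the factor |\<kappa>| sgn \<kappa> / t equals a \<bullet> e exactly,
  for every n. What remains is dominated convergence on the fixed box
  \<open>cball 0 R \<times> {0..1}\<close>, where convergence of \<open>Q\<close> may fail over the
  null set \<open>N\<close>. If a \<bullet> e = 0, the half-space is invariant and both sides
  vanish.\<close>

lemma layer_limit:
  fixes f :: "'a \<Rightarrow> real" and Q :: "nat \<Rightarrow> 'a \<Rightarrow> real" and Q0 :: "'a \<Rightarrow> real"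
  assumes f: "continuous_on UNIV f" "\<And>z. R < norm z \<Longrightarrow> f z = 0"
    and Q: "\<And>n. Q n \<in> borel_measurable borel" "\<And>n z. \<bar>Q n z\<bar> \<le> 1"
    and Q0[measurable]: "Q0 \<in> borel_measurable borel" and Q0b: "\<And>z. \<bar>Q0 z\<bar> \<le> 1"
    and t: "\<And>n. 0 < t n" "t \<longlonglongrightarrow> 0"
    and N: "N \<in> sets borel" "emeasure lborel N = 0"
    and lim: "\<And>y s. y \<notin> N \<Longrightarrow> (\<lambda>n. Q n (chart (b + t n * (a \<bullet> e) * s) y)) \<longlonglongrightarrow> Q0 (chart b y)"
  shows "(\<lambda>n. LINT z|lborel. f z * Q n z *
      (indicator (halfspace (a, b)) (z - t n *\<^sub>R e) - indicator (halfspace (a, b)) z) / t n)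
    \<longlonglongrightarrow> (a \<bullet> e) * (LINT y|lborel. f (chart b y) * Q0 (chart b y))"
proof (cases "a \<bullet> e = 0")
  case True
  have "indicator (halfspace (a, b)) (z - t n *\<^sub>R e) = (indicator (halfspace (a, b)) z :: real)" for z n
    using True by (simp add: indicator_def halfspace_def inner_diff_right)
  thus ?thesis using True by simp
next
  case k: False
  define J where "J = (if 0 < a \<bullet> e then {0<..1} else {0..<1::real})"
  have J: "J \<in> sets borel" "J \<subseteq> {0..1}" "(LINT s|lborel. indicator J s :: real) = 1" "integrable lborel (indicator J :: real \<Rightarrow> real)"
    by (auto simp: J_def)
  note [measurable] = J(1) Q(1) borel_measurable_continuous_onI[OF f(1)] N(1)
  define F where "F n p = f (chart (b + t n * (a \<bullet> e) * snd p) (fst p))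
      * Q n (chart (b + t n * (a \<bullet> e) * snd p) (fst p)) * indicator J (snd p)" for n :: nat and p :: "'b \<times> real"
  define F0 where "F0 p = f (chart b (fst p)) * Q0 (chart b (fst p)) * indicator J (snd p)" for p :: "'b \<times> real"
  have ms[measurable]: "snd \<in> borel_measurable (borel :: ('b \<times> real) measure)" "fst \<in> borel_measurable (borel :: ('b \<times> real) measure)"
    by (intro borel_measurable_continuous_onI continuous_intros)+
  have mc: "(\<lambda>p::'b \<times> real. chart (b + c * snd p) (fst p)) \<in> borel_measurable borel" for c
    by (rule measurable_chart_pair[of "\<lambda>s. b + c * s"]) measurable
  have mJ: "(\<lambda>p::'b \<times> real. indicator J (snd p) :: real) \<in> borel_measurable borel"
    by (rule measurable_compose[OF ms(1)]) measurable
  have mF: "F n \<in> borel_measurable borel" for n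
    unfolding F_def by (intro borel_measurable_times mJ measurable_compose[OF mc] Q borel_measurable_continuous_onI[OF f(1)])
  have mF0: "F0 \<in> borel_measurable borel"
    using measurable_compose[OF mc[of 0]] Q0 borel_measurable_continuous_onI[OF f(1)]
    unfolding F0_def by (intro borel_measurable_times mJ) auto
  have eq: "(LINT z|lborel. f z * Q n z *
      (indicator (halfspace (a, b)) (z - t n *\<^sub>R e) - indicator (halfspace (a, b)) z) / t n)
    = (a \<bullet> e) * (LINT p|lborel. F n p)" for n
  proof -
    have tn: "0 < t n" by (rule t)
    define \<kappa> where "\<kappa> = t n * (a \<bullet> e)"
    have \<kappa>: "\<kappa> \<noteq> 0" using k tn by (simp add: \<kappa>_def)
    have sg: "0 < \<kappa> \<longleftrightarrow> 0 < a \<bullet> e" using tn by (simp add: \<kappa>_def zero_less_mult_iff)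
    have *: "f (chart (b + \<kappa> * snd p) (fst p)) * Q n (chart (b + \<kappa> * snd p) (fst p)) *
        (indicator (halfspace (a, b)) (chart (b + \<kappa> * snd p) (fst p) - t n *\<^sub>R e)
          - indicator (halfspace (a, b)) (chart (b + \<kappa> * snd p) (fst p))) / t n
        = sgn \<kappa> / t n * F n p" for p
      unfolding layer_indicator[OF \<kappa> \<kappa>_def] sg J_def F_def by (simp add: \<kappa>_def)
    have "(LINT z|lborel. f z * Q n z *
      (indicator (halfspace (a, b)) (z - t n *\<^sub>R e) - indicator (halfspace (a, b)) z) / t n)
      = \<bar>\<kappa>\<bar> * (LINT p|lborel. sgn \<kappa> / t n * F n p)"
      by (subst integral_rescaled_layers[OF \<kappa>, of _ b]) (simp_all only: *, measurable)
    also have "\<dots> = \<bar>\<kappa>\<bar> * sgn \<kappa> / t n * (LINT p|lborel. F n p)" by simp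
    also have "\<bar>\<kappa>\<bar> * sgn \<kappa> / t n = a \<bullet> e"
      using tn by (simp add: abs_mult_sgn \<kappa>_def)
    finally show ?thesis .
  qed
  obtain M where M: "0 \<le> M" "\<And>z. \<bar>f z\<bar> \<le> M" using bounded_support_bound[OF f] by metis
  have bound: "\<bar>F n p\<bar> \<le> M * indicator (cball 0 R \<times> {0..1}) p" for n p
  proof (cases "p \<in> cball 0 R \<times> {0..1}")
    case True
    have "\<bar>F n p\<bar> \<le> M * 1 * 1"
      unfolding F_def F0_def abs_mult using M Q(2) by (intro mult_mono) (auto simp: indicator_def)
    thus ?thesis using True by simp
  next
    case False
    hence "R < norm (fst p) \<or> snd p \<notin> J" using J(2) by (cases p) auto
    hence "F n p = 0"
    proof
      assume "R < norm (fst p)"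
      hence "R < norm (chart (b + t n * (a \<bullet> e) * snd p) (fst p))"
        by (rule less_le_trans[OF _ norm_le_chart])
      thus ?thesis by (simp add: F_def f(2))
    qed (simp add: F_def)
    thus ?thesis using False by simp
  qed
  have AEN: "AE p in (lborel :: ('b \<times> real) measure). fst p \<notin> N"
  proof (rule AE_I)
    have "emeasure (lborel \<Otimes>\<^sub>M lborel) (N \<times> (UNIV :: real set)) = 0"
      using N by (subst lborel.emeasure_pair_measure_Times) auto
    thus "emeasure lborel (N \<times> (UNIV :: real set)) = 0" by (simp add: lborel_prod)
    show "N \<times> (UNIV :: real set) \<in> sets lborel"
      using N by (simp add: borel_Times)
  qed auto
  have intB: "integrable lborel (\<lambda>p::'b \<times> real. M * indicator (cball 0 R \<times> {0..1}) p)"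
    using emeasure_bounded_finite[of "cball (0::'b) R \<times> {0..1::real}"]
    by (intro integrable_mult_right integrable_real_indicator)
      (auto simp: bounded_Times intro!: borel_closed closed_Times)
  have limF: "(\<lambda>n. LINT p|lborel. F n p) \<longlonglongrightarrow> (LINT p|lborel. F0 p)"
  proof (rule integral_dominated_convergence)
    show "integrable lborel (\<lambda>p::'b \<times> real. M * indicator (cball 0 R \<times> {0..1}) p)"
      by (rule intB)
    show "AE p in lborel. norm (F n p) \<le> M * indicator (cball 0 R \<times> {0..1}) p" for n
      using bound by simp
    show "AE p in lborel. (\<lambda>n. F n p) \<longlonglongrightarrow> F0 p"
      using AEN
    proof eventually_elim
      fix p :: "'b \<times> real" assume "fst p \<notin> N"
      have c: "(\<lambda>n. chart (b + t n * (a \<bullet> e) * snd p) (fst p)) \<longlonglongrightarrow> chart (b + 0 * (a \<bullet> e) * snd p) (fst p)"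
        unfolding chart_def by (intro tendsto_intros t(2))
      have "(\<lambda>n. f (chart (b + t n * (a \<bullet> e) * snd p) (fst p))) \<longlonglongrightarrow> f (chart (b + 0 * (a \<bullet> e) * snd p) (fst p))"
        using f(1) c by (rule continuous_on_tendsto_compose) auto
      thus "(\<lambda>n. F n p) \<longlonglongrightarrow> F0 p"
        using lim[OF \<open>fst p \<notin> N\<close>, of "snd p"] unfolding F_def F0_def by (intro tendsto_mult) auto
    qed
  qed (use mF mF0 in simp_all)
  have "(LINT p|lborel. F0 p) = (LINT y|lborel. f (chart b y) * Q0 (chart b y))"
  proof -
    have "\<bar>F0 p\<bar> \<le> M * indicator (cball 0 R \<times> {0..1}) p" for p
    proof (cases "p \<in> cball 0 R \<times> {0..1}")
      case True
      have "\<bar>F0 p\<bar> \<le> M * 1 * 1"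
        unfolding F_def F0_def abs_mult using M Q0b by (intro mult_mono) (auto simp: indicator_def)
      thus ?thesis using True by simp
    next
      case False
      hence "R < norm (fst p) \<or> snd p \<notin> J" using J(2) by (cases p) auto
      hence "F0 p = 0"
        using f(2) less_le_trans[OF _ norm_le_chart, of R "fst p" b] by (auto simp: F0_def)
      thus ?thesis using False by simp
    qed
    hence "AE p in lborel. norm (F0 p) \<le> norm (M * indicator (cball 0 R \<times> {0..1}) p)"
      using M(1) by (intro AE_I2) (simp add: abs_mult)
    hence "integrable lborel F0"
      using mF0 by (intro Bochner_Integration.integrable_bound[OF intB]) simp_all
    hence "integrable (lborel \<Otimes>\<^sub>M lborel) (\<lambda>p. F0 p)" by (simp add: lborel_prod)
    hence "(LINT y|lborel. LINT s|lborel. F0 (y, s)) = (LINT p|(lborel \<Otimes>\<^sub>M lborel). F0 p)"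
      by (rule lborel_pair.integral_fst')
    thus ?thesis using J by (simp add: lborel_prod F0_def)
  qed
  thus ?thesis unfolding eq using limF by (intro tendsto_mult tendsto_const) simp
qed

end

section \<open>The Gauss theorem on convex polyhedra\<close>


lemma finite_cball: "emeasure lborel (cball (c::'a::euclidean_space) r) < \<infinity>"
  by (rule emeasure_bounded_finite) simp

lemma facet_integrable:
  fixes p :: "'a::euclidean_space \<times> real" and h :: "'a \<Rightarrow> real"
  assumes p: "norm (fst p) = 1" and P: "finite P" and dim: "DIM('a) = Suc DIM('b::euclidean_space)"
    and h[measurable]: "h \<in> borel_measurable borel" "\<And>z. \<bar>h z\<bar> \<le> M" "\<And>z. R < norm z \<Longrightarrow> h z = 0"
  shows "integrable surface_measure (\<lambda>z. indicator (facet P p) z * h z)"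
proof -
  obtain \<iota> :: "'b \<Rightarrow> 'a" where "hyperplane_chart \<iota> (fst p)"
    by (rule hyperplane_chart_exists[OF p dim])
  then interpret hyperplane_chart \<iota> "fst p" .
  have [measurable]: "facet P p \<in> sets borel" by (rule facet_borel[OF P])
  have eq: "indicator (facet P p) z * h z
      = indicator (hyperplane (fst p, snd p)) z * (indicator (facet P p) z * h z)" for z
    by (auto simp: facet_def indicator_def)
  have "integrable lborel (\<lambda>y. indicator (facet P p) (chart (snd p) y) * h (chart (snd p) y))"
  proof (rule integrable_bounded_support[where M = M and R = R])
    show "(\<lambda>y. indicator (facet P p) (chart (snd p) y) * h (chart (snd p) y)) \<in> borel_measurable borel"
      by measurable
    fix y
    have "0 \<le> M" using h(2)[of 0] by (rule order_trans[OF abs_ge_zero])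
    thus "\<bar>indicator (facet P p) (chart (snd p) y) * h (chart (snd p) y)\<bar> \<le> M"
      using h(2) by (auto simp: indicator_def)
    assume "R < norm y"
    hence "R < norm (chart (snd p) y)" by (rule less_le_trans[OF _ norm_le_chart])
    thus "indicator (facet P p) (chart (snd p) y) * h (chart (snd p) y) = 0" by (simp add: h(3))
  qed
  thus ?thesis
    by (subst eq) (subst hyperplane_integral(1), measurable)
qed

text \<open>\<open>Q\<close> collects the remaining constraints, those before i translated and those
  after i not. On the hyperplane of constraint i it tends to the indicator of the facet wherever no
  other constraint is tight. The exceptional parameters form a null set because the nonempty
  interior of \<open>T\<close> keeps the hyperplanes distinct.\<close>

lemma facet_limit:
  fixes f :: "'a::euclidean_space \<Rightarrow> real" and p :: "nat \<Rightarrow> 'a \<times> real" and e :: 'a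
  assumes P: "halfspaces_of P T" and int: "interior T \<noteq> {}"
    and dim: "DIM('a) = Suc DIM('b::euclidean_space)"
    and bij: "bij_betw p {..<m} P" and i: "i < m"
    and f: "continuous_on UNIV f" "\<And>z. R < norm z \<Longrightarrow> f z = 0"
    and t: "\<And>n::nat. 0 < t n" "t \<longlonglongrightarrow> (0::real)"
  defines "Q n z \<equiv> (\<Prod>j<i. indicator (halfspace (p j)) (z - t n *\<^sub>R e)) * (\<Prod>j\<in>{i<..<m}. indicator (halfspace (p j)) z)"
  shows "(\<lambda>n. LINT z|lborel. f z * Q n z *
      (indicator (halfspace (p i)) (z - t n *\<^sub>R e) - indicator (halfspace (p i)) z) / t n)
    \<longlonglongrightarrow> (fst (p i) \<bullet> e) * (LINT z|surface_measure. indicator (facet P (p i)) z * f z)"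
proof -
  have pP: "p j \<in> P" if "j < m" for j using bij that by (auto simp: bij_betw_def)
  have inj: "p j \<noteq> p k" if "j < m" "k < m" "j \<noteq> k" for j k
    using bij that by (auto simp: bij_betw_def inj_on_def)
  have norm_p: "norm (fst (p j)) = 1" if "j < m" for j
    using halfspaces_norm[OF P pP[OF that]] .
  define b where "b = snd (p i)"
  have pi: "p i = (fst (p i), b)" by (simp add: b_def)
  have finP: "finite P" by (rule halfspaces_finite[OF P])
  obtain \<iota> :: "'b \<Rightarrow> 'a" where "hyperplane_chart \<iota> (fst (p i))"
    by (rule hyperplane_chart_exists[OF norm_p[OF i] dim])
  then interpret hyperplane_chart \<iota> "fst (p i)" .
  let ?Q0 = "indicator (facet P (p i)) :: 'a \<Rightarrow> real"
  define N where "N = (\<Union>j\<in>{..<m} - {i}. chart b -` hyperplane (p j))"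
  have [measurable]: "facet P (p i) \<in> sets borel" by (rule facet_borel[OF finP])
  have N1: "chart b -` hyperplane (p j) \<in> null_sets lborel" if "j \<in> {..<m} - {i}" for j
  proof -
    have "hyperplane (p j) \<noteq> hyperplane (fst (p i), b)"
      using hyperplane_neq[OF P int pP[of j] pP[OF i]] inj[of j i] that i pi by auto
    hence "emeasure lborel (chart b -` hyperplane (p j)) = 0"
      using that by (intro null_vimage_hyperplane norm_p) auto
    moreover have "chart b -` hyperplane (p j) \<in> sets borel"
      by (rule measurable_sets_borel[OF measurable_chart hyperplane_borel])
    ultimately show ?thesis by (simp add: null_sets_def)
  qed
  have "N \<in> null_sets lborel" unfolding N_def by (rule null_sets.finite_UN) (use N1 in auto)
  hence N: "N \<in> sets borel" "emeasure lborel N = 0" by (auto simp: null_sets_def)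
  have bnd: "\<bar>\<Prod>j\<in>J. indicator (A j) (x j) :: real\<bar> \<le> 1" for J :: "nat set" and A :: "nat \<Rightarrow> 'a set" and x
    unfolding abs_prod by (rule prod_le_1) (auto simp: indicator_def)
  have Qm: "Q n \<in> borel_measurable borel" for n
    unfolding Q_def[abs_def] by measurable
  have Qb: "\<bar>Q n z\<bar> \<le> 1" for n z
  proof -
    have "\<bar>Q n z\<bar> \<le> 1 * 1" unfolding Q_def abs_mult by (intro mult_mono bnd) auto
    thus ?thesis by simp
  qed
  have lim: "(\<lambda>n. Q n (chart (b + t n * (fst (p i) \<bullet> e) * s) y)) \<longlonglongrightarrow> ?Q0 (chart b y)"
    if y: "y \<notin> N" for y s
  proof -
    let ?z = "chart b y" and ?w = "\<lambda>n. chart (b + t n * (fst (p i) \<bullet> e) * s) y"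
    have w: "?w \<longlonglongrightarrow> ?z"
    proof -
      have "?w \<longlonglongrightarrow> chart (b + 0 * (fst (p i) \<bullet> e) * s) y"
        unfolding chart_def by (intro tendsto_intros t(2))
      thus ?thesis by simp
    qed
    have "(\<lambda>n. ?w n - t n *\<^sub>R e) \<longlonglongrightarrow> ?z - 0 *\<^sub>R e" by (intro tendsto_intros w t(2))
    hence w': "(\<lambda>n. ?w n - t n *\<^sub>R e) \<longlonglongrightarrow> ?z" by simp
    have nh: "?z \<notin> hyperplane (p j)" if "j < m" "j \<noteq> i" for j
      using y that by (auto simp: N_def)
    have "(\<lambda>n. Q n (?w n)) \<longlonglongrightarrow> (\<Prod>j<i. indicator (halfspace (p j)) ?z) * (\<Prod>j\<in>{i<..<m}. indicator (halfspace (p j)) ?z)"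
      unfolding Q_def
      by (intro tendsto_mult tendsto_prod tendsto_indicator_halfspace w w') (use nh i in auto)
    moreover have "(\<Prod>j<i. indicator (halfspace (p j)) ?z) * (\<Prod>j\<in>{i<..<m}. indicator (halfspace (p j)) ?z) = ?Q0 ?z"
    proof -
      have un: "{..<i} \<union> {i<..<m} = {..<m} - {i}" using i by auto
      have "(\<Prod>j<i. indicator (halfspace (p j)) ?z) * (\<Prod>j\<in>{i<..<m}. indicator (halfspace (p j)) ?z)
          = (\<Prod>j\<in>{..<i} \<union> {i<..<m}. indicator (halfspace (p j)) ?z :: real)"
        by (rule prod.union_disjoint[symmetric]) auto
      also have "\<dots> = (\<Prod>j\<in>{..<m} - {i}. indicator (halfspace (p j)) ?z)" by (simp add: un)
      also have "\<dots> = (if \<forall>j\<in>{..<m} - {i}. ?z \<in> halfspace (p j) then 1 else 0)"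
        by (auto simp: indicator_def intro!: prod.neutral)
      also have "(\<forall>j\<in>{..<m} - {i}. ?z \<in> halfspace (p j)) \<longleftrightarrow> (\<forall>q\<in>P - {p i}. fst q \<bullet> ?z < snd q)"
      proof -
        have "P - {p i} = p ` ({..<m} - {i})"
          using bij i by (auto simp: bij_betw_def inj_on_def)
        moreover have "?z \<in> halfspace (p j) \<longleftrightarrow> fst (p j) \<bullet> ?z < snd (p j)" if "j \<in> {..<m} - {i}" for j
          using nh[of j] that by (auto simp: halfspace_def hyperplane_def)
        ultimately show ?thesis by auto
      qed
      also have "\<dots> \<longleftrightarrow> ?z \<in> facet P (p i)" by (simp add: facet_def hyperplane_def b_def)
      finally show ?thesis by (simp add: indicator_def)
    qed
    ultimately show ?thesis by simp
  qed
  have "(\<lambda>n. LINT z|lborel. f z * Q n z *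
      (indicator (halfspace (fst (p i), b)) (z - t n *\<^sub>R e) - indicator (halfspace (fst (p i), b)) z) / t n)
    \<longlonglongrightarrow> (fst (p i) \<bullet> e) * (LINT y|lborel. f (chart b y) * ?Q0 (chart b y))"
    by (rule layer_limit[OF f Qm Qb borel_measurable_indicator[OF facet_borel[OF finP]] _ t N lim])
      (auto simp: indicator_def)
  also have "(LINT y|lborel. f (chart b y) * ?Q0 (chart b y))
      = (LINT z|surface_measure. indicator (hyperplane (fst (p i), b)) z * (f z * ?Q0 z))"
  proof -
    have [measurable]: "f \<in> borel_measurable borel" by (rule borel_measurable_continuous_onI[OF f(1)])
    have "(\<lambda>z. f z * ?Q0 z) \<in> borel_measurable borel" by measurable
    thus ?thesis by (rule hyperplane_integral(2)[symmetric])
  qed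
  also have "\<dots> = (LINT z|surface_measure. ?Q0 z * f z)"
    by (rule Bochner_Integration.integral_cong) (auto simp: facet_def indicator_def b_def)
  finally show ?thesis by (simp add: b_def)
qed

text \<open>The half-space factors are exchanged one at a time, so that each summand carries a
  single differenced indicator and lives in the thin slab of one constraint.\<close>

lemma halfspaces_indicator_diff:
  fixes p :: "nat \<Rightarrow> 'a::euclidean_space \<times> real"
  assumes bij: "bij_betw p {..<m} P" and P: "halfspaces_of P T"
  shows "indicator T x - indicator T y = (\<Sum>i<m. (\<Prod>j<i. indicator (halfspace (p j)) x)
    * (\<Prod>j\<in>{i<..<m}. indicator (halfspace (p j)) y)
    * (indicator (halfspace (p i)) x - indicator (halfspace (p i)) y :: real))"
proof -
  have "indicator T x = (\<Prod>j<m. indicator (halfspace (p j)) x :: real)" for x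
  proof -
    have "T = (\<Inter>j<m. halfspace (p j))" using bij P by (auto simp: bij_betw_def halfspaces_of_def)
    show ?thesis
    proof (cases "x \<in> T")
      case True
      thus ?thesis using \<open>T = _\<close> by (simp add: indicator_def)
    next
      case False
      then obtain j where "j < m" "x \<notin> halfspace (p j)" using \<open>T = _\<close> by auto
      hence "(\<Prod>j<m. indicator (halfspace (p j)) x :: real) = 0" by (auto intro!: bexI[of _ j])
      thus ?thesis using False by simp
    qed
  qed
  thus ?thesis by (simp add: prod_diff_telescope)
qed

lemma directional_mean_value:
  fixes f f' :: "'a::euclidean_space \<Rightarrow> real"
  assumes der: "\<And>z. ((\<lambda>t. f (z + t *\<^sub>R e)) has_real_derivative f' z) (at 0)" and t: "0 < t"
  obtains s where "0 < s" "s < t" "f (z + t *\<^sub>R e) - f z = t * f' (z + s *\<^sub>R e)"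
proof -
  have d: "((\<lambda>t. f (z + t *\<^sub>R e)) has_real_derivative f' (z + s *\<^sub>R e)) (at s)" for s
  proof -
    have "((\<lambda>u. f (z + s *\<^sub>R e + u *\<^sub>R e)) has_real_derivative f' (z + s *\<^sub>R e)) (at (s - s))"
      using der[of "z + s *\<^sub>R e"] by simp
    hence "((\<lambda>t. f (z + s *\<^sub>R e + (t - s) *\<^sub>R e)) has_real_derivative f' (z + s *\<^sub>R e) * 1) (at s)"
      by (rule DERIV_chain2[where g = "\<lambda>t. t - s"]) (auto intro!: derivative_eq_intros)
    thus ?thesis by (simp add: algebra_simps)
  qed
  obtain s where "0 < s" "s < t"
    "f (z + t *\<^sub>R e) - f (z + 0 *\<^sub>R e) = (t - 0) * f' (z + s *\<^sub>R e)"
    using MVT2[OF t, of "\<lambda>t. f (z + t *\<^sub>R e)" "\<lambda>s. f' (z + s *\<^sub>R e)"] d by blast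
  thus ?thesis using that by simp
qed

lemma directional_derivative_support:
  fixes f f' :: "'a::euclidean_space \<Rightarrow> real"
  assumes der: "((\<lambda>t. f (z + t *\<^sub>R e)) has_real_derivative f' z) (at 0)"
    and f: "\<And>z. R < norm z \<Longrightarrow> f z = 0" and z: "R < norm z"
  shows "f' z = 0"
proof -
  have "((\<lambda>t. norm (z + t *\<^sub>R e)) \<longlongrightarrow> norm (z + 0 *\<^sub>R e)) (at 0)" by (intro tendsto_intros)
  hence "eventually (\<lambda>t. R < norm (z + t *\<^sub>R e)) (at 0)"
    using z by (intro order_tendstoD) auto
  hence "eventually (\<lambda>t. f (z + t *\<^sub>R e) = 0) (nhds 0)"
    using f z by (simp add: eventually_at_filter) (auto elim!: eventually_mono)
  hence "((\<lambda>t. f (z + t *\<^sub>R e)) has_real_derivative 0) (at 0)"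
    by (subst DERIV_cong_ev[OF refl _ refl]) auto
  thus ?thesis by (rule DERIV_unique[OF der])
qed

lemma difference_quotient_limit:
  fixes f f' :: "'a::euclidean_space \<Rightarrow> real"
  assumes der: "\<And>z. ((\<lambda>t. f (z + t *\<^sub>R e)) has_real_derivative f' z) (at 0)"
    and f: "continuous_on UNIV f" "\<And>z. R < norm z \<Longrightarrow> f z = 0"
    and f': "continuous_on UNIV f'" and T: "T \<in> sets borel"
    and t: "\<And>n::nat. 0 < t n" "\<And>n. t n \<le> 1" "t \<longlonglongrightarrow> (0::real)"
  shows "(\<lambda>n. LINT z|lborel. indicator T z * ((f (z + t n *\<^sub>R e) - f z) / t n))
    \<longlonglongrightarrow> (LINT z|lborel. indicator T z * f' z)"
proof -
  note [measurable] = borel_measurable_continuous_onI[OF f(1)] borel_measurable_continuous_onI[OF f'] T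
  have f'0: "f' z = 0" if "R < norm z" for z
    using der f(2) that by (rule directional_derivative_support)
  obtain M where M: "0 \<le> M" "\<And>z. \<bar>f' z\<bar> \<le> M"
    using bounded_support_bound[OF f' f'0] by metis
  show ?thesis
  proof (rule integral_dominated_convergence)
    \<comment> \<open>Since t n is at most 1, the point z + t n e can return to the support of f
      only if z lies within distance \<open>norm e\<close> of it.\<close>
    show "integrable lborel (\<lambda>z::'a. M * indicator (cball 0 (R + norm e)) z)"
      using finite_cball[of "0::'a" "R + norm e"]
      by (intro integrable_mult_right integrable_real_indicator) auto
    show "AE z in lborel. (\<lambda>n. indicator T z * ((f (z + t n *\<^sub>R e) - f z) / t n)) \<longlonglongrightarrow> indicator T z * f' z"
    proof (rule AE_I2, rule tendsto_mult[OF tendsto_const])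
      fix z
      have "((\<lambda>h. (f (z + h *\<^sub>R e) - f z) / h) \<longlongrightarrow> f' z) (at 0)"
        using der[of z] by (simp add: DERIV_def)
      moreover have "filterlim t (at 0) sequentially"
        using t(1,3) by (intro filterlim_atI) (auto intro!: always_eventually simp: less_imp_neq[THEN not_sym])
      ultimately show "(\<lambda>n. (f (z + t n *\<^sub>R e) - f z) / t n) \<longlonglongrightarrow> f' z"
        by (rule filterlim_compose)
    qed
    show "AE z in lborel. norm (indicator T z * ((f (z + t n *\<^sub>R e) - f z) / t n))
        \<le> M * indicator (cball 0 (R + norm e)) z" for n
    proof (rule AE_I2)
      fix z
      show "norm (indicator T z * ((f (z + t n *\<^sub>R e) - f z) / t n))
        \<le> M * indicator (cball 0 (R + norm e)) z"
      proof (cases "norm z \<le> R + norm e")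
        case True
        obtain s where s: "f (z + t n *\<^sub>R e) - f z = t n * f' (z + s *\<^sub>R e)"
          using directional_mean_value[of f e f', OF der t(1)] by metis
        have "\<bar>(f (z + t n *\<^sub>R e) - f z) / t n\<bar> \<le> M" using M(2) t(1)[of n] by (simp add: s)
        thus ?thesis using True M(1) by (auto simp: indicator_def)
      next
        case False
        have "norm z - norm (t n *\<^sub>R e) \<le> norm (z + t n *\<^sub>R e)" by (rule norm_diff_ineq)
        moreover have "norm (t n *\<^sub>R e) \<le> 1 * norm e"
          unfolding norm_scaleR using t(1)[of n] t(2)[of n] by (intro mult_right_mono) auto
        ultimately have "R < norm (z + t n *\<^sub>R e)" using False by linarith
        moreover have "R < norm z" using False norm_ge_zero[of e] by linarith
        ultimately show ?thesis using M(1) by (simp add: f(2))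
      qed
    qed
  qed measurable
qed

lemma lborel_integral_translate:
  fixes f :: "'a::euclidean_space \<Rightarrow> real"
  assumes [measurable]: "f \<in> borel_measurable borel" "T \<in> sets borel"
  shows "(LINT z|lborel. indicator T z * f (z + u)) = (LINT z|lborel. indicator T (z - u) * f z)"
proof -
  have "(LINT z|lborel. indicator T (z - u) * f z) = (LINT z|distr lborel borel ((+) u). indicator T (z - u) * f z)"
    by (simp add: lborel_distr_plus)
  also have "\<dots> = (LINT z|lborel. indicator T z * f (z + u))"
    by (subst integral_distr) (auto simp: add.commute)
  finally show ?thesis ..
qed

text \<open>A difference quotient of f integrated over \<open>T\<close> equals, after a translation,
  a difference quotient of the indicator of \<open>T\<close> integrated against f; the two readings
  have the two sides as limits. Bounded support of f admits unbounded \<open>T\<close>, and only the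
  derivative along \<open>e\<close> enters, so the divergence can be treated one coordinate at a
  time.\<close>

theorem gauss_polyhedron:
  fixes f f' :: "'a::euclidean_space \<Rightarrow> real"
  assumes P: "halfspaces_of P T" and int: "interior T \<noteq> {}"
    and dim: "DIM('a) = Suc DIM('b::euclidean_space)"
    and der: "\<And>z. ((\<lambda>t. f (z + t *\<^sub>R e)) has_real_derivative f' z) (at 0)"
    and f: "continuous_on UNIV f" "\<And>z. R < norm z \<Longrightarrow> f z = 0"
    and f': "continuous_on UNIV f'"
  shows "integrable surface_measure (\<lambda>z. indicator (frontier T) z * (f z * (outward_normal T z \<bullet> e)))"
    and "(LINT z|lborel. indicator T z * f' z)
      = (LINT z|surface_measure. indicator (frontier T) z * (f z * (outward_normal T z \<bullet> e)))"
proof -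
  have finP: "finite P" by (rule halfspaces_finite[OF P])
  have Tm[measurable]: "T \<in> sets borel" by (rule borel_closed[OF closed_halfspaces[OF P]])
  note [measurable] = borel_measurable_continuous_onI[OF f(1)]
  obtain M where M: "0 \<le> M" "\<And>z. \<bar>f z\<bar> \<le> M" using bounded_support_bound[OF f] by metis
  have eq: "indicator (frontier T) z * (f z * (outward_normal T z \<bullet> e))
      = (\<Sum>p\<in>P. (fst p \<bullet> e) * (indicator (facet P p) z * f z))" for z
  proof (cases "z \<in> frontier T")
    case True
    thus ?thesis
      by (simp add: outward_normal_eq_sum[OF P] inner_sum_left sum_distrib_left mult_ac)
  next
    case False
    hence "z \<notin> facet P p" if "p \<in> P" for p using facet_subset_frontier[OF P that] by auto
    thus ?thesis using False by simp
  qed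
  have intf: "integrable surface_measure (\<lambda>z. indicator (facet P p) z * f z)" if "p \<in> P" for p
    using halfspaces_norm[OF P that] M(2) f(2)
    by (intro facet_integrable[OF _ finP dim]) auto
  show "integrable surface_measure (\<lambda>z. indicator (frontier T) z * (f z * (outward_normal T z \<bullet> e)))"
    unfolding eq using intf by (intro Bochner_Integration.integrable_sum integrable_mult_right) auto
  have rhs: "(LINT z|surface_measure. indicator (frontier T) z * (f z * (outward_normal T z \<bullet> e)))
      = (\<Sum>p\<in>P. (fst p \<bullet> e) * (LINT z|surface_measure. indicator (facet P p) z * f z))"
    unfolding eq using intf by (subst Bochner_Integration.integral_sum) (auto intro!: integrable_mult_right)
  obtain p where bij: "bij_betw p {..<card P} P"
    using ex_bij_betw_nat_finite[OF finP] by (auto simp: atLeast0LessThan)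
  define m where "m = card P"
  define t where "t n = inverse (real (Suc n))" for n
  have t: "\<And>n. 0 < t n" "\<And>n. t n \<le> 1" "t \<longlonglongrightarrow> 0"
    using LIMSEQ_inverse_real_of_nat unfolding t_def by (auto simp: inverse_le_1_iff)
  let ?Q = "\<lambda>i n z. (\<Prod>j<i. indicator (halfspace (p j)) (z - t n *\<^sub>R e)) * (\<Prod>j\<in>{i<..<m}. indicator (halfspace (p j)) z) :: real"
  let ?h = "\<lambda>i n z. indicator (halfspace (p i)) (z - t n *\<^sub>R e) - indicator (halfspace (p i)) z :: real"
  have quot: "(LINT z|lborel. indicator T z * ((f (z + t n *\<^sub>R e) - f z) / t n))
      = (\<Sum>i<m. (LINT z|lborel. f z * ?Q i n z * ?h i n z / t n))" for n
  proof -
    have i1: "integrable lborel (\<lambda>z. indicator T (z - u) * f z)" for u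
    proof (rule integrable_bounded_support[where M = M and R = R])
      fix z show "\<bar>indicator T (z - u) * f z\<bar> \<le> M" using M by (auto simp: indicator_def)
    qed (use f(2) in auto)
    have "integrable lborel (\<lambda>z. indicator T z * f (z + u))" for u
    proof (rule integrable_bounded_support[where M = M and R = "R + norm u"])
      fix z show "\<bar>indicator T z * f (z + u)\<bar> \<le> M" using M by (auto simp: indicator_def)
      assume "R + norm u < norm z"
      hence "R < norm (z + u)" using norm_diff_ineq[of z u] by linarith
      thus "indicator T z * f (z + u) = 0" by (simp add: f(2))
    qed measurable
    note i2 = this
    have "(LINT z|lborel. indicator T z * ((f (z + t n *\<^sub>R e) - f z) / t n))
        = (LINT z|lborel. (indicator T z * f (z + t n *\<^sub>R e) - indicator T (z - 0) * f z) / t n)"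
      by (simp add: algebra_simps diff_divide_distrib)
    also have "\<dots> = ((LINT z|lborel. indicator T z * f (z + t n *\<^sub>R e)) - (LINT z|lborel. indicator T (z - 0) * f z)) / t n"
      using i1[of 0] i2[of "t n *\<^sub>R e"] by simp
    also have "\<dots> = ((LINT z|lborel. indicator T (z - t n *\<^sub>R e) * f z) - (LINT z|lborel. indicator T (z - 0) * f z)) / t n"
      by (subst lborel_integral_translate) auto
    also have "\<dots> = (LINT z|lborel. (indicator T (z - t n *\<^sub>R e) * f z - indicator T (z - 0) * f z) / t n)"
      using i1[of 0] i1[of "t n *\<^sub>R e"] by simp
    also have "\<dots> = (LINT z|lborel. (\<Sum>i<m. f z * ?Q i n z * ?h i n z / t n))"
    proof (rule Bochner_Integration.integral_cong)
      fix z
      have "indicator T (z - t n *\<^sub>R e) * f z - indicator T (z - 0) * f z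
          = f z * (indicator T (z - t n *\<^sub>R e) - indicator T z)" by (simp add: algebra_simps)
      also have "\<dots> = (\<Sum>i<m. f z * ?Q i n z * ?h i n z)"
        unfolding halfspaces_indicator_diff[OF bij P] m_def sum_distrib_left by (simp add: mult_ac)
      finally show "(indicator T (z - t n *\<^sub>R e) * f z - indicator T (z - 0) * f z) / t n
          = (\<Sum>i<m. f z * ?Q i n z * ?h i n z / t n)" by (simp add: sum_divide_distrib)
    qed simp
    also have "\<dots> = (\<Sum>i<m. (LINT z|lborel. f z * ?Q i n z * ?h i n z / t n))"
    proof (rule Bochner_Integration.integral_sum)
      fix i
      have bnd: "\<bar>\<Prod>j\<in>J. indicator (A j) (x j) :: real\<bar> \<le> 1" for J :: "nat set" and A :: "nat \<Rightarrow> 'a set" and x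
        unfolding abs_prod by (rule prod_le_1) (auto simp: indicator_def)
      show "integrable lborel (\<lambda>z. f z * ?Q i n z * ?h i n z / t n)"
      proof (rule integrable_divide_zero, rule integrable_bounded_support[where M = "M * (1 * 1) * 1" and R = R])
        fix z
        show "\<bar>f z * ?Q i n z * ?h i n z\<bar> \<le> M * (1 * 1) * 1"
          unfolding abs_mult using M by (intro mult_mono bnd) (auto simp: indicator_def)
      qed (use f(2) in \<open>measurable, auto\<close>)
    qed
    finally show ?thesis .
  qed
  have "(\<lambda>n. LINT z|lborel. indicator T z * ((f (z + t n *\<^sub>R e) - f z) / t n))
      \<longlonglongrightarrow> (\<Sum>i<m. (fst (p i) \<bullet> e) * (LINT z|surface_measure. indicator (facet P (p i)) z * f z))"
    unfolding quot m_def
    by (intro tendsto_sum facet_limit[OF P int dim bij _ f t(1,3)]) auto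
  moreover have "(\<lambda>n. LINT z|lborel. indicator T z * ((f (z + t n *\<^sub>R e) - f z) / t n))
      \<longlonglongrightarrow> (LINT z|lborel. indicator T z * f' z)"
    by (rule difference_quotient_limit[OF der f f' Tm t])
  ultimately have "(LINT z|lborel. indicator T z * f' z)
      = (\<Sum>i<m. (fst (p i) \<bullet> e) * (LINT z|surface_measure. indicator (facet P (p i)) z * f z))"
    by (rule LIMSEQ_unique[rotated])
  also have "\<dots> = (\<Sum>p\<in>P. (fst p \<bullet> e) * (LINT z|surface_measure. indicator (facet P p) z * f z))"
    using sum.reindex_bij_betw[OF bij] unfolding m_def .
  finally show "(LINT z|lborel. indicator T z * f' z)
      = (LINT z|surface_measure. indicator (frontier T) z * (f z * (outward_normal T z \<bullet> e)))"
    unfolding rhs .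
qed

section \<open>The skeleton of a mesh\<close>


lemma mesh_finite_near:
  assumes "mesh \<T>" "compact K"
  shows "finite {T \<in> \<T>. T \<inter> K \<noteq> {}}"
  using assms by (simp add: mesh_def)

lemma mesh_polyhedron: "mesh \<T> \<Longrightarrow> T \<in> \<T> \<Longrightarrow> polyhedron T"
  and mesh_interior: "mesh \<T> \<Longrightarrow> T \<in> \<T> \<Longrightarrow> interior T \<noteq> {}"
  and mesh_cover: "mesh \<T> \<Longrightarrow> \<exists>T\<in>\<T>. z \<in> T"
  by (auto simp: mesh_def)

lemma mesh_closed: "mesh \<T> \<Longrightarrow> T \<in> \<T> \<Longrightarrow> closed T"
  and mesh_convex: "mesh \<T> \<Longrightarrow> T \<in> \<T> \<Longrightarrow> convex T"
  by (auto dest!: mesh_polyhedron simp: polyhedron_imp_closed polyhedron_imp_convex)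

lemma mesh_countable:
  assumes m: "mesh \<T>"
  shows "countable \<T>"
proof -
  have "\<T> \<subseteq> (\<Union>n::nat. {T \<in> \<T>. T \<inter> cball 0 (real n) \<noteq> {}})"
  proof
    fix T assume T: "T \<in> \<T>"
    then obtain z where z: "z \<in> T" using mesh_interior[OF m T] interior_subset by fastforce
    obtain n :: nat where "norm z \<le> real n" using real_arch_simple by blast
    hence "T \<inter> cball 0 (real n) \<noteq> {}" using z by auto
    thus "T \<in> (\<Union>n::nat. {T \<in> \<T>. T \<inter> cball 0 (real n) \<noteq> {}})" using T by blast
  qed
  moreover have "countable {T \<in> \<T>. T \<inter> cball 0 (real n) \<noteq> {}}" for n
    by (rule countable_finite[OF mesh_finite_near[OF m compact_cball]])
  hence "countable (\<Union>n::nat. {T \<in> \<T>. T \<inter> cball 0 (real n) \<noteq> {}})" by (intro countable_UN) auto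
  ultimately show ?thesis by (rule countable_subset)
qed

text \<open>A closed convex set with interior points is the closure of its interior, and an open set
  that misses a set also misses its closure.\<close>

lemma mesh_interior_Int:
  assumes m: "mesh \<T>" and "S \<in> \<T>" "T \<in> \<T>" "S \<noteq> T"
  shows "interior S \<inter> T = {}"
proof -
  have "interior S \<inter> interior T = {}" using assms by (auto simp: mesh_def pairwise_def)
  hence "interior S \<inter> closure (interior T) = {}" by (simp add: open_Int_closure_eq_empty)
  moreover have "closure (interior T) = T"
    using convex_closure_interior[OF mesh_convex[OF m] mesh_interior[OF m]] mesh_closed[OF m] assms by simp
  ultimately show ?thesis by simp
qed

lemma mesh_frontier_of_skeleton:
  assumes m: "mesh \<T>" and z: "z \<in> skeleton \<T>" and T: "T \<in> \<T>" "z \<in> T"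
  shows "z \<in> frontier T"
proof -
  obtain S where S: "S \<in> \<T>" "z \<in> frontier S" using z by (auto simp: skeleton_def)
  have zS: "z \<in> S" using S mesh_closed[OF m S(1)] frontier_subset_closed by blast
  have "z \<notin> interior T"
  proof (cases "S = T")
    case True
    thus ?thesis using S by (simp add: frontier_def)
  next
    case False
    thus ?thesis using mesh_interior_Int[OF m T(1) S(1)] zS by auto
  qed
  thus ?thesis using T by (simp add: frontier_def closure_closed mesh_closed[OF m])
qed

lemma mesh_overlap_null:
  assumes m: "mesh \<T>" and "z \<in> S" "z \<in> T" "S \<in> \<T>" "T \<in> \<T>" "S \<noteq> T"
  shows "z \<in> frontier S"
proof -
  have "z \<notin> interior S" using mesh_interior_Int[OF m, of S T] assms by auto
  thus ?thesis using assms by (simp add: frontier_def closure_closed mesh_closed[OF m])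
qed

lemma halfspace_interior_ball:
  fixes p :: "'a::euclidean_space \<times> real"
  assumes "norm (fst p) = 1" "z \<in> hyperplane p" "0 < r"
  shows "z - (r / 2) *\<^sub>R fst p \<in> interior (halfspace p \<inter> ball z r)"
proof -
  have "fst p \<noteq> 0" "fst p \<bullet> fst p = 1" using assms(1) by (auto simp: dot_square_norm)
  thus ?thesis using assms by (simp add: halfspace_def hyperplane_def inner_diff_right dist_norm)
qed

text \<open>The null set consists of all intersections of two distinct bounding hyperplanes,
  countably many over the whole mesh. Elsewhere all tight constraints share one hyperplane, and near
  z each element through z is one of its two half-spaces. Disjoint interiors forbid two elements on
  the same side, and the covering property supplies one on each side.\<close>

theorem mesh_skeleton_two_elements:
  fixes \<T> :: "'a::euclidean_space set set"
  assumes m: "mesh \<T>" and dim: "DIM('a) = Suc DIM('b::euclidean_space)"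
  shows "\<exists>N\<in>null_sets surface_measure. \<forall>z\<in>skeleton \<T> - N. \<exists>T1 T2. T1 \<noteq> T2
        \<and> {T \<in> \<T>. z \<in> frontier T} = {T1, T2} \<and> outward_normal T2 z = - outward_normal T1 z"
proof -
  have "\<exists>P. halfspaces_of P T" if "T \<in> \<T>" for T
    using polyhedron_halfspaces[OF mesh_polyhedron[OF m that]] by blast
  then obtain P where P: "\<And>T. T \<in> \<T> \<Longrightarrow> halfspaces_of (P T) T" by metis
  define Q where "Q = (\<Union>T\<in>\<T>. P T)"
  have Qn: "norm (fst p) = 1" if "p \<in> Q" for p
    using that halfspaces_norm[OF P] unfolding Q_def by blast
  have "countable Q"
    unfolding Q_def by (intro countable_UN mesh_countable[OF m] countable_finite halfspaces_finite[OF P])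
  define QQ where "QQ = {(p, q) \<in> Q \<times> Q. hyperplane p \<noteq> hyperplane q}"
  have cQQ: "countable QQ" unfolding QQ_def
    by (rule countable_subset[OF _ countable_SIGMA[OF \<open>countable Q\<close> \<open>countable Q\<close>]]) auto
  define N where "N = (\<Union>pq\<in>QQ. hyperplane (fst pq) \<inter> hyperplane (snd pq))"
  have N: "N \<in> null_sets surface_measure"
    unfolding N_def
  proof (rule null_sets_UN'[OF cQQ])
    fix pq assume "pq \<in> QQ"
    thus "hyperplane (fst pq) \<inter> hyperplane (snd pq) \<in> null_sets surface_measure"
      using Qn by (intro null_ties[OF _ _ _ dim]) (auto simp: QQ_def)
  qed
  have two: "\<exists>T1 T2. T1 \<noteq> T2 \<and> {T \<in> \<T>. z \<in> frontier T} = {T1, T2}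
        \<and> outward_normal T2 z = - outward_normal T1 z" if z: "z \<in> skeleton \<T> - N" for z
  proof -
    define S where "S = {T \<in> \<T>. z \<in> T}"
    have S_fr: "S = {T \<in> \<T>. z \<in> frontier T}"
      using mesh_frontier_of_skeleton[OF m] z frontier_subset_closed[OF mesh_closed[OF m]]
      by (auto simp: S_def)
    have finS: "finite S"
      using mesh_finite_near[OF m compact_sing[of z]] by (auto simp: S_def elim: finite_subset[rotated])
    have "\<exists>p. p \<in> P T \<and> z \<in> facet (P T) p" if T: "T \<in> S" for T
    proof -
      have T': "T \<in> \<T>" "z \<in> frontier T" using T S_fr by auto
      obtain p where p: "p \<in> P T" "z \<in> hyperplane p" using frontier_halfspaces[OF P] T' by blast
      have "fst q \<bullet> z < snd q" if q: "q \<in> P T" "q \<noteq> p" for q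
      proof -
        have "hyperplane p \<noteq> hyperplane q"
          using hyperplane_neq[OF P[OF T'(1)] mesh_interior[OF m T'(1)] p(1) q(1)] q(2) by auto
        hence "(p, q) \<in> QQ" using p q T' by (auto simp: QQ_def Q_def)
        hence "z \<notin> hyperplane q" using z p(2) by (force simp: N_def)
        moreover have "fst q \<bullet> z \<le> snd q"
          using frontier_halfspaces[OF P[OF T'(1)]] halfspaces_mem[OF P[OF T'(1)]] T' q by blast
        ultimately show ?thesis by (auto simp: hyperplane_def)
      qed
      thus ?thesis using p unfolding facet_def by blast
    qed
    then obtain p where p: "\<And>T. T \<in> S \<Longrightarrow> p T \<in> P T" "\<And>T. T \<in> S \<Longrightarrow> z \<in> facet (P T) (p T)" by metis
    have pz: "z \<in> hyperplane (p T)" if "T \<in> S" for T using p(2)[OF that] by (simp add: facet_def)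
    have pn: "norm (fst (p T)) = 1" if "T \<in> S" for T
      by (rule halfspaces_norm[OF P p(1)[OF that]]) (use that in \<open>simp add: S_def\<close>)
    have pm: "p T' = p T \<or> p T' = - p T" if "T \<in> S" "T' \<in> S" for T T'
    proof -
      have "(p T, p T') \<notin> QQ" using z pz[OF that(1)] pz[OF that(2)] by (force simp: N_def)
      moreover have "p T \<in> Q" "p T' \<in> Q" using p(1) that by (auto simp: Q_def S_def)
      ultimately have "hyperplane (p T) = hyperplane (p T')" by (auto simp: QQ_def)
      thus ?thesis using hyperplane_eqD pn that by metis
    qed
    have "\<exists>r>0. T \<inter> ball z r = halfspace (p T) \<inter> ball z r" if "T \<in> S" for T
      using facet_locally_halfspace[OF P p(1)[OF that] p(2)[OF that]] that by (auto simp: S_def)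
    then obtain r where r: "\<And>T. T \<in> S \<Longrightarrow> 0 < r T"
      "\<And>T. T \<in> S \<Longrightarrow> T \<inter> ball z (r T) = halfspace (p T) \<inter> ball z (r T)" by metis
    \<comment> \<open>By local finiteness this is a finite family of closed sets that miss z, so a
      whole ball around z avoids them; elements outside the family and outside \<open>S\<close> do
      not reach the unit ball.\<close>
    let ?far = "{T \<in> \<T>. T \<inter> cball z 1 \<noteq> {}} - S"
    have "closed (\<Union>?far)"
      using mesh_finite_near[OF m, of "cball z 1"] mesh_closed[OF m] by (intro closed_Union) auto
    hence "open (- \<Union>?far)" by (rule open_Compl)
    moreover have "z \<in> - \<Union>?far" by (auto simp: S_def)
    ultimately obtain r1 where r1: "0 < r1" "ball z r1 \<subseteq> - \<Union>?far"
      by (rule openE)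
    define \<rho> where "\<rho> = Min (insert 1 (insert r1 (r ` S)))"
    have \<rho>0: "0 < \<rho>" unfolding \<rho>_def using finS r1 r(1) by (subst Min_gr_iff) auto
    have \<rho>le: "\<rho> \<le> 1" "\<rho> \<le> r1" "\<And>T. T \<in> S \<Longrightarrow> \<rho> \<le> r T"
      unfolding \<rho>_def by (rule Min_le; use finS in blast)+
    have loc: "T \<inter> ball z \<rho> = halfspace (p T) \<inter> ball z \<rho>" if T: "T \<in> S" for T
    proof -
      have "ball z \<rho> = ball z (r T) \<inter> ball z \<rho>" using \<rho>le(3)[OF T] by auto
      thus ?thesis using r(2)[OF T] by (metis Int_assoc)
    qed
    have near: "T \<in> S" if "T \<in> \<T>" "y \<in> T" "y \<in> ball z \<rho>" for T y
    proof (rule ccontr)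
      assume "T \<notin> S"
      hence "T \<in> ?far" using that \<rho>le(1) by auto
      moreover have "y \<in> ball z r1" using that \<rho>le(2) by auto
      ultimately show False using r1(2) that by blast
    qed
    have same: "T = T'" if TT: "T \<in> S" "T' \<in> S" "p T = p T'" for T T'
    proof (rule ccontr)
      assume ne: "T \<noteq> T'"
      have "z - (\<rho> / 2) *\<^sub>R fst (p T) \<in> interior (T \<inter> ball z \<rho>)"
        unfolding loc[OF TT(1)] using pn pz TT \<rho>0 by (intro halfspace_interior_ball) auto
      moreover have "z - (\<rho> / 2) *\<^sub>R fst (p T) \<in> interior (T' \<inter> ball z \<rho>)"
        unfolding loc[OF TT(2)] TT(3) using pn pz TT \<rho>0 by (intro halfspace_interior_ball) auto
      ultimately have "interior T \<inter> interior T' \<noteq> {}" by (auto simp: interior_Int)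
      thus False using m TT ne by (auto simp: mesh_def pairwise_def S_def)
    qed
    obtain T1 where T1: "T1 \<in> S" using mesh_cover[OF m, of z] by (auto simp: S_def)
    \<comment> \<open>A point just beyond the face of \<open>T1\<close>. Some element covers it, and
      being so close to z this element also contains z.\<close>
    define y where "y = z + (\<rho> / 2) *\<^sub>R fst (p T1)"
    have y: "y \<in> ball z \<rho>" using pn[OF T1] \<rho>0 by (simp add: y_def dist_norm)
    obtain T2 where T2: "T2 \<in> \<T>" "y \<in> T2" using mesh_cover[OF m] by blast
    have T2S: "T2 \<in> S" by (rule near[OF T2 y])
    have "y \<notin> halfspace (p T1)"
      using pz[OF T1] pn[OF T1] \<rho>0
      by (simp add: y_def halfspace_def hyperplane_def inner_add_right dot_square_norm)
    moreover have "y \<in> halfspace (p T2)" using loc[OF T2S] T2 y by blast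
    ultimately have "p T2 \<noteq> p T1" by auto
    hence p2: "p T2 = - p T1" using pm[OF T1 T2S] by blast
    have "S = {T1, T2}"
    proof
      show "{T1, T2} \<subseteq> S" using T1 T2S by auto
      show "S \<subseteq> {T1, T2}"
      proof
        fix T assume T: "T \<in> S"
        from pm[OF T1 T] show "T \<in> {T1, T2}"
          using same[OF T T1] same[OF T T2S] p2 by auto
      qed
    qed
    moreover have "outward_normal T z = fst (p T)" if "T \<in> S" for T
      by (rule outward_normal_facet[OF P p(1)[OF that] p(2)[OF that]]) (use that in \<open>simp add: S_def\<close>)
    hence "outward_normal T2 z = - outward_normal T1 z" using T1 T2S p2 by simp
    moreover have "T1 \<noteq> T2" using \<open>p T2 \<noteq> p T1\<close> by auto
    ultimately show ?thesis unfolding S_fr[symmetric] by blast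
  qed
  show ?thesis by (rule bexI[OF _ N]) (use two in blast)
qed

section \<open>Traces\<close>


text \<open>The difference of the products is split into (A - a)(B - b), (A - a) b and (B - b) a,
  and the mixed terms are estimated by Young's inequality with a weight depending on k. Distances
  are nonnegative integrals, as in \<open>is_trace\<close>, so the differences are square integrable
  only from some k on.\<close>

lemma L2_product_limit:
  fixes a b h :: "'a \<Rightarrow> real" and A B :: "nat \<Rightarrow> 'a \<Rightarrow> real"
  assumes [measurable]: "a \<in> borel_measurable M" "b \<in> borel_measurable M" "h \<in> borel_measurable M"
    "\<And>k. A k \<in> borel_measurable M" "\<And>k. B k \<in> borel_measurable M"
    and C: "\<And>z. \<bar>h z\<bar> \<le> C"
    and A: "(\<lambda>k. \<integral>\<^sup>+z. ennreal ((A k z - a z)\<^sup>2) \<partial>M) \<longlonglongrightarrow> 0"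
    and B: "(\<lambda>k. \<integral>\<^sup>+z. ennreal ((B k z - b z)\<^sup>2) \<partial>M) \<longlonglongrightarrow> 0"
    and iA: "\<And>k. integrable M (\<lambda>z. (A k z)\<^sup>2)" and iB: "\<And>k. integrable M (\<lambda>z. (B k z)\<^sup>2)"
  shows "integrable M (\<lambda>z. a z * b z * h z)"
    and "(\<lambda>k. LINT z|M. A k z * B k z * h z) \<longlonglongrightarrow> (LINT z|M. a z * b z * h z)"
proof -
  have L2: "(\<lambda>k. LINT z|M. (F k z - f z)\<^sup>2) \<longlonglongrightarrow> 0 \<and> integrable M (\<lambda>z. (f z)\<^sup>2)
      \<and> eventually (\<lambda>k. integrable M (\<lambda>z. (F k z - f z)\<^sup>2)) sequentially"
    if [measurable]: "f \<in> borel_measurable M" "\<And>k. F k \<in> borel_measurable M"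
      and F: "(\<lambda>k. \<integral>\<^sup>+z. ennreal ((F k z - f z)\<^sup>2) \<partial>M) \<longlonglongrightarrow> 0"
      and iF: "\<And>k. integrable M (\<lambda>z. (F k z)\<^sup>2)" for f :: "'a \<Rightarrow> real" and F
  proof -
    have ev: "eventually (\<lambda>k. integrable M (\<lambda>z. (F k z - f z)\<^sup>2)) sequentially"
    proof -
      have "eventually (\<lambda>k. (\<integral>\<^sup>+z. ennreal ((F k z - f z)\<^sup>2) \<partial>M) < 1) sequentially"
        using F by (rule order_tendstoD) simp
      thus ?thesis
      proof eventually_elim
        case (elim k)
        hence "(\<integral>\<^sup>+z. ennreal ((F k z - f z)\<^sup>2) \<partial>M) < \<infinity>" by (rule less_trans) simp
        thus ?case by (intro integrableI_nonneg) auto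
      qed
    qed
    then obtain k where k: "integrable M (\<lambda>z. (F k z - f z)\<^sup>2)"
      by (auto simp: eventually_sequentially)
    have sq: "integrable M (\<lambda>z. (f z)\<^sup>2)"
    proof (rule Bochner_Integration.integrable_bound)
      show "integrable M (\<lambda>z. 2 * (F k z - f z)\<^sup>2 + 2 * (F k z)\<^sup>2)" using k iF by simp
      have "(f z)\<^sup>2 \<le> 2 * (F k z - f z)\<^sup>2 + 2 * (F k z)\<^sup>2" for z
        using zero_le_power2[of "2 * F k z - f z"] by (simp add: power2_eq_square algebra_simps)
      thus "AE z in M. norm ((f z)\<^sup>2) \<le> norm (2 * (F k z - f z)\<^sup>2 + 2 * (F k z)\<^sup>2)" by simp
    qed simp
    have "(\<lambda>k. ennreal (LINT z|M. (F k z - f z)\<^sup>2)) \<longlonglongrightarrow> 0"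
    proof (rule Lim_transform_eventually[OF F])
      show "eventually (\<lambda>k. (\<integral>\<^sup>+z. ennreal ((F k z - f z)\<^sup>2) \<partial>M) = ennreal (LINT z|M. (F k z - f z)\<^sup>2)) sequentially"
        using ev by eventually_elim (simp add: nn_integral_eq_integral)
    qed
    hence "(\<lambda>k. LINT z|M. (F k z - f z)\<^sup>2) \<longlonglongrightarrow> 0"
      by (subst (asm) ennreal_0[symmetric], subst (asm) tendsto_ennreal_iff) auto
    thus ?thesis using ev sq by blast
  qed
  define X where "X k = (LINT z|M. (A k z - a z)\<^sup>2)" for k
  define Y where "Y k = (LINT z|M. (B k z - b z)\<^sup>2)" for k
  have X: "X \<longlonglongrightarrow> 0" "integrable M (\<lambda>z. (a z)\<^sup>2)"
    "eventually (\<lambda>k. integrable M (\<lambda>z. (A k z - a z)\<^sup>2)) sequentially"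
    using L2[of a A] A iA unfolding X_def by auto
  have Y: "Y \<longlonglongrightarrow> 0" "integrable M (\<lambda>z. (b z)\<^sup>2)"
    "eventually (\<lambda>k. integrable M (\<lambda>z. (B k z - b z)\<^sup>2)) sequentially"
    using L2[of b B] B iB unfolding Y_def by auto
  have C0: "0 \<le> C" using C by (meson abs_ge_zero order_trans)
  have amgm: "\<bar>x * y\<bar> \<le> (x\<^sup>2 / \<epsilon> + \<epsilon> * y\<^sup>2) / 2" if "0 < \<epsilon>" for x y \<epsilon> :: real
  proof -
    have "0 \<le> (\<bar>x\<bar> - \<epsilon> * \<bar>y\<bar>)\<^sup>2 / \<epsilon>" using that by simp
    also have "\<dots> = x\<^sup>2 / \<epsilon> + \<epsilon> * y\<^sup>2 - 2 * \<bar>x * y\<bar>"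
      using that by (simp add: power2_eq_square algebra_simps abs_mult diff_divide_distrib add_divide_distrib)
    finally show ?thesis by simp
  qed
  have prodint: "integrable M (\<lambda>z. f z * g z * h z)"
    if [measurable]: "f \<in> borel_measurable M" "g \<in> borel_measurable M"
      and i: "integrable M (\<lambda>z. (f z)\<^sup>2)" "integrable M (\<lambda>z. (g z)\<^sup>2)" for f g :: "'a \<Rightarrow> real"
  proof (rule Bochner_Integration.integrable_bound)
    show "integrable M (\<lambda>z. C * ((f z)\<^sup>2 + (g z)\<^sup>2))" using i by simp
    have "\<bar>f z * g z * h z\<bar> \<le> C * ((f z)\<^sup>2 + (g z)\<^sup>2)" for z
    proof -
      have "\<bar>f z * g z\<bar> \<le> (f z)\<^sup>2 + (g z)\<^sup>2"
        using amgm[of 1 "f z" "g z"] zero_le_power2[of "f z"] zero_le_power2[of "g z"] by (simp add: field_simps)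
      hence "\<bar>f z * g z\<bar> * \<bar>h z\<bar> \<le> ((f z)\<^sup>2 + (g z)\<^sup>2) * C" using C by (intro mult_mono) auto
      thus ?thesis by (simp add: abs_mult mult_ac)
    qed
    thus "AE z in M. norm (f z * g z * h z) \<le> norm (C * ((f z)\<^sup>2 + (g z)\<^sup>2))"
      using C0 by (simp add: abs_mult)
  qed measurable
  show ab: "integrable M (\<lambda>z. a z * b z * h z)" using X Y by (intro prodint) auto
  define S where "S = (LINT z|M. (a z)\<^sup>2) + (LINT z|M. (b z)\<^sup>2)"
  \<comment> \<open>The weight has to tend to 0 and still dominate sqrt (X k + Y k), so that (X k +
    Y k) / \<epsilon> k tends to 0 as well. The second summand keeps it positive when X k + Y k =
    0.\<close>
  define \<epsilon> where "\<epsilon> k = sqrt (X k + Y k) + inverse (real (Suc k))" for k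
  have XY0: "0 \<le> X k + Y k" for k by (simp add: X_def Y_def)
  have \<epsilon>: "0 < \<epsilon> k" for k using XY0[of k] by (simp add: \<epsilon>_def add_nonneg_pos)
  have "eventually (\<lambda>k. norm ((LINT z|M. A k z * B k z * h z) - (LINT z|M. a z * b z * h z))
      \<le> C * (((X k + Y k) + sqrt (X k + Y k) + \<epsilon> k * S) / 2)) sequentially"
    using X(3) Y(3)
  proof eventually_elim
    case (elim k)
    let ?D = "\<lambda>z. C * (((1 + 1 / \<epsilon> k) * ((A k z - a z)\<^sup>2 + (B k z - b z)\<^sup>2) + \<epsilon> k * ((a z)\<^sup>2 + (b z)\<^sup>2)) / 2)"
    have AB: "integrable M (\<lambda>z. A k z * B k z * h z)" using iA iB by (intro prodint) auto
    have "\<bar>A k z * B k z * h z - a z * b z * h z\<bar> \<le> ?D z" for z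
    proof -
      have "A k z * B k z - a z * b z = (A k z - a z) * (B k z - b z) + (A k z - a z) * b z + (B k z - b z) * a z"
        by (simp add: algebra_simps)
      also have "\<bar>\<dots>\<bar> \<le> \<bar>(A k z - a z) * (B k z - b z)\<bar> + \<bar>(A k z - a z) * b z\<bar> + \<bar>(B k z - b z) * a z\<bar>"
        by linarith
      also have "\<dots> \<le> ((A k z - a z)\<^sup>2 / 1 + 1 * (B k z - b z)\<^sup>2) / 2
          + ((A k z - a z)\<^sup>2 / \<epsilon> k + \<epsilon> k * (b z)\<^sup>2) / 2 + ((B k z - b z)\<^sup>2 / \<epsilon> k + \<epsilon> k * (a z)\<^sup>2) / 2"
        by (intro add_mono amgm \<epsilon>) simp
      also have "\<dots> = ((1 + 1 / \<epsilon> k) * ((A k z - a z)\<^sup>2 + (B k z - b z)\<^sup>2) + \<epsilon> k * ((a z)\<^sup>2 + (b z)\<^sup>2)) / 2"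
        by (simp add: add_divide_distrib distrib_left distrib_right)
      finally have "\<bar>A k z * B k z - a z * b z\<bar> * C
          \<le> ((1 + 1 / \<epsilon> k) * ((A k z - a z)\<^sup>2 + (B k z - b z)\<^sup>2) + \<epsilon> k * ((a z)\<^sup>2 + (b z)\<^sup>2)) / 2 * C"
        using C0 by (rule mult_right_mono)
      hence "\<bar>A k z * B k z - a z * b z\<bar> * \<bar>h z\<bar>
          \<le> ((1 + 1 / \<epsilon> k) * ((A k z - a z)\<^sup>2 + (B k z - b z)\<^sup>2) + \<epsilon> k * ((a z)\<^sup>2 + (b z)\<^sup>2)) / 2 * C"
        using mult_left_mono[OF C[of z] abs_ge_zero[of "A k z * B k z - a z * b z"]] by linarith
      thus ?thesis by (simp add: abs_mult[symmetric] left_diff_distrib mult.commute[of C])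
    qed
    moreover have iD: "integrable M ?D" using elim X(2) Y(2) by (intro integrable_mult_right integrable_divide_zero) simp
    ultimately have "\<bar>LINT z|M. A k z * B k z * h z - a z * b z * h z\<bar> \<le> (LINT z|M. ?D z)"
      using AB ab by (intro order_trans[OF integral_abs_bound] integral_mono) auto
    also have "(LINT z|M. ?D z) = C * (((1 + 1 / \<epsilon> k) * (X k + Y k) + \<epsilon> k * S) / 2)"
      using elim X(2) Y(2) by (simp add: X_def Y_def S_def)
    also have "\<dots> \<le> C * (((X k + Y k) + sqrt (X k + Y k) + \<epsilon> k * S) / 2)"
    proof -
      have "X k + Y k = sqrt (X k + Y k) * sqrt (X k + Y k)" using XY0[of k] by simp
      also have "\<dots> \<le> sqrt (X k + Y k) * \<epsilon> k" using XY0[of k] by (intro mult_left_mono) (auto simp: \<epsilon>_def)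
      finally have "(X k + Y k) / \<epsilon> k \<le> sqrt (X k + Y k)" using \<epsilon>[of k] by (simp add: pos_divide_le_eq)
      hence "(1 + 1 / \<epsilon> k) * (X k + Y k) \<le> (X k + Y k) + sqrt (X k + Y k)" by (simp add: distrib_right)
      thus ?thesis using C0 by (intro mult_left_mono divide_right_mono add_right_mono) simp_all
    qed
    finally show ?case using AB ab by simp
  qed
  moreover have "(\<lambda>k. C * (((X k + Y k) + sqrt (X k + Y k) + \<epsilon> k * S) / 2)) \<longlonglongrightarrow> C * (((0 + 0) + sqrt (0 + 0) + (sqrt (0 + 0) + 0) * S) / 2)"
    unfolding \<epsilon>_def by (intro tendsto_intros X Y LIMSEQ_inverse_real_of_nat) auto
  hence "(\<lambda>k. C * (((X k + Y k) + sqrt (X k + Y k) + \<epsilon> k * S) / 2)) \<longlonglongrightarrow> 0" by simp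
  ultimately have "(\<lambda>k. (LINT z|M. A k z * B k z * h z) - (LINT z|M. a z * b z * h z)) \<longlonglongrightarrow> 0"
    by (rule Lim_null_comparison)
  thus "(\<lambda>k. LINT z|M. A k z * B k z * h z) \<longlonglongrightarrow> (LINT z|M. a z * b z * h z)"
    by (simp add: LIM_zero_iff)
qed

text \<open>Ensures that the continuous approximations of a trace are square integrable on bounded
  pieces of the frontier. A chart does not decrease norms, so each piece has parameters in a
  ball.\<close>

lemma surface_frontier_finite:
  fixes T :: "'a::euclidean_space set"
  assumes P: "halfspaces_of P T" and dim: "DIM('a) = Suc DIM('b::euclidean_space)"
  shows "emeasure surface_measure (frontier T \<inter> cball 0 R) < \<infinity>"
proof -
  have fin: "emeasure surface_measure (hyperplane p \<inter> cball 0 R) < \<infinity>" if p: "p \<in> P" for p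
  proof -
    obtain \<iota> :: "'b \<Rightarrow> 'a" where "hyperplane_chart \<iota> (fst p)"
      by (rule hyperplane_chart_exists[OF halfspaces_norm[OF P p] dim])
    then interpret hyperplane_chart \<iota> "fst p" .
    have "emeasure surface_measure (hyperplane p \<inter> cball 0 R)
        = (\<integral>\<^sup>+z. indicator (hyperplane (fst p, snd p)) z * indicator (cball 0 R) z \<partial>surface_measure)"
      by (simp add: indicator_inter_arith[symmetric])
    also have "\<dots> = (\<integral>\<^sup>+y. indicator (cball 0 R) (chart (snd p) y) \<partial>lborel)"
      by (rule nn_integral_hyperplane[OF borel_measurable_indicator[OF borel_closed[OF closed_cball]]])
    also have "\<dots> \<le> (\<integral>\<^sup>+y. indicator (cball 0 R) y \<partial>(lborel :: 'b measure))"
      using order_trans[OF norm_le_chart] by (intro nn_integral_mono) (auto simp: indicator_def)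
    also have "\<dots> < \<infinity>" using finite_cball[of "0::'b" R] by simp
    finally show ?thesis .
  qed
  have "frontier T \<inter> cball 0 R \<subseteq> (\<Union>p\<in>P. hyperplane p \<inter> cball 0 R)"
    using frontier_halfspaces[OF P] by auto
  hence "emeasure surface_measure (frontier T \<inter> cball 0 R) \<le> emeasure surface_measure (\<Union>p\<in>P. hyperplane p \<inter> cball 0 R)"
  proof (rule emeasure_mono)
    show "(\<Union>p\<in>P. hyperplane p \<inter> cball 0 R) \<in> sets surface_measure"
      using halfspaces_finite[OF P] by (intro sets.finite_UN) auto
  qed
  also have "\<dots> \<le> (\<Sum>p\<in>P. emeasure surface_measure (hyperplane p \<inter> cball 0 R))"
    using halfspaces_finite[OF P] by (intro emeasure_subadditive_finite) auto
  also have "\<dots> < \<infinity>" using fin halfspaces_finite[OF P] by simp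
  finally show ?thesis .
qed

lemma norm_outward_normal_le: "norm (outward_normal T z) \<le> 1"
proof (cases "\<exists>!n. norm n = 1 \<and> (\<forall>y\<in>T. n \<bullet> (y - z) \<le> 0)")
  case True
  from theI'[OF this] show ?thesis using True by (simp add: outward_normal_def)
next
  case False
  thus ?thesis unfolding outward_normal_def Let_def by (simp only: if_False norm_zero zero_le_one)
qed

lemma GDERIV_directional:
  assumes "GDERIV f z :> Df"
  shows "((\<lambda>t. f (z + t *\<^sub>R e)) has_real_derivative (Df \<bullet> e)) (at 0)"
proof -
  have g: "((\<lambda>t. z + t *\<^sub>R e) has_derivative (\<lambda>t. t *\<^sub>R e)) (at 0)"
    by (auto intro!: derivative_eq_intros)
  have "(f has_derivative (\<lambda>h. h \<bullet> Df)) (at (z + 0 *\<^sub>R e))" using assms by (simp add: gderiv_def)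
  from diff_chain_at[OF g this] have "((\<lambda>t. f (z + t *\<^sub>R e)) has_derivative (\<lambda>t. (t *\<^sub>R e) \<bullet> Df)) (at 0)"
    by (simp add: o_def)
  thus ?thesis by (simp add: has_field_derivative_def mult_commute_abs inner_commute)
qed

text \<open>Gauss's theorem is applied to the squares of the C1 approximations of w times \<rho>,
  and both sides pass to the limit. Because \<rho> has bounded support, convergence on a single
  bounded piece of \<open>T\<close> and of its frontier is enough.\<close>

lemma trace_green:
  fixes T :: "'a::euclidean_space set" and w u \<rho> \<rho>' :: "'a \<Rightarrow> real" and G :: "'a \<Rightarrow> 'a"
  assumes T: "polyhedron T" "interior T \<noteq> {}" and dim: "DIM('a) = Suc DIM('b::euclidean_space)"
    and [measurable]: "w \<in> borel_measurable borel" "G \<in> borel_measurable borel"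
    and tr: "is_trace T w G u" and e: "norm e = 1"
    and der: "\<And>z. ((\<lambda>t. \<rho> (z + t *\<^sub>R e)) has_real_derivative \<rho>' z) (at 0)"
    and \<rho>: "continuous_on UNIV \<rho>" "\<And>z. R < norm z \<Longrightarrow> \<rho> z = 0" and \<rho>': "continuous_on UNIV \<rho>'"
    and R: "0 < R"
  shows "integrable lborel (\<lambda>z. indicator T z * (2 * w z * (G z \<bullet> e) * \<rho> z + (w z)\<^sup>2 * \<rho>' z))"
    and "integrable surface_measure (\<lambda>z. indicator (frontier T) z * ((u z)\<^sup>2 * (\<rho> z * (outward_normal T z \<bullet> e))))"
    and "(LINT z|lborel. indicator T z * (2 * w z * (G z \<bullet> e) * \<rho> z + (w z)\<^sup>2 * \<rho>' z))
      = (LINT z|surface_measure. indicator (frontier T) z * ((u z)\<^sup>2 * (\<rho> z * (outward_normal T z \<bullet> e))))"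
proof -
  obtain P where P: "halfspaces_of P T" by (rule polyhedron_halfspaces[OF T(1)])
  have finP: "finite P" by (rule halfspaces_finite[OF P])
  have clT: "closed T" by (rule closed_halfspaces[OF P])
  have um: "(\<lambda>z. indicator (frontier T) z * u z) \<in> borel_measurable borel"
    using tr by (simp add: is_trace_def set_borel_measurable_def)
  obtain \<phi> D\<phi> where *: "(\<forall>k::nat. C1_function (\<phi> k) (D\<phi> k)) \<and> (\<forall>R>0.
      (\<lambda>k. \<integral>\<^sup>+z\<in>T \<inter> cball 0 R.
        ennreal ((\<phi> k z - w z)\<^sup>2 + (norm (D\<phi> k z - G z))\<^sup>2) \<partial>lborel) \<longlonglongrightarrow> 0 \<and>
      (\<lambda>k. \<integral>\<^sup>+z\<in>frontier T \<inter> cball 0 R. ennreal ((\<phi> k z - u z)\<^sup>2) \<partial>surface_measure) \<longlonglongrightarrow> 0)"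
    using tr[unfolded is_trace_def, THEN conjunct2] by (elim exE) (rule that)
  from * have C1: "\<And>k::nat. C1_function (\<phi> k) (D\<phi> k)" by blast
  from * have lim1: "(\<lambda>k. \<integral>\<^sup>+z\<in>T \<inter> cball 0 R.
      ennreal ((\<phi> k z - w z)\<^sup>2 + (norm (D\<phi> k z - G z))\<^sup>2) \<partial>lborel) \<longlonglongrightarrow> 0" using R by blast
  from * have lim2: "(\<lambda>k. \<integral>\<^sup>+z\<in>frontier T \<inter> cball 0 R.
      ennreal ((\<phi> k z - u z)\<^sup>2) \<partial>surface_measure) \<longlonglongrightarrow> 0" using R by blast
  have cD\<phi>: "continuous_on UNIV (D\<phi> k)" and G\<phi>: "GDERIV (\<phi> k) z :> D\<phi> k z" for k z
    using C1[of k] by (auto simp: C1_function_def)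
  have c\<phi>: "continuous_on UNIV (\<phi> k)" for k
    using G\<phi>[of k] by (auto simp: continuous_on_eq_continuous_at gderiv_def intro: has_derivative_continuous)
  have [measurable]: "\<phi> k \<in> borel_measurable borel" "D\<phi> k \<in> borel_measurable borel" for k
    using c\<phi> cD\<phi> by (auto intro: borel_measurable_continuous_onI)
  have [measurable]: "\<rho> \<in> borel_measurable borel" "\<rho>' \<in> borel_measurable borel"
    using \<rho> \<rho>' by (auto intro: borel_measurable_continuous_onI)
  have \<rho>'0: "\<rho>' z = 0" if "R < norm z" for z
    using der \<rho>(2) that by (rule directional_derivative_support)
  obtain C where C: "0 \<le> C" "\<And>z. \<bar>\<rho> z\<bar> \<le> C" using bounded_support_bound[OF \<rho>] by metis
  obtain C' where C': "0 \<le> C'" "\<And>z. \<bar>\<rho>' z\<bar> \<le> C'" using bounded_support_bound[OF \<rho>' \<rho>'0] by metis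
  let ?S = "T \<inter> cball 0 R" and ?F = "frontier T \<inter> cball 0 R"
  have cS: "compact ?S" "compact ?F" using clT by (auto intro!: closed_Int_compact)
  have [measurable]: "?S \<in> sets borel" "?F \<in> sets borel" "frontier T \<in> sets borel" "T \<in> sets borel" "cball 0 R \<in> sets borel"
    using clT by (auto intro!: borel_closed closed_Int)
  define f where "f k z = (\<phi> k z)\<^sup>2 * \<rho> z" for k z
  define f' where "f' k z = 2 * \<phi> k z * (D\<phi> k z \<bullet> e) * \<rho> z + (\<phi> k z)\<^sup>2 * \<rho>' z" for k z
  have der_f: "((\<lambda>t. f k (z + t *\<^sub>R e)) has_real_derivative f' k z) (at 0)" for k z
    unfolding f_def f'_def
    by (rule derivative_eq_intros GDERIV_directional[OF G\<phi>] der refl | simp)+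
  have c_f: "continuous_on UNIV (f k)" "continuous_on UNIV (f' k)" for k
    unfolding f_def f'_def by (intro continuous_intros c\<phi> cD\<phi> \<rho> \<rho>')+
  have f0: "R < norm z \<Longrightarrow> f k z = 0" for k z by (simp add: f_def \<rho>)
  note gauss = gauss_polyhedron[OF P T(2) dim der_f c_f(1) f0 c_f(2)]

  let ?w = "\<lambda>z. indicator ?S z * w z" and ?A = "\<lambda>k z. indicator ?S z * \<phi> k z"
  let ?G = "\<lambda>z. indicator ?S z * (G z \<bullet> e)" and ?B = "\<lambda>k z. indicator ?S z * (D\<phi> k z \<bullet> e)"
  have limA: "(\<lambda>k. \<integral>\<^sup>+z. ennreal ((?A k z - ?w z)\<^sup>2) \<partial>lborel) \<longlonglongrightarrow> 0"
  proof (rule tendsto_sandwich[OF _ _ tendsto_const lim1])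
    show "eventually (\<lambda>k. (\<integral>\<^sup>+z. ennreal ((?A k z - ?w z)\<^sup>2) \<partial>lborel)
      \<le> (\<integral>\<^sup>+z\<in>?S. ennreal ((\<phi> k z - w z)\<^sup>2 + (norm (D\<phi> k z - G z))\<^sup>2) \<partial>lborel)) sequentially"
      by (intro always_eventually allI nn_integral_mono) (auto simp: indicator_def intro!: ennreal_leI)
  qed simp
  have limB: "(\<lambda>k. \<integral>\<^sup>+z. ennreal ((?B k z - ?G z)\<^sup>2) \<partial>lborel) \<longlonglongrightarrow> 0"
  proof (rule tendsto_sandwich[OF _ _ tendsto_const lim1])
    have "(D\<phi> k z \<bullet> e - G z \<bullet> e)\<^sup>2 \<le> (norm (D\<phi> k z - G z))\<^sup>2" for k z
      using Cauchy_Schwarz_ineq[of "D\<phi> k z - G z" e] e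
      by (simp add: inner_diff_left dot_square_norm power2_norm_eq_inner[symmetric])
    hence "(D\<phi> k z \<bullet> e - G z \<bullet> e)\<^sup>2 \<le> (\<phi> k z - w z)\<^sup>2 + (norm (D\<phi> k z - G z))\<^sup>2" for k z
      by (rule order_trans) simp
    thus "eventually (\<lambda>k. (\<integral>\<^sup>+z. ennreal ((?B k z - ?G z)\<^sup>2) \<partial>lborel)
      \<le> (\<integral>\<^sup>+z\<in>?S. ennreal ((\<phi> k z - w z)\<^sup>2 + (norm (D\<phi> k z - G z))\<^sup>2) \<partial>lborel)) sequentially"
      by (intro always_eventually allI nn_integral_mono)
        (auto simp: indicator_def simp del: ennreal_plus intro!: ennreal_leI)
  qed simp
  have sq: "(indicator X z * x)\<^sup>2 = indicator X z * x\<^sup>2" for X and z :: 'a and x :: real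
    by (simp add: indicator_def)
  have iA: "integrable lborel (\<lambda>z. (?A k z)\<^sup>2)" for k
    unfolding sq using borel_integrable_compact[OF cS(1), of "\<lambda>z. (\<phi> k z)\<^sup>2"]
    by (simp add: continuous_on_subset[OF c\<phi>] continuous_on_power)
  have iB: "integrable lborel (\<lambda>z. (?B k z)\<^sup>2)" for k
    unfolding sq using borel_integrable_compact[OF cS(1), of "\<lambda>z. (D\<phi> k z \<bullet> e)\<^sup>2"]
    by (simp add: continuous_on_subset[OF cD\<phi>] continuous_on_power continuous_on_inner)
  have b2: "\<bar>2 * \<rho> z\<bar> \<le> 2 * C" for z using C by (simp add: abs_mult)
  have m[measurable]: "?w \<in> borel_measurable lborel" "?G \<in> borel_measurable lborel" "?A k \<in> borel_measurable lborel"
    "?B k \<in> borel_measurable lborel" "(\<lambda>z. 2 * \<rho> z) \<in> borel_measurable lborel" "\<rho>' \<in> borel_measurable lborel" for k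
    by measurable
  note p1 = L2_product_limit[OF m(1,2,5,3,4) b2 limA limB iA iB]
  note p2 = L2_product_limit[OF m(1,1,6,3,3) C'(2) limA limA iA iA]
  \<comment> \<open>The ball may be inserted into the indicators because \<rho> and \<rho>' vanish
    outside it; the integrand then consists of two products of the form required by
    \<open>L2_product_limit\<close>.\<close>
  have rw: "indicator T z * (2 * a * b * \<rho> z + a\<^sup>2 * \<rho>' z)
      = (indicator ?S z * a) * (indicator ?S z * b) * (2 * \<rho> z) + (indicator ?S z * a) * (indicator ?S z * a) * \<rho>' z" for a b z
    by (cases "norm z \<le> R") (auto simp: indicator_def \<rho>(2) \<rho>'0 power2_eq_square)
  show "integrable lborel (\<lambda>z. indicator T z * (2 * w z * (G z \<bullet> e) * \<rho> z + (w z)\<^sup>2 * \<rho>' z))"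
    unfolding rw by (rule Bochner_Integration.integrable_add[OF p1(1) p2(1)])
  \<comment> \<open>Integrability for a fixed k is read off from the same lemma, applied to constant
    sequences.\<close>
  have AB: "integrable lborel (\<lambda>z. ?A k z * ?B k z * (2 * \<rho> z))" for k
  proof -
    have "(\<lambda>k'::nat. \<integral>\<^sup>+z. ennreal ((?A k z - ?A k z)\<^sup>2) \<partial>(lborel :: 'a measure)) \<longlonglongrightarrow> 0" by simp
    moreover have "(\<lambda>k'::nat. \<integral>\<^sup>+z. ennreal ((?B k z - ?B k z)\<^sup>2) \<partial>(lborel :: 'a measure)) \<longlonglongrightarrow> 0" by simp
    ultimately show ?thesis
      by (rule L2_product_limit(1)[OF m(3,4,5) m(3,4) b2 _ _ iA iB])
  qed
  have AA: "integrable lborel (\<lambda>z. ?A k z * ?A k z * \<rho>' z)" for k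
  proof -
    have "(\<lambda>k'::nat. \<integral>\<^sup>+z. ennreal ((?A k z - ?A k z)\<^sup>2) \<partial>(lborel :: 'a measure)) \<longlonglongrightarrow> 0" by simp
    from this this show ?thesis
      by (rule L2_product_limit(1)[OF m(3,3,6) m(3,3) C'(2) _ _ iA iA])
  qed
  have L1: "(\<lambda>k. LINT z|lborel. indicator T z * f' k z)
      \<longlonglongrightarrow> (LINT z|lborel. indicator T z * (2 * w z * (G z \<bullet> e) * \<rho> z + (w z)\<^sup>2 * \<rho>' z))"
    unfolding f'_def rw Bochner_Integration.integral_add[OF p1(1) p2(1)]
    unfolding Bochner_Integration.integral_add[OF AB AA]
    by (rule tendsto_add[OF p1(2) p2(2)])

  let ?u = "\<lambda>z. indicator ?F z * u z" and ?U = "\<lambda>k z. indicator ?F z * \<phi> k z"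
  let ?h = "\<lambda>z. indicator (frontier T) z * (\<rho> z * (outward_normal T z \<bullet> e))"
  have ueq: "?u z = indicator (cball 0 R) z * (indicator (frontier T) z * u z)" for z by (auto simp: indicator_def)
  have u_m: "?u \<in> borel_measurable surface_measure" unfolding ueq using um by measurable
  have U_m: "?U k \<in> borel_measurable surface_measure" for k by measurable
  \<comment> \<open>Measurability of the normal comes from its expansion over the facets, which are
    Borel sets.\<close>
  have h_m: "?h \<in> borel_measurable surface_measure"
  proof -
    have "?h z = indicator (frontier T) z * (\<rho> z * (\<Sum>p\<in>P. indicator (facet P p) z * (fst p \<bullet> e)))" for z
      by (cases "z \<in> frontier T") (auto simp: outward_normal_eq_sum[OF P] inner_sum_left)
    moreover have "(\<lambda>z. indicator (frontier T) z * (\<rho> z * (\<Sum>p\<in>P. indicator (facet P p) z * (fst p \<bullet> e))))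
        \<in> borel_measurable surface_measure"
    proof -
      have [measurable]: "facet P p \<in> sets borel" for p by (rule facet_borel[OF finP])
      show ?thesis by measurable
    qed
    ultimately show ?thesis by presburger
  qed
  have h_b: "\<bar>?h z\<bar> \<le> C" for z
  proof -
    have "\<bar>outward_normal T z \<bullet> e\<bar> \<le> norm (outward_normal T z) * norm e" by (rule Cauchy_Schwarz_ineq2)
    also have "\<dots> \<le> 1 * 1" using norm_outward_normal_le e by (intro mult_mono) auto
    finally have "\<bar>\<rho> z\<bar> * \<bar>outward_normal T z \<bullet> e\<bar> \<le> C * 1" using C by (intro mult_mono) auto
    thus ?thesis using C(1) by (simp add: indicator_def abs_mult)
  qed
  have limU: "(\<lambda>k. \<integral>\<^sup>+z. ennreal ((?U k z - ?u z)\<^sup>2) \<partial>surface_measure) \<longlonglongrightarrow> 0"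
  proof -
    have "ennreal ((?U k z - ?u z)\<^sup>2) = ennreal ((\<phi> k z - u z)\<^sup>2) * indicator ?F z" for k z
      by (auto simp: indicator_def)
    thus ?thesis using lim2 by presburger
  qed
  have iU: "integrable surface_measure (\<lambda>z. (?U k z)\<^sup>2)" for k
  proof -
    have "compact (\<phi> k ` ?F)" using cS(2) c\<phi> by (intro compact_continuous_image) (auto intro: continuous_on_subset)
    then obtain K where K: "\<And>z. z \<in> ?F \<Longrightarrow> \<bar>\<phi> k z\<bar> \<le> K"
      using compact_imp_bounded bounded_iff by (metis imageI real_norm_def)
    show ?thesis
    proof (rule Bochner_Integration.integrable_bound)
      show "integrable surface_measure (\<lambda>z. K\<^sup>2 * indicator ?F z)"
        using surface_frontier_finite[OF P dim, of R]
        by (intro integrable_mult_right integrable_real_indicator) auto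
      have "(?U k z)\<^sup>2 \<le> K\<^sup>2 * indicator ?F z" for z
        using K[of z] by (auto simp: indicator_def abs_le_square_iff[symmetric] intro: order_trans[OF _ abs_ge_self])
      thus "AE z in surface_measure. norm ((?U k z)\<^sup>2) \<le> norm (K\<^sup>2 * indicator ?F z)" by simp
    qed (use U_m in measurable)
  qed
  note q = L2_product_limit[OF u_m u_m h_m U_m U_m h_b limU limU iU iU]
  have rw2: "indicator (frontier T) z * (a\<^sup>2 * (\<rho> z * (outward_normal T z \<bullet> e)))
      = (indicator ?F z * a) * (indicator ?F z * a) * ?h z" for a z
    by (cases "norm z \<le> R") (auto simp: indicator_def \<rho>(2) power2_eq_square)
  show "integrable surface_measure (\<lambda>z. indicator (frontier T) z * ((u z)\<^sup>2 * (\<rho> z * (outward_normal T z \<bullet> e))))"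
    unfolding rw2 by (rule q(1))
  have rw3: "indicator (frontier T) z * (f k z * (outward_normal T z \<bullet> e)) = ?U k z * ?U k z * ?h z" for k z
    unfolding rw2[symmetric] by (simp add: f_def)
  have L2: "(\<lambda>k. LINT z|surface_measure. indicator (frontier T) z * (f k z * (outward_normal T z \<bullet> e)))
      \<longlonglongrightarrow> (LINT z|surface_measure. indicator (frontier T) z * ((u z)\<^sup>2 * (\<rho> z * (outward_normal T z \<bullet> e))))"
    unfolding rw3 rw2 by (rule q(2))
  show "(LINT z|lborel. indicator T z * (2 * w z * (G z \<bullet> e) * \<rho> z + (w z)\<^sup>2 * \<rho>' z))
      = (LINT z|surface_measure. indicator (frontier T) z * ((u z)\<^sup>2 * (\<rho> z * (outward_normal T z \<bullet> e))))"
    by (rule LIMSEQ_unique[OF L1]) (use L2 gauss(2) in simp)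
qed

section \<open>Integration by parts on a mesh\<close>


text \<open>Different elements meet only in their frontiers, which are null sets because the
  elements are convex.\<close>

lemma mesh_indicator_sum:
  fixes \<T> :: "'a::euclidean_space set set" and F :: "'a \<Rightarrow> real"
  assumes m: "mesh \<T>" and F: "\<And>z. R < norm z \<Longrightarrow> F z = 0"
  defines "\<S> \<equiv> {T \<in> \<T>. T \<inter> cball 0 R \<noteq> {}}"
  shows "AE z in lborel. (\<Sum>T\<in>\<S>. indicator T z * F z) = F z"
proof -
  have fin: "finite \<S>" unfolding \<S>_def by (rule mesh_finite_near[OF m]) simp
  define N where "N = (\<Union>T\<in>\<S>. frontier T)"
  have "frontier T \<in> null_sets lborel" if "T \<in> \<S>" for T
  proof -
    have "negligible (frontier T)"
      using that mesh_convex[OF m] by (intro negligible_convex_frontier) (simp add: \<S>_def)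
    thus ?thesis by (simp add: negligible_iff_null_sets null_sets_def)
  qed
  hence N: "N \<in> null_sets lborel" unfolding N_def using fin by (intro null_sets.finite_UN) auto
  show ?thesis
  proof (rule AE_I'[OF N], rule subsetI, rule ccontr)
    fix z assume ne: "z \<in> {z \<in> space lborel. (\<Sum>T\<in>\<S>. indicator T z * F z) \<noteq> F z}" and zN: "z \<notin> N"
    show False
    proof (cases "norm z \<le> R")
      case True
      obtain T where T: "T \<in> \<T>" "z \<in> T" using mesh_cover[OF m] by blast
      hence TS: "T \<in> \<S>" using True by (auto simp: \<S>_def)
      have "indicator T' z * F z = (if T' = T then F z else 0)" if "T' \<in> \<S>" for T'
      proof (cases "T' = T")
        case False
        have "z \<notin> T'"
        proof
          assume "z \<in> T'"
          hence "z \<in> frontier T'" using False T that by (intro mesh_overlap_null[OF m, of z T' T]) (auto simp: \<S>_def)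
          thus False using zN that by (auto simp: N_def)
        qed
        thus ?thesis using False by simp
      qed (use T in simp)
      hence "(\<Sum>T'\<in>\<S>. indicator T' z * F z) = (\<Sum>T'\<in>\<S>. if T' = T then F z else 0)" by (intro sum.cong) auto
      thus False using ne TS fin by simp
    qed (use ne F in simp)
  qed
qed

text \<open>The support of \<rho> meets finitely many elements, so the identity is a finite sum of
  instances of \<open>trace_green\<close>. Each element has its own trace \<open>u T\<close>, hence
  the contributions of an interface remain separate summands.\<close>

theorem mesh_green:
  fixes \<T> :: "'a::euclidean_space set set" and w \<rho> \<rho>' :: "'a \<Rightarrow> real" and G :: "'a \<Rightarrow> 'a"
  assumes m: "mesh \<T>" and dim: "DIM('a) = Suc DIM('b::euclidean_space)"
    and [measurable]: "w \<in> borel_measurable borel" "G \<in> borel_measurable borel"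
    and tr: "\<And>T. T \<in> \<T> \<Longrightarrow> is_trace T w G (u T)" and e: "norm e = 1"
    and der: "\<And>z. ((\<lambda>t. \<rho> (z + t *\<^sub>R e)) has_real_derivative \<rho>' z) (at 0)"
    and \<rho>: "continuous_on UNIV \<rho>" "\<And>z. R < norm z \<Longrightarrow> \<rho> z = 0" and \<rho>': "continuous_on UNIV \<rho>'"
    and R: "0 < R"
  shows "integrable lborel (\<lambda>z. 2 * w z * (G z \<bullet> e) * \<rho> z + (w z)\<^sup>2 * \<rho>' z)"
    and "integrable surface_measure
      (\<lambda>z. \<Sum>T\<in>{T \<in> \<T>. z \<in> frontier T}. (u T z)\<^sup>2 * (\<rho> z * (outward_normal T z \<bullet> e)))"
    and "(LINT z|lborel. 2 * w z * (G z \<bullet> e) * \<rho> z + (w z)\<^sup>2 * \<rho>' z)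
      = (LINT z|surface_measure. (\<Sum>T\<in>{T \<in> \<T>. z \<in> frontier T}. (u T z)\<^sup>2 * (\<rho> z * (outward_normal T z \<bullet> e))))"
proof -
  define \<S> where "\<S> = {T \<in> \<T>. T \<inter> cball 0 R \<noteq> {}}"
  have fin: "finite \<S>" unfolding \<S>_def by (rule mesh_finite_near[OF m]) simp
  have sub: "\<S> \<subseteq> \<T>" by (auto simp: \<S>_def)
  note tg = trace_green[OF mesh_polyhedron[OF m] mesh_interior[OF m] dim assms(3,4) tr e der \<rho> \<rho>' R]
  have [measurable]: "\<rho> \<in> borel_measurable borel" "\<rho>' \<in> borel_measurable borel"
    using \<rho> \<rho>' by (auto intro: borel_measurable_continuous_onI)
  define F where "F z = 2 * w z * (G z \<bullet> e) * \<rho> z + (w z)\<^sup>2 * \<rho>' z" for z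
  have Fm: "F \<in> borel_measurable lborel" unfolding F_def by measurable
  have \<rho>'0: "\<rho>' z = 0" if "R < norm z" for z
    using der \<rho>(2) that by (rule directional_derivative_support)
  have F0: "R < norm z \<Longrightarrow> F z = 0" for z by (simp add: F_def \<rho>(2) \<rho>'0)
  have ae: "AE z in lborel. (\<Sum>T\<in>\<S>. indicator T z * F z) = F z"
    unfolding \<S>_def by (rule mesh_indicator_sum[OF m F0])
  have iT: "integrable lborel (\<lambda>z. indicator T z * F z)" if "T \<in> \<S>" for T
    unfolding F_def using tg(1)[of T] sub that by blast
  have Tm: "(\<lambda>z. indicator T z * F z) \<in> borel_measurable lborel" if "T \<in> \<S>" for T
    using iT[OF that] by (rule borel_measurable_integrable)
  have iS: "integrable lborel (\<lambda>z. \<Sum>T\<in>\<S>. indicator T z * F z)"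
    using iT by (rule Bochner_Integration.integrable_sum)
  show "integrable lborel (\<lambda>z. 2 * w z * (G z \<bullet> e) * \<rho> z + (w z)\<^sup>2 * \<rho>' z)"
    using iS ae Fm unfolding F_def[symmetric]
    by (subst integrable_cong_AE[OF Fm borel_measurable_integrable[OF iS]]) auto
  define B where "B T z = (u T z)\<^sup>2 * (\<rho> z * (outward_normal T z \<bullet> e))" for T z
  have Beq: "(\<Sum>T\<in>{T \<in> \<T>. z \<in> frontier T}. B T z) = (\<Sum>T\<in>\<S>. indicator (frontier T) z * B T z)" for z
  proof (cases "norm z \<le> R")
    case True
    have "{T \<in> \<T>. z \<in> frontier T} \<subseteq> \<S>"
    proof
      fix T assume T: "T \<in> {T \<in> \<T>. z \<in> frontier T}"
      hence "z \<in> T \<inter> cball 0 R" using True frontier_subset_closed[OF mesh_closed[OF m, of T]] by auto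
      thus "T \<in> \<S>" using T unfolding \<S>_def by blast
    qed
    hence "(\<Sum>T\<in>{T \<in> \<T>. z \<in> frontier T}. indicator (frontier T) z * B T z)
        = (\<Sum>T\<in>\<S>. indicator (frontier T) z * B T z)"
      using sub by (intro sum.mono_neutral_left[OF fin]) (auto simp: indicator_def)
    thus ?thesis by simp
  qed (simp add: B_def \<rho>(2))
  have iB: "integrable surface_measure (\<lambda>z. indicator (frontier T) z * B T z)" if "T \<in> \<S>" for T
    unfolding B_def using tg(2)[of T] sub that by blast
  show "integrable surface_measure
      (\<lambda>z. \<Sum>T\<in>{T \<in> \<T>. z \<in> frontier T}. (u T z)\<^sup>2 * (\<rho> z * (outward_normal T z \<bullet> e)))"
    unfolding B_def[symmetric] Beq using iB by (rule Bochner_Integration.integrable_sum)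
  have "(LINT z|lborel. F z) = (LINT z|lborel. (\<Sum>T\<in>\<S>. indicator T z * F z))"
    using ae by (intro integral_cong_AE[OF Fm borel_measurable_integrable[OF iS]]) auto
  also have "\<dots> = (\<Sum>T\<in>\<S>. (LINT z|lborel. indicator T z * F z))"
    using iT by (rule Bochner_Integration.integral_sum)
  also have "\<dots> = (\<Sum>T\<in>\<S>. (LINT z|surface_measure. indicator (frontier T) z * B T z))"
    unfolding F_def B_def using tg(3) sub by (intro sum.cong) blast+
  also have "\<dots> = (LINT z|surface_measure. (\<Sum>T\<in>\<S>. indicator (frontier T) z * B T z))"
    using iB by (rule Bochner_Integration.integral_sum[symmetric])
  finally have "(LINT z|lborel. F z) = (LINT z|surface_measure. (\<Sum>T\<in>{T \<in> \<T>. z \<in> frontier T}. B T z))"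
    unfolding Beq .
  thus "(LINT z|lborel. 2 * w z * (G z \<bullet> e) * \<rho> z + (w z)\<^sup>2 * \<rho>' z)
      = (LINT z|surface_measure. (\<Sum>T\<in>{T \<in> \<T>. z \<in> frontier T}. (u T z)\<^sup>2 * (\<rho> z * (outward_normal T z \<bullet> e))))"
    unfolding F_def B_def .
qed

section \<open>The cut-off and the weighted flux\<close>

definition bump :: "real \<Rightarrow> 'a::real_inner \<Rightarrow> real" where
  "bump R z = max 0 (1 - (norm z)\<^sup>2 / R\<^sup>2)"

lemma bump_nonneg: "0 \<le> bump R z" and bump_le_1: "bump R z \<le> 1"
  by (auto simp: bump_def)

lemma bump_outside: "0 < R \<Longrightarrow> R < norm z \<Longrightarrow> bump R z = 0"
  by (simp add: bump_def pos_le_divide_eq power_mono)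

lemma continuous_bump: "continuous_on A (bump R)"
proof -
  have "continuous_on A (\<lambda>z::'a. max 0 (1 - (norm z)\<^sup>2 * c))" for c by (intro continuous_intros)
  thus ?thesis by (simp add: bump_def[abs_def] divide_inverse)
qed

text \<open>\<open>bump\<close> has a kink on the sphere of radius R; squaring removes it and leaves
  one factor \<open>bump\<close> in the derivative.\<close>

lemma DERIV_max_0_square: "((\<lambda>x::real. (max 0 x)\<^sup>2) has_real_derivative 2 * max 0 x) (at x)"
proof (cases "x = 0")
  case True
  have "((\<lambda>h::real. ((max 0 (0 + h))\<^sup>2 - (max 0 0)\<^sup>2) / h) \<longlongrightarrow> 0) (at 0)"
  proof (rule Lim_null_comparison)
    show "eventually (\<lambda>h::real. norm (((max 0 (0 + h))\<^sup>2 - (max 0 0)\<^sup>2) / h) \<le> \<bar>h\<bar>) (at 0)"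
      by (intro always_eventually allI) (auto simp: max_def power2_eq_square)
    show "((\<lambda>h::real. \<bar>h\<bar>) \<longlongrightarrow> 0) (at 0)" by (rule tendsto_rabs_zero) (rule tendsto_ident_at)
  qed
  thus ?thesis using True by (simp add: DERIV_def)
next
  case False
  show ?thesis
  proof (cases "0 < x")
    case True
    have "eventually (\<lambda>y::real. y \<in> {0<..}) (nhds x)" by (rule eventually_nhds_in_open) (use True in auto)
    hence "eventually (\<lambda>y::real. (max 0 y)\<^sup>2 = y\<^sup>2) (nhds x)" by eventually_elim auto
    moreover have "((\<lambda>y::real. y\<^sup>2) has_real_derivative 2 * max 0 x) (at x)"
      using True by (auto intro!: derivative_eq_intros)
    ultimately show ?thesis by (subst DERIV_cong_ev[OF refl _ refl]) auto
  next
    case neg: False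
    have "eventually (\<lambda>y::real. y \<in> {..<0}) (nhds x)" by (rule eventually_nhds_in_open) (use neg False in auto)
    hence "eventually (\<lambda>y::real. (max 0 y)\<^sup>2 = 0) (nhds x)" by eventually_elim auto
    moreover have "((\<lambda>y::real. 0) has_real_derivative 2 * max 0 x) (at x)" using neg by auto
    ultimately show ?thesis by (subst DERIV_cong_ev[OF refl _ refl]) auto
  qed
qed

lemma DERIV_bump_square:
  "((\<lambda>t. (bump R (z + t *\<^sub>R e))\<^sup>2) has_real_derivative - 4 * bump R z * (z \<bullet> e) / R\<^sup>2) (at 0)"
proof -
  have eq: "(norm (z + t *\<^sub>R e))\<^sup>2 = z \<bullet> z + 2 * t * (z \<bullet> e) + t\<^sup>2 * (e \<bullet> e)" for t
    unfolding power2_norm_eq_inner by (simp add: inner_simps inner_commute power2_eq_square algebra_simps)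
  have "((\<lambda>t. 1 - (norm (z + t *\<^sub>R e))\<^sup>2 * c) has_real_derivative - (2 * (z \<bullet> e) * c)) (at 0)" for c
    unfolding eq by (auto intro!: derivative_eq_intros)
  from this[of "inverse (R\<^sup>2)"]
  have d: "((\<lambda>t. 1 - (norm (z + t *\<^sub>R e))\<^sup>2 / R\<^sup>2) has_real_derivative - (2 * (z \<bullet> e) / R\<^sup>2)) (at 0)"
    by (simp add: divide_inverse)
  have "((\<lambda>t. (max 0 (1 - (norm (z + t *\<^sub>R e))\<^sup>2 / R\<^sup>2))\<^sup>2) has_real_derivative
      2 * max 0 (1 - (norm (z + 0 *\<^sub>R e))\<^sup>2 / R\<^sup>2) * - (2 * (z \<bullet> e) / R\<^sup>2)) (at 0)"
    by (rule DERIV_chain2[OF DERIV_max_0_square d])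
  thus ?thesis by (simp add: bump_def mult.assoc)
qed

lemma bump_tendsto: "(\<lambda>n. bump (real (Suc n)) z) \<longlonglongrightarrow> 1"
proof -
  have "(\<lambda>n. max 0 (1 - (norm z)\<^sup>2 * (inverse (real (Suc n)))\<^sup>2)) \<longlonglongrightarrow> max 0 (1 - (norm z)\<^sup>2 * 0\<^sup>2)"
    by (intro tendsto_intros LIMSEQ_inverse_real_of_nat)
  thus ?thesis by (simp add: bump_def field_simps)
qed

definition xdir :: "'d::finite \<Rightarrow> 'd phase" where
  "xdir j = (0, axis j 1)"

lemma norm_xdir: "norm (xdir j) = 1"
  by (simp add: xdir_def norm_Pair)

lemma inner_xdir: "z \<bullet> xdir j = snd z $ j"
  by (cases z) (simp add: xdir_def inner_axis)

context
  fixes V :: "real ^ 'd::finite \<Rightarrow> real" and DV :: "real ^ 'd \<Rightarrow> real ^ 'd" and HV :: "real ^ 'd \<Rightarrow> real ^ 'd ^ 'd"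
  assumes V: "C2_function V DV HV"
begin

lemma continuous_DV: "continuous_on A DV" and continuous_V: "continuous_on A V" and continuous_HV: "continuous_on A HV"
proof -
  have "isCont DV x" for x using V by (auto simp: C2_function_def intro: has_derivative_continuous)
  thus "continuous_on A DV" by (simp add: continuous_at_imp_continuous_on)
  have "isCont V x" for x using V by (auto simp: C2_function_def gderiv_def intro: has_derivative_continuous)
  thus "continuous_on A V" by (simp add: continuous_at_imp_continuous_on)
  show "continuous_on A HV" using V by (auto simp: C2_function_def intro: continuous_on_subset)
qed

lemma continuous_on_snd_comp:
  "continuous_on A (\<lambda>z. DV (snd z))" "continuous_on A (\<lambda>z. V (snd z))" "continuous_on A (\<lambda>z. HV (snd z))"
  by (rule continuous_on_compose2[OF continuous_DV[of UNIV]] continuous_on_compose2[OF continuous_V[of UNIV]]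
      continuous_on_compose2[OF continuous_HV[of UNIV]]; simp add: continuous_on_snd continuous_on_id)+

lemma continuous_energy: "continuous_on A (energy V)"
proof -
  have "energy V = (\<lambda>z. V (snd z) + (norm (fst z))\<^sup>2 / 2)" by (auto simp: energy_def split: prod.split)
  thus ?thesis by (simp only:) (intro continuous_intros continuous_on_snd_comp, simp)
qed

lemma DERIV_DV_component:
  "((\<lambda>t. DV (x + t *\<^sub>R axis j 1) $ j) has_real_derivative HV x $ j $ j) (at 0)"
proof -
  have g: "((\<lambda>t. x + t *\<^sub>R axis j 1) has_derivative (\<lambda>t. t *\<^sub>R axis j 1)) (at 0)"
    by (auto intro!: derivative_eq_intros)
  have "(DV has_derivative (\<lambda>h. HV x *v h)) (at (x + 0 *\<^sub>R axis j 1))"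
    using V by (simp add: C2_function_def)
  from diff_chain_at[OF g this]
  have "((\<lambda>t. DV (x + t *\<^sub>R axis j 1)) has_derivative (\<lambda>t. HV x *v (t *\<^sub>R axis j 1))) (at 0)"
    by (simp add: o_def)
  from bounded_linear.has_derivative[OF bounded_linear_vec_nth[of j] this]
  have "((\<lambda>t. DV (x + t *\<^sub>R axis j 1) $ j) has_derivative (\<lambda>t. (HV x *v (t *\<^sub>R axis j 1)) $ j)) (at 0)" .
  moreover have "(HV x *v (t *\<^sub>R axis j 1)) $ j = HV x $ j $ j * t" for t
    by (simp add: matrix_vector_mult_def axis_def if_distrib[of "\<lambda>u. _ * u"] cong: if_cong)
  ultimately show ?thesis by (simp add: has_field_derivative_def)
qed

lemma DERIV_weight:
  "((\<lambda>t. exp (- energy V (z + t *\<^sub>R xdir j))) has_real_derivative - (DV (snd z) $ j) * exp (- energy V z)) (at 0)"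
proof -
  have "GDERIV V (snd z) :> DV (snd z)" using V by (simp add: C2_function_def)
  from GDERIV_directional[OF this, of "axis j 1"]
  have "((\<lambda>t. V (snd z + t *\<^sub>R axis j 1)) has_real_derivative DV (snd z) $ j) (at 0)"
    by (simp add: inner_axis)
  hence "((\<lambda>t. exp (- (V (snd z + t *\<^sub>R axis j 1) + (norm (fst z))\<^sup>2 / 2))) has_real_derivative
      exp (- (V (snd z + 0 *\<^sub>R axis j 1) + (norm (fst z))\<^sup>2 / 2)) * - (DV (snd z) $ j)) (at 0)"
    by (auto intro!: derivative_eq_intros)
  moreover have "energy V (z + t *\<^sub>R xdir j) = V (snd z + t *\<^sub>R axis j 1) + (norm (fst z))\<^sup>2 / 2" for t
    by (cases z) (simp add: energy_def xdir_def)
  moreover have "energy V z = V (snd z) + (norm (fst z))\<^sup>2 / 2" by (cases z) (simp add: energy_def)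
  ultimately show ?thesis by (simp add: mult.commute)
qed

definition flux :: "real \<Rightarrow> 'd \<Rightarrow> 'd phase \<Rightarrow> real" where
  "flux R j z = (bump R z)\<^sup>2 * DV (snd z) $ j * exp (- energy V z)"

text \<open>The derivative of \<open>flux\<close> along \<open>xdir j\<close>: the cut-off
  contributes the first term, the gradient of V the Hessian entry, and the weight the negative
  square.\<close>

definition flux' :: "real \<Rightarrow> 'd \<Rightarrow> 'd phase \<Rightarrow> real" where
  "flux' R j z = exp (- energy V z) * (- 4 * bump R z * (snd z $ j) / R\<^sup>2 * DV (snd z) $ j
      + (bump R z)\<^sup>2 * (HV (snd z) $ j $ j - (DV (snd z) $ j)\<^sup>2))"

lemma DERIV_flux: "((\<lambda>t. flux R j (z + t *\<^sub>R xdir j)) has_real_derivative flux' R j z) (at 0)"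
proof -
  have s: "snd (z + t *\<^sub>R xdir j) = snd z + t *\<^sub>R axis j 1" for t by (cases z) (simp add: xdir_def)
  have "((\<lambda>t. (bump R (z + t *\<^sub>R xdir j))\<^sup>2 * DV (snd z + t *\<^sub>R axis j 1) $ j * exp (- energy V (z + t *\<^sub>R xdir j)))
      has_real_derivative ((- 4 * bump R z * (z \<bullet> xdir j) / R\<^sup>2) * DV (snd z + 0 *\<^sub>R axis j 1) $ j
         + HV (snd z) $ j $ j * (bump R (z + 0 *\<^sub>R xdir j))\<^sup>2) * exp (- energy V (z + 0 *\<^sub>R xdir j))
       + (- (DV (snd z) $ j) * exp (- energy V z)) * ((bump R (z + 0 *\<^sub>R xdir j))\<^sup>2 * DV (snd z + 0 *\<^sub>R axis j 1) $ j)) (at 0)"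
    by (intro DERIV_mult DERIV_bump_square DERIV_DV_component DERIV_weight)
  thus ?thesis unfolding flux_def flux'_def s
    by (rule DERIV_cong) (simp add: inner_xdir algebra_simps power2_eq_square)
qed

lemma continuous_flux:
  assumes "0 < R"
  shows "continuous_on UNIV (flux R j)" "continuous_on UNIV (flux' R j)"
  using assms unfolding flux_def flux'_def
  by (intro continuous_intros continuous_bump continuous_on_snd_comp continuous_energy; simp)+

lemma flux_outside: "0 < R \<Longrightarrow> R < norm z \<Longrightarrow> flux R j z = 0"
  by (simp add: flux_def bump_outside)

end

section \<open>The identity with a cut-off\<close>


text \<open>An index type with \<open>2 d - 1\<close> elements: \<open>real ^ 'd facet_index\<close> has the dimension of a hyperplane of
  phase space and serves as the parameter space of its charts.\<close>

typedef 'd facet_index = "UNIV - {Inl undefined} :: ('d + 'd) set"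
  by (rule exI[of _ "Inr undefined"]) simp

lemma facet_index_UNIV: "(UNIV :: 'd facet_index set) = Abs_facet_index ` (UNIV - {Inl undefined})"
  by (metis type_definition.Abs_image type_definition_facet_index)

instance facet_index :: (finite) finite
  by standard (simp add: facet_index_UNIV)

lemma DIM_phase: "DIM('d::finite phase) = Suc DIM(real ^ 'd facet_index)"
proof -
  have "CARD('d facet_index) = card (UNIV - {Inl undefined} :: ('d + 'd) set)"
    by (rule type_definition.card[OF type_definition_facet_index])
  also have "\<dots> = 2 * CARD('d) - 1" by (simp add: card_Diff_singleton card_UNIV_sum)
  finally have "CARD('d facet_index) = 2 * CARD('d) - 1" .
  thus ?thesis using zero_less_card_finite[where 'a = 'd] by simp
qed

lemma tensor_mult_vec: "tensor a b *v d = (b \<bullet> d) *\<^sub>R a"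
  by (simp add: vec_eq_iff tensor_def matrix_vector_mult_def inner_vec_def sum_distrib_left mult_ac)

lemma norm_vec_square: "(norm (x :: real ^ 'n))\<^sup>2 = (\<Sum>i\<in>UNIV. (x $ i)\<^sup>2)"
  unfolding power2_norm_eq_inner inner_vec_def by (simp add: power2_eq_square)

lemma two_element_jump:
  assumes S: "{T \<in> \<T>. z \<in> frontier T} = {T1, T2}" and ne: "T1 \<noteq> T2"
    and n: "outward_normal T2 z = - outward_normal T1 z"
  shows "(\<Sum>T\<in>{T \<in> \<T>. z \<in> frontier T}. (norm (tr T z))\<^sup>2 * (snd (outward_normal T z) \<bullet> d))
    = 2 * (avg \<T> tr z \<bullet> (jump_x \<T> tr z *v d))"
proof -
  have J: "jump_x \<T> tr z *v d = (snd (outward_normal T1 z) \<bullet> d) *\<^sub>R (tr T1 z - tr T2 z)"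
    using ne by (simp add: jump_x_def S n matrix_vector_mult_add_rdistrib tensor_mult_vec scaleR_diff_right)
  have A: "avg \<T> tr z = (1 / 2) *\<^sub>R (tr T1 z + tr T2 z)"
    using ne by (simp add: avg_def S)
  show ?thesis
    unfolding J A using ne
    by (simp add: S n power2_norm_eq_inner inner_simps inner_commute algebra_simps)
qed

locale broken_field =
  fixes V :: "real ^ 'd::finite \<Rightarrow> real" and DV :: "real ^ 'd \<Rightarrow> real ^ 'd" and HV :: "real ^ 'd \<Rightarrow> real ^ 'd ^ 'd"
    and \<T> :: "'d phase set set" and g :: "'d phase \<Rightarrow> real ^ 'd" and tr :: "'d phase set \<Rightarrow> 'd phase \<Rightarrow> real ^ 'd"
  assumes mesh: "mesh \<T>" and V: "C2_function V DV HV"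
    and H1: "\<And>i. (\<lambda>z. g z $ i) \<in> H1_broken V \<T>"
    and trace: "\<And>T i. T \<in> \<T> \<Longrightarrow> is_trace T (\<lambda>z. g z $ i) (hgrad \<T> (\<lambda>z. g z $ i)) (\<lambda>z. tr T z $ i)"
    and jump: "set_integrable (nu V) (skeleton \<T>) (\<lambda>z. avg \<T> tr z \<bullet> (jump_x \<T> tr z *v DV (snd z)))"
begin

abbreviation "Gx \<equiv> hgrad_x \<T> g"

definition jump_density :: "'d phase \<Rightarrow> real" where
  "jump_density z = indicator (skeleton \<T>) z * (avg \<T> tr z \<bullet> (jump_x \<T> tr z *v DV (snd z)))"

text \<open>The sum over components i and directions j of the product rule for g_i^2 times the flux,
  with the factor exp (- E) divided out, see \<open>flux_sum\<close>. The term with - |DV|^2 comes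
  from the weight and is the source of coercivity.\<close>

definition green_density :: "real \<Rightarrow> 'd phase \<Rightarrow> real" where
  "green_density R z = 2 * (bump R z)\<^sup>2 * (g z \<bullet> (Gx z *v DV (snd z)))
     + (norm (g z))\<^sup>2 * (- 4 * bump R z * (snd z \<bullet> DV (snd z)) / R\<^sup>2
        + (bump R z)\<^sup>2 * ((\<Sum>j\<in>UNIV. HV (snd z) $ j $ j) - (norm (DV (snd z)))\<^sup>2))"

lemma measurable_component: "(\<lambda>z. g z $ i) \<in> borel_measurable borel"
  using H1[of i] by (simp add: H1_broken_def)

lemma measurable_hgrad: "hgrad \<T> (\<lambda>z. g z $ i) \<in> borel_measurable borel"
proof -
  have "\<exists>G. broken_gradient \<T> (\<lambda>z. g z $ i) G" using H1[of i] by (auto simp: H1_broken_def)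
  hence "broken_gradient \<T> (\<lambda>z. g z $ i) (hgrad \<T> (\<lambda>z. g z $ i))"
    unfolding hgrad_def by (rule someI_ex)
  thus ?thesis by (simp add: broken_gradient_def)
qed

lemma Gx_component: "Gx z $ i $ j = hgrad \<T> (\<lambda>y. g y $ i) z \<bullet> xdir j"
  by (simp add: hgrad_x_def inner_xdir)

lemma measurable_g [measurable]: "g \<in> borel_measurable borel"
  by (subst borel_measurable_euclidean_space) (auto simp: Basis_vec_def inner_axis measurable_component)

lemma measurable_Gx [measurable]: "Gx \<in> borel_measurable borel"
proof -
  have "(\<lambda>z. hgrad \<T> (\<lambda>y. g y $ i) z \<bullet> xdir j) \<in> borel_measurable borel" for i j
    using measurable_hgrad[of i] by measurable
  hence "(\<lambda>z. Gx z $ i $ j) \<in> borel_measurable borel" for i j by (simp add: Gx_component)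
  thus ?thesis
    by (subst borel_measurable_euclidean_space) (auto simp: Basis_vec_def inner_axis)
qed

lemma measurable_coefficients [measurable]:
  "(\<lambda>z. DV (snd z)) \<in> borel_measurable borel" "(\<lambda>z. HV (snd z)) \<in> borel_measurable borel"
  "energy V \<in> borel_measurable borel" "bump R \<in> borel_measurable (borel :: 'd phase measure)"
  by (intro borel_measurable_continuous_onI continuous_on_snd_comp[OF V] continuous_energy[OF V] continuous_bump)+

lemma measurable_matrix_vec [measurable]:
  assumes "A \<in> borel_measurable M" "x \<in> borel_measurable M"
  shows "(\<lambda>z. (A z :: real ^ 'd ^ 'd) *v x z) \<in> borel_measurable M"
proof -
  have "continuous_on UNIV (\<lambda>p :: (real ^ 'd ^ 'd) \<times> (real ^ 'd). fst p *v snd p)"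
    unfolding matrix_vector_mult_def by (intro continuous_intros)
  thus ?thesis by (rule borel_measurable_continuous_Pair[OF assms])
qed

lemma measurable_trace_HV [measurable]: "(\<lambda>z. \<Sum>j\<in>UNIV. HV (snd z) $ j $ j) \<in> borel_measurable borel"
  by (intro borel_measurable_continuous_onI continuous_intros continuous_on_snd_comp[OF V])

lemma measurable_snd_phase [measurable]: "(\<lambda>z. snd z) \<in> borel_measurable (borel :: 'd phase measure)"
  by (intro borel_measurable_continuous_onI continuous_intros)

lemma measurable_green_density [measurable]: "green_density R \<in> borel_measurable borel"
  unfolding green_density_def by measurable

lemma measurable_jump_density [measurable]: "jump_density \<in> borel_measurable borel"
proof -
  have "integrable (nu V) jump_density"
    using jump by (simp add: set_integrable_def jump_density_def[abs_def])
  thus ?thesis by (auto dest: borel_measurable_integrable simp: nu_def)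
qed

lemma integrable_jump_density: "integrable (nu V) jump_density"
  using jump by (simp add: set_integrable_def jump_density_def[abs_def])

lemma integral_mu:
  fixes f :: "'d phase \<Rightarrow> real"
  assumes [measurable]: "f \<in> borel_measurable borel"
  shows "integrable (mu V) f \<longleftrightarrow> integrable lborel (\<lambda>z. exp (- energy V z) * f z)"
    "(LINT z|mu V. f z) = (LINT z|lborel. exp (- energy V z) * f z)"
  unfolding mu_def by (subst integrable_density integral_density; simp)+

lemma integral_nu:
  fixes f :: "'d phase \<Rightarrow> real"
  assumes [measurable]: "f \<in> borel_measurable borel"
  shows "(LINT z|nu V. f z) = (LINT z|surface_measure. exp (- energy V z) * f z)"
  unfolding nu_def by (subst integral_density; simp)

lemma flux_sum:
  "(\<Sum>i\<in>UNIV. \<Sum>j\<in>UNIV. 2 * (g z $ i) * (hgrad \<T> (\<lambda>y. g y $ i) z \<bullet> xdir j) * flux V DV R j z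
      + (g z $ i)\<^sup>2 * flux' V DV HV R j z) = exp (- energy V z) * green_density R z"
proof -
  have "(\<Sum>i\<in>UNIV. \<Sum>j\<in>UNIV. 2 * (g z $ i) * (hgrad \<T> (\<lambda>y. g y $ i) z \<bullet> xdir j) * flux V DV R j z
      + (g z $ i)\<^sup>2 * flux' V DV HV R j z)
    = (\<Sum>i\<in>UNIV. \<Sum>j\<in>UNIV. 2 * (g z $ i) * Gx z $ i $ j * flux V DV R j z)
      + (\<Sum>i\<in>UNIV. (g z $ i)\<^sup>2) * (\<Sum>j\<in>UNIV. flux' V DV HV R j z)"
    by (simp add: sum.distrib Gx_component sum_product)
  also have "(\<Sum>i\<in>UNIV. \<Sum>j\<in>UNIV. 2 * (g z $ i) * Gx z $ i $ j * flux V DV R j z)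
      = exp (- energy V z) * (2 * (bump R z)\<^sup>2 * (g z \<bullet> (Gx z *v DV (snd z))))"
    by (simp add: inner_vec_def matrix_vector_mult_def flux_def[OF V] sum_distrib_left mult_ac)
  also have "(\<Sum>i\<in>UNIV. (g z $ i)\<^sup>2) = (norm (g z))\<^sup>2"
    by (rule norm_vec_square[symmetric])
  also have "(\<Sum>j\<in>UNIV. flux' V DV HV R j z) = exp (- energy V z) * (- 4 * bump R z * (snd z \<bullet> DV (snd z)) / R\<^sup>2
        + (bump R z)\<^sup>2 * ((\<Sum>j\<in>UNIV. HV (snd z) $ j $ j) - (norm (DV (snd z)))\<^sup>2))"
    unfolding flux'_def[OF V] sum_distrib_left[symmetric] sum.distrib sum_subtractf
    by (simp add: norm_vec_square inner_vec_def sum_distrib_left sum_divide_distrib mult_ac sum_negf)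
  finally show ?thesis by (simp add: green_density_def algebra_simps)
qed

text \<open>One instance of \<open>mesh_green\<close> for every component i and direction j, so that
  only scalar traces occur. Summation turns the squared components into |tr|^2 and the directions
  into the x-part of the normal times DV; points where more than two elements meet lie in a null
  set.\<close>

lemma green_identity:
  assumes R: "0 < R"
  shows "integrable (mu V) (green_density R)"
    and "(LINT z|mu V. green_density R z) = 2 * (LINT z|nu V. (bump R z)\<^sup>2 * jump_density z)"
proof -
  let ?L = "\<lambda>i j z. 2 * (g z $ i) * (hgrad \<T> (\<lambda>y. g y $ i) z \<bullet> xdir j) * flux V DV R j z
      + (g z $ i)\<^sup>2 * flux' V DV HV R j z"
  let ?S = "\<lambda>i j z. \<Sum>T\<in>{T \<in> \<T>. z \<in> frontier T}. (tr T z $ i)\<^sup>2 * (flux V DV R j z * (outward_normal T z \<bullet> xdir j))"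
  have mg: "integrable lborel (?L i j)" "integrable surface_measure (?S i j)"
    "(LINT z|lborel. ?L i j z) = (LINT z|surface_measure. ?S i j z)" for i j
    by (rule mesh_green[OF mesh DIM_phase measurable_component measurable_hgrad trace norm_xdir DERIV_flux[OF V]
        continuous_flux(1)[OF V R] flux_outside[OF V R] continuous_flux(2)[OF V R] R]; assumption)+
  have iL: "integrable lborel (\<lambda>z. \<Sum>i\<in>UNIV. \<Sum>j\<in>UNIV. ?L i j z)"
    by (intro Bochner_Integration.integrable_sum mg)
  thus "integrable (mu V) (green_density R)"
    unfolding flux_sum by (subst integral_mu(1)) auto
  have iS: "integrable surface_measure (\<lambda>z. \<Sum>i\<in>UNIV. \<Sum>j\<in>UNIV. ?S i j z)"
    by (intro Bochner_Integration.integrable_sum mg)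
  have Seq: "(\<Sum>i\<in>UNIV. \<Sum>j\<in>UNIV. ?S i j z) = exp (- energy V z) * (bump R z)\<^sup>2 *
      (\<Sum>T\<in>{T \<in> \<T>. z \<in> frontier T}. (norm (tr T z))\<^sup>2 * (snd (outward_normal T z) \<bullet> DV (snd z)))" for z
  proof -
    have "(\<Sum>i\<in>UNIV. \<Sum>j\<in>UNIV. ?S i j z) = (\<Sum>T\<in>{T \<in> \<T>. z \<in> frontier T}.
        \<Sum>i\<in>UNIV. \<Sum>j\<in>UNIV. (tr T z $ i)\<^sup>2 * (flux V DV R j z * (outward_normal T z \<bullet> xdir j)))"
      by (simp add: sum.swap[of _ _ "{T \<in> \<T>. z \<in> frontier T}"])
    also have "\<dots> = (\<Sum>T\<in>{T \<in> \<T>. z \<in> frontier T}. exp (- energy V z) * (bump R z)\<^sup>2 *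
        ((norm (tr T z))\<^sup>2 * (snd (outward_normal T z) \<bullet> DV (snd z))))"
    proof (rule sum.cong)
      fix T
      have "(\<Sum>i\<in>UNIV. \<Sum>j\<in>UNIV. (tr T z $ i)\<^sup>2 * (flux V DV R j z * (outward_normal T z \<bullet> xdir j)))
        = (\<Sum>i\<in>UNIV. (tr T z $ i)\<^sup>2) * (\<Sum>j\<in>UNIV. flux V DV R j z * (snd (outward_normal T z) $ j))"
        by (simp add: sum_product inner_xdir)
      also have "(\<Sum>i\<in>UNIV. (tr T z $ i)\<^sup>2) = (norm (tr T z))\<^sup>2"
        by (rule norm_vec_square[symmetric])
      also have "(\<Sum>j\<in>UNIV. flux V DV R j z * (snd (outward_normal T z) $ j))
        = exp (- energy V z) * (bump R z)\<^sup>2 * (snd (outward_normal T z) \<bullet> DV (snd z))"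
        by (simp add: flux_def[OF V] inner_vec_def sum_distrib_left mult_ac)
      finally show "(\<Sum>i\<in>UNIV. \<Sum>j\<in>UNIV. (tr T z $ i)\<^sup>2 * (flux V DV R j z * (outward_normal T z \<bullet> xdir j)))
        = exp (- energy V z) * (bump R z)\<^sup>2 * ((norm (tr T z))\<^sup>2 * (snd (outward_normal T z) \<bullet> DV (snd z)))"
        by (simp add: mult_ac)
    qed simp
    finally show ?thesis by (simp add: sum_distrib_left)
  qed
  obtain N where N: "N \<in> null_sets surface_measure"
    and two: "\<And>z. z \<in> skeleton \<T> - N \<Longrightarrow> \<exists>T1 T2. T1 \<noteq> T2 \<and> {T \<in> \<T>. z \<in> frontier T} = {T1, T2}
        \<and> outward_normal T2 z = - outward_normal T1 z"
    using mesh_skeleton_two_elements[OF mesh DIM_phase] by meson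
  have pt: "(\<Sum>i\<in>UNIV. \<Sum>j\<in>UNIV. ?S i j z) = exp (- energy V z) * (2 * ((bump R z)\<^sup>2 * jump_density z))"
    if z: "z \<notin> N" for z
  proof (cases "z \<in> skeleton \<T>")
    case True
    hence "z \<in> skeleton \<T> - N" using z by simp
    from two[OF this] obtain T1 T2 where T12: "{T \<in> \<T>. z \<in> frontier T} = {T1, T2}" "T1 \<noteq> T2"
        "outward_normal T2 z = - outward_normal T1 z" by metis
    show ?thesis unfolding Seq two_element_jump[OF T12] using True by (simp add: jump_density_def)
  next
    case False
    hence "{T \<in> \<T>. z \<in> frontier T} = {}" by (auto simp: skeleton_def)
    thus ?thesis using False by (simp only: jump_density_def indicator_simps) simp
  qed
  have ae: "AE z in surface_measure. (\<Sum>i\<in>UNIV. \<Sum>j\<in>UNIV. ?S i j z) = exp (- energy V z) * (2 * ((bump R z)\<^sup>2 * jump_density z))"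
    by (rule AE_I'[OF N]) (use pt in blast)
  have "(LINT z|mu V. green_density R z) = (LINT z|lborel. (\<Sum>i\<in>UNIV. \<Sum>j\<in>UNIV. ?L i j z))"
    unfolding flux_sum by (rule integral_mu(2)) measurable
  also have "\<dots> = (\<Sum>i\<in>UNIV. \<Sum>j\<in>UNIV. (LINT z|lborel. ?L i j z))"
    using mg(1) by (simp add: Bochner_Integration.integral_sum Bochner_Integration.integrable_sum)
  also have "\<dots> = (\<Sum>i\<in>UNIV. \<Sum>j\<in>UNIV. (LINT z|surface_measure. ?S i j z))" by (simp only: mg(3))
  also have "\<dots> = (LINT z|surface_measure. (\<Sum>i\<in>UNIV. \<Sum>j\<in>UNIV. ?S i j z))"
    using mg(2) by (simp add: Bochner_Integration.integral_sum Bochner_Integration.integrable_sum)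
  also have "\<dots> = (LINT z|surface_measure. exp (- energy V z) * (2 * ((bump R z)\<^sup>2 * jump_density z)))"
    using ae by (intro integral_cong_AE borel_measurable_integrable[OF iS]) auto
  also have "\<dots> = (LINT z|nu V. 2 * ((bump R z)\<^sup>2 * jump_density z))"
    by (rule integral_nu[symmetric]) measurable
  finally show "(LINT z|mu V. green_density R z) = 2 * (LINT z|nu V. (bump R z)\<^sup>2 * jump_density z)" by simp
qed

end

section \<open>Removing the cut-off\<close>


lemma norm_matrix_square: "(norm (A :: real ^ 'n ^ 'm))\<^sup>2 = (\<Sum>i\<in>UNIV. (norm (A $ i))\<^sup>2)"
  by (simp add: norm_vec_def[of A] L2_set_def sum_nonneg)

lemma norm_matrix_vec_le: "norm ((A :: real ^ 'n ^ 'm) *v x) \<le> norm A * norm x"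
proof (rule power2_le_imp_le)
  have "(norm (A *v x))\<^sup>2 = (\<Sum>i\<in>UNIV. (A $ i \<bullet> x)\<^sup>2)"
    by (simp add: norm_vec_square matrix_vector_mult_def inner_vec_def)
  also have "\<dots> \<le> (\<Sum>i\<in>UNIV. (norm (A $ i))\<^sup>2 * (norm x)\<^sup>2)"
    by (intro sum_mono) (metis Cauchy_Schwarz_ineq power2_norm_eq_inner)
  also have "\<dots> = (norm A * norm x)\<^sup>2"
    by (simp add: norm_matrix_square power_mult_distrib sum_distrib_right)
  finally show "(norm (A *v x))\<^sup>2 \<le> (norm A * norm x)\<^sup>2" .
qed simp

text \<open>Cauchy-Schwarz for the diagonal and the all-ones vector; every sqrt d in the constants
  originates here.\<close>

lemma abs_trace_le: "\<bar>\<Sum>j\<in>UNIV. (A :: real ^ 'n ^ 'n) $ j $ j\<bar> \<le> sqrt (real CARD('n)) * norm A"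
proof -
  let ?e = "(\<chi> j. 1) :: real ^ 'n" and ?a = "(\<chi> j. A $ j $ j) :: real ^ 'n"
  have "(\<Sum>j\<in>UNIV. A $ j $ j) = ?e \<bullet> ?a" by (simp add: inner_vec_def)
  hence "\<bar>\<Sum>j\<in>UNIV. A $ j $ j\<bar> \<le> norm ?e * norm ?a" by (simp add: Cauchy_Schwarz_ineq2)
  also have "(norm ?e)\<^sup>2 = real CARD('n)" by (simp add: norm_vec_square)
  hence "norm ?e = sqrt (real CARD('n))" by (metis norm_ge_zero real_sqrt_unique)
  also have "norm ?a \<le> norm A"
  proof (rule power2_le_imp_le)
    have "(A $ j $ j)\<^sup>2 \<le> (norm (A $ j))\<^sup>2" for j
      using component_le_norm_cart[of "A $ j" j] by (metis abs_ge_zero power2_abs power_mono)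
    thus "(norm ?a)\<^sup>2 \<le> (norm A)\<^sup>2" unfolding norm_vec_square norm_matrix_square by (simp add: sum_mono)
  qed simp
  finally show ?thesis by (simp add: mult_left_mono)
qed

lemma L2_sq_eq_integral:
  assumes "integrable M (\<lambda>z. (norm (f z))\<^sup>2)"
  shows "L2_sq M f = ennreal (LINT z|M. (norm (f z))\<^sup>2)"
  unfolding L2_sq_def using assms by (rule nn_integral_eq_integral) simp

lemma integrable_L2_sq:
  assumes [measurable]: "f \<in> borel_measurable M" and "L2_sq M f < \<infinity>"
  shows "integrable M (\<lambda>z. (norm (f z))\<^sup>2)"
  using assms(2) unfolding L2_sq_def by (intro integrableI_nonneg) auto

lemma bump_square_mult_le: "\<bar>(bump R z)\<^sup>2 * x\<bar> \<le> \<bar>x\<bar>"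
proof -
  have "(bump R z)\<^sup>2 \<le> 1" using bump_nonneg bump_le_1 by (rule power_le_one)
  thus ?thesis by (simp add: abs_mult mult_left_le_one_le)
qed

lemma sets_mu [simp, measurable_cong]: "sets (mu V) = sets borel"
  by (simp add: mu_def)

lemma sets_nu [simp, measurable_cong]: "sets (nu V) = sets borel"
  by (simp add: nu_def)

context broken_field
begin

lemma integrable_g: "integrable (mu V) (\<lambda>z. (norm (g z))\<^sup>2)"
proof -
  have "integrable (mu V) (\<lambda>z. (norm (g z $ i))\<^sup>2)" for i
    using H1[of i] measurable_component[of i] by (intro integrable_L2_sq) (auto simp: H1_broken_def)
  hence "integrable (mu V) (\<lambda>z. \<Sum>i\<in>UNIV. (norm (g z $ i))\<^sup>2)" by (intro Bochner_Integration.integrable_sum)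
  thus ?thesis by (simp add: norm_vec_square)
qed

lemma inner_Gx_le: "\<bar>g z \<bullet> (Gx z *v DV (snd z))\<bar> \<le> norm (g z) * norm (Gx z) * norm (DV (snd z))"
proof -
  have "\<bar>g z \<bullet> (Gx z *v DV (snd z))\<bar> \<le> norm (g z) * norm (Gx z *v DV (snd z))" by (rule Cauchy_Schwarz_ineq2)
  also have "\<dots> \<le> norm (g z) * (norm (Gx z) * norm (DV (snd z)))"
    by (intro mult_left_mono norm_matrix_vec_le) simp
  finally show ?thesis by (simp add: mult.assoc)
qed

text \<open>On the support |x| is at most R, so |x| / R^2 is at most 1 / R. The decay in R is given
  up, since a uniform bound suffices; the remaining factor \<open>bump\<close> lets the coercive
  term absorb this one.\<close>

lemma bump_drift_le:
  assumes "1 \<le> R"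
  shows "\<bar>- 4 * bump R z * (snd z \<bullet> DV (snd z)) / R\<^sup>2\<bar> \<le> 4 * bump R z * norm (DV (snd z))"
proof (cases "norm z \<le> R")
  case True
  have "\<bar>snd z \<bullet> DV (snd z)\<bar> \<le> norm (snd z) * norm (DV (snd z))" by (rule Cauchy_Schwarz_ineq2)
  also have "\<dots> \<le> R * norm (DV (snd z))"
    using True norm_snd_le[of "snd z" "fst z"] by (intro mult_right_mono) auto
  also have "\<dots> \<le> R\<^sup>2 * norm (DV (snd z))"
    using assms by (intro mult_right_mono) (auto simp: power2_eq_square)
  finally have "\<bar>snd z \<bullet> DV (snd z)\<bar> / R\<^sup>2 \<le> norm (DV (snd z))"
    using assms by (simp add: pos_divide_le_eq mult.commute)
  hence "4 * bump R z * (\<bar>snd z \<bullet> DV (snd z)\<bar> / R\<^sup>2) \<le> 4 * bump R z * norm (DV (snd z))"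
    using bump_nonneg by (intro mult_left_mono) auto
  thus ?thesis using bump_nonneg[of R z] by (simp add: abs_mult)
qed (use assms in \<open>simp add: bump_outside\<close>)

definition full_density :: "'d phase \<Rightarrow> real" where
  "full_density z = 2 * (g z \<bullet> (Gx z *v DV (snd z)))
     + (norm (g z))\<^sup>2 * ((\<Sum>j\<in>UNIV. HV (snd z) $ j $ j) - (norm (DV (snd z)))\<^sup>2)"

lemma measurable_full_density [measurable]: "full_density \<in> borel_measurable borel"
  unfolding full_density_def by measurable

end

text \<open>\<open>s\<close> bounds the Laplacian of V relative to 1 + |DV|. Finiteness of the
  gradient norm is no loss: otherwise the right-hand side of the final estimate is infinite, see
  \<open>weighted_bound\<close>.\<close>

locale broken_field_growth = broken_field V DV HV \<T> g tr
  for V :: "real ^ 'd::finite \<Rightarrow> real" and DV :: "real ^ 'd \<Rightarrow> real ^ 'd" and HV :: "real ^ 'd \<Rightarrow> real ^ 'd ^ 'd"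
    and \<T> :: "'d phase set set" and g :: "'d phase \<Rightarrow> real ^ 'd" and tr :: "'d phase set \<Rightarrow> 'd phase \<Rightarrow> real ^ 'd" +
  fixes C0 s :: real
  assumes s_def: "s = sqrt (real CARD('d)) * C0" and C0: "0 < C0" and growth: "\<And>x. norm (HV x) \<le> C0 * (1 + norm (DV x))"
    and finite_Gx: "L2_sq (mu V) Gx < \<infinity>"
begin



lemma s_nonneg: "0 \<le> s" using C0 by (simp add: s_def)

lemma trace_HV_le: "\<bar>\<Sum>j\<in>UNIV. HV x $ j $ j\<bar> \<le> s * (1 + norm (DV x))"
proof -
  have "\<bar>\<Sum>j\<in>UNIV. HV x $ j $ j\<bar> \<le> sqrt (real CARD('d)) * norm (HV x)" by (rule abs_trace_le)
  also have "\<dots> \<le> sqrt (real CARD('d)) * (C0 * (1 + norm (DV x)))" by (intro mult_left_mono growth) simp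
  finally show ?thesis by (simp add: s_def mult.assoc)
qed

lemma integrable_Gx: "integrable (mu V) (\<lambda>z. (norm (Gx z))\<^sup>2)"
  using finite_Gx by (intro integrable_L2_sq) auto

text \<open>The cross term, the drift of the cut-off and the Laplacian each use up a quarter of m^2
  p^2 a^2 by Young's inequality. The last quarter is what remains on the left, whence the factor 4;
  the constants 4 b^2, 16 and s + s^2 are the other halves of the three Young inequalities.\<close>

lemma green_density_coercive:
  assumes R: "1 \<le> R"
  shows "(bump R z)\<^sup>2 * (norm (DV (snd z)))\<^sup>2 * (norm (g z))\<^sup>2
    \<le> 4 * (- green_density R z + (s + s\<^sup>2 + 16) * (norm (g z))\<^sup>2 + 4 * (norm (Gx z))\<^sup>2)"
proof -
  define m p a b where "m = bump R z" and "p = norm (DV (snd z))" and "a = norm (g z)" and "b = norm (Gx z)"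
  define D where "D = - 4 * bump R z * (snd z \<bullet> DV (snd z)) / R\<^sup>2"
  define t where "t = (\<Sum>j\<in>UNIV. HV (snd z) $ j $ j)"
  define I where "I = g z \<bullet> (Gx z *v DV (snd z))"
  have m: "0 \<le> m" "m \<le> 1" by (auto simp: m_def bump_nonneg bump_le_1)
  have m2: "m\<^sup>2 \<le> 1" using m by (simp add: power_le_one)
  have p: "0 \<le> p" by (simp add: p_def)
  have I: "I \<le> a * b * p" using inner_Gx_le[of z] by (simp add: I_def a_def b_def p_def)
  have "2 * I \<le> p\<^sup>2 * a\<^sup>2 / 4 + 4 * b\<^sup>2"
    using I zero_le_power2[of "p * a / 2 - 2 * b"] by (simp add: power2_eq_square algebra_simps)
  hence "m\<^sup>2 * (2 * I) \<le> m\<^sup>2 * (p\<^sup>2 * a\<^sup>2 / 4 + 4 * b\<^sup>2)" by (intro mult_left_mono) auto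
  also have "\<dots> \<le> m\<^sup>2 * p\<^sup>2 * a\<^sup>2 / 4 + 4 * b\<^sup>2"
    using mult_right_mono[OF m2, of "4 * b\<^sup>2"] by (simp add: algebra_simps)
  finally have 1: "2 * m\<^sup>2 * I \<le> m\<^sup>2 * p\<^sup>2 * a\<^sup>2 / 4 + 4 * b\<^sup>2" by simp
  have "D \<le> 4 * m * p" using bump_drift_le[OF R, of z] unfolding D_def m_def p_def by linarith
  also have "\<dots> \<le> m\<^sup>2 * p\<^sup>2 / 4 + 16"
    using zero_le_power2[of "m * p / 2 - 4"] by (simp add: power2_eq_square algebra_simps)
  finally have 2: "D \<le> m\<^sup>2 * p\<^sup>2 / 4 + 16" .
  have "t \<le> s * (1 + p)" using trace_HV_le[of "snd z"] by (simp add: t_def p_def)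
  also have "\<dots> \<le> s + s\<^sup>2 + p\<^sup>2 / 4"
    using zero_le_power2[of "p / 2 - s"] by (simp add: power2_eq_square algebra_simps)
  finally have "m\<^sup>2 * t \<le> m\<^sup>2 * (s + s\<^sup>2 + p\<^sup>2 / 4)" by (intro mult_left_mono) auto
  also have "\<dots> \<le> s + s\<^sup>2 + m\<^sup>2 * p\<^sup>2 / 4"
    using mult_right_mono[OF m2, of "s + s\<^sup>2"] s_nonneg by (simp add: algebra_simps)
  finally have 3: "m\<^sup>2 * t \<le> s + s\<^sup>2 + m\<^sup>2 * p\<^sup>2 / 4" .
  have "a\<^sup>2 * (D + m\<^sup>2 * (t - p\<^sup>2)) \<le> a\<^sup>2 * (16 + s + s\<^sup>2 - m\<^sup>2 * p\<^sup>2 / 2)"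
    using 2 3 by (intro mult_left_mono) (auto simp: algebra_simps)
  hence "2 * m\<^sup>2 * I + a\<^sup>2 * (D + m\<^sup>2 * (t - p\<^sup>2)) \<le> (s + s\<^sup>2 + 16) * a\<^sup>2 + 4 * b\<^sup>2 - m\<^sup>2 * p\<^sup>2 * a\<^sup>2 / 4"
    using 1 by (simp add: algebra_simps)
  moreover have "green_density R z = 2 * m\<^sup>2 * I + a\<^sup>2 * (D + m\<^sup>2 * (t - p\<^sup>2))"
    by (simp add: green_density_def m_def I_def a_def D_def t_def p_def)
  ultimately show ?thesis by (simp add: m_def p_def a_def b_def)
qed

text \<open>Integrating the coercive estimate bounds the truncated integrals uniformly in the
  radius, because the jump density is integrable and the cut-off is at most 1. Fatou's lemma then
  removes the cut-off.\<close>

lemma integrable_DV_g: "integrable (mu V) (\<lambda>z. (norm (DV (snd z)))\<^sup>2 * (norm (g z))\<^sup>2)"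
proof -
  define K where "K = (LINT z|nu V. \<bar>jump_density z\<bar>)"
  define B where "B = 4 * (2 * K + (s + s\<^sup>2 + 16) * (LINT z|mu V. (norm (g z))\<^sup>2) + 4 * (LINT z|mu V. (norm (Gx z))\<^sup>2))"
  define f where "f n z = (bump (real (Suc n)) z)\<^sup>2 * (norm (DV (snd z)))\<^sup>2 * (norm (g z))\<^sup>2" for n z
  have fm[measurable]: "f n \<in> borel_measurable borel" for n unfolding f_def by measurable
  have bound: "(\<integral>\<^sup>+z. ennreal (f n z) \<partial>mu V) \<le> ennreal B" for n
  proof -
    let ?R = "real (Suc n)"
    have R: "1 \<le> ?R" by simp
    let ?h = "\<lambda>z. 4 * (- green_density ?R z + (s + s\<^sup>2 + 16) * (norm (g z))\<^sup>2 + 4 * (norm (Gx z))\<^sup>2)"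
    have G: "integrable (mu V) (green_density ?R)" by (rule green_identity(1)) simp
    have ih: "integrable (mu V) ?h" using G integrable_g integrable_Gx by simp
    have fh: "0 \<le> f n z" "f n z \<le> ?h z" for z
      using green_density_coercive[OF R, of z] by (simp_all add: f_def)
    have J: "integrable (nu V) (\<lambda>z. (bump ?R z)\<^sup>2 * jump_density z)"
    proof (rule Bochner_Integration.integrable_bound[OF integrable_jump_density])
      show "AE z in nu V. norm ((bump ?R z)\<^sup>2 * jump_density z) \<le> norm (jump_density z)"
        by (intro AE_I2) (simp only: real_norm_def bump_square_mult_le)
    qed measurable
    have "\<bar>LINT z|nu V. (bump ?R z)\<^sup>2 * jump_density z\<bar> \<le> (LINT z|nu V. \<bar>(bump ?R z)\<^sup>2 * jump_density z\<bar>)"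
      by (rule integral_abs_bound)
    also have "\<dots> \<le> K" unfolding K_def
      using J integrable_jump_density by (intro integral_mono integrable_abs bump_square_mult_le)
    finally have "- (LINT z|mu V. green_density ?R z) \<le> 2 * K"
      using green_identity(2)[of ?R] by simp
    moreover have "(LINT z|mu V. ?h z) = 4 * (- (LINT z|mu V. green_density ?R z)
        + (s + s\<^sup>2 + 16) * (LINT z|mu V. (norm (g z))\<^sup>2) + 4 * (LINT z|mu V. (norm (Gx z))\<^sup>2))"
      using G integrable_g integrable_Gx by simp
    ultimately have "(LINT z|mu V. ?h z) \<le> B" by (simp add: B_def)
    have "(\<integral>\<^sup>+z. ennreal (f n z) \<partial>mu V) \<le> (\<integral>\<^sup>+z. ennreal (?h z) \<partial>mu V)"
      using fh by (intro nn_integral_mono ennreal_leI)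
    also have "\<dots> = ennreal (LINT z|mu V. ?h z)"
      using ih fh order_trans by (intro nn_integral_eq_integral) (blast intro: AE_I2)+
    also have "\<dots> \<le> ennreal B" using \<open>_ \<le> B\<close> by (rule ennreal_leI)
    finally show ?thesis .
  qed
  have lim: "(\<lambda>n. f n z) \<longlonglongrightarrow> (norm (DV (snd z)))\<^sup>2 * (norm (g z))\<^sup>2" for z
  proof -
    have "(\<lambda>n. f n z) \<longlonglongrightarrow> 1\<^sup>2 * (norm (DV (snd z)))\<^sup>2 * (norm (g z))\<^sup>2"
      unfolding f_def by (intro tendsto_intros bump_tendsto)
    thus ?thesis by simp
  qed
  have "(\<integral>\<^sup>+z. ennreal ((norm (DV (snd z)))\<^sup>2 * (norm (g z))\<^sup>2) \<partial>mu V)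
      = (\<integral>\<^sup>+z. liminf (\<lambda>n. ennreal (f n z)) \<partial>mu V)"
    by (intro nn_integral_cong lim_imp_Liminf[symmetric] tendsto_ennrealI lim) simp
  also have "\<dots> \<le> liminf (\<lambda>n. \<integral>\<^sup>+z. ennreal (f n z) \<partial>mu V)"
    by (rule nn_integral_liminf) measurable
  also have "\<dots> \<le> liminf (\<lambda>n::nat. ennreal B)"
    using bound by (intro Liminf_mono always_eventually) auto
  also have "\<dots> = ennreal B" by (rule Liminf_const) simp
  also have "\<dots> < \<infinity>" by simp
  finally have fin: "(\<integral>\<^sup>+z. ennreal ((norm (DV (snd z)))\<^sup>2 * (norm (g z))\<^sup>2) \<partial>mu V) < \<infinity>" .
  show ?thesis by (rule integrableI_nonneg) (measurable, simp, use fin in simp)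
qed

lemma full_identity:
  "integrable (mu V) full_density" "(LINT z|mu V. full_density z) = 2 * (LINT z|nu V. jump_density z)"
proof -
  \<comment> \<open>The majorant uses p \<le> 1 + p^2 throughout: the drift 4 p becomes 4 + 4 p^2,
    the Laplacian s (1 + p) becomes s (2 + p^2), and one further p^2 comes from the weight.\<close>
  define D where "D z = 2 * ((norm (DV (snd z)))\<^sup>2 * (norm (g z))\<^sup>2 + (norm (Gx z))\<^sup>2)
    + (4 + 2 * s) * (norm (g z))\<^sup>2 + (5 + s) * ((norm (DV (snd z)))\<^sup>2 * (norm (g z))\<^sup>2)" for z
  have iD: "integrable (mu V) D"
    unfolding D_def using integrable_DV_g integrable_g integrable_Gx by simp
  have dom: "norm (green_density (real (Suc n)) z) \<le> D z" for n z
  proof -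
    let ?R = "real (Suc n)"
    define m p a b where "m = bump ?R z" and "p = norm (DV (snd z))" and "a = norm (g z)" and "b = norm (Gx z)"
    define E where "E = - 4 * bump ?R z * (snd z \<bullet> DV (snd z)) / ?R\<^sup>2"
    define t where "t = (\<Sum>j\<in>UNIV. HV (snd z) $ j $ j)"
    define I where "I = g z \<bullet> (Gx z *v DV (snd z))"
    have m: "0 \<le> m" "m \<le> 1" by (auto simp: m_def bump_nonneg bump_le_1)
    have m2: "0 \<le> m\<^sup>2" "m\<^sup>2 \<le> 1" using m by (auto simp: power_le_one)
    have p0: "0 \<le> p" by (simp add: p_def)
    have "2 * p \<le> 1 + p\<^sup>2" using zero_le_power2[of "p - 1"] by (simp add: power2_eq_square algebra_simps)
    with p0 have p: "0 \<le> p" "p \<le> 1 + p\<^sup>2" by linarith+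
    have "\<bar>I\<bar> \<le> a * b * p" using inner_Gx_le[of z] by (simp add: I_def a_def b_def p_def)
    also have "\<dots> \<le> p\<^sup>2 * a\<^sup>2 + b\<^sup>2"
    proof -
      have "2 * (a * b * p) \<le> p\<^sup>2 * a\<^sup>2 + b\<^sup>2"
        using zero_le_power2[of "p * a - b"] by (simp add: power2_eq_square algebra_simps)
      moreover have "0 \<le> p\<^sup>2 * a\<^sup>2 + b\<^sup>2" by simp
      ultimately show ?thesis by linarith
    qed
    finally have I: "m\<^sup>2 * \<bar>I\<bar> \<le> p\<^sup>2 * a\<^sup>2 + b\<^sup>2"
      using mult_left_le_one_le[of "\<bar>I\<bar>" "m\<^sup>2"] m2 by linarith
    have "\<bar>E\<bar> \<le> 4 * m * p" using bump_drift_le[of ?R z] by (simp add: E_def m_def p_def)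
    also have "\<dots> \<le> 4 * p" using m p mult_left_le_one_le[of p m] by linarith
    finally have E: "\<bar>E\<bar> \<le> 4 * p" .
    have "\<bar>t\<bar> \<le> s * (1 + p)" using trace_HV_le[of "snd z"] by (simp add: t_def p_def)
    hence "\<bar>t - p\<^sup>2\<bar> \<le> s * (1 + p) + p\<^sup>2" using abs_triangle_ineq4[of t "p\<^sup>2"] by simp
    hence T: "m\<^sup>2 * \<bar>t - p\<^sup>2\<bar> \<le> s * (1 + p) + p\<^sup>2"
      using mult_left_le_one_le[of "\<bar>t - p\<^sup>2\<bar>" "m\<^sup>2"] m2 by linarith
    have sp: "s * (1 + p) \<le> s * (2 + p\<^sup>2)" using p s_nonneg by (intro mult_left_mono) auto
    have "\<bar>E + m\<^sup>2 * (t - p\<^sup>2)\<bar> \<le> \<bar>E\<bar> + \<bar>m\<^sup>2 * (t - p\<^sup>2)\<bar>" by (rule abs_triangle_ineq)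
    also have "\<bar>m\<^sup>2 * (t - p\<^sup>2)\<bar> = m\<^sup>2 * \<bar>t - p\<^sup>2\<bar>" by (simp add: abs_mult)
    finally have "\<bar>E + m\<^sup>2 * (t - p\<^sup>2)\<bar> \<le> 4 + 2 * s + (5 + s) * p\<^sup>2"
      using E T sp p by (simp add: algebra_simps)
    hence 1: "a\<^sup>2 * \<bar>E + m\<^sup>2 * (t - p\<^sup>2)\<bar> \<le> a\<^sup>2 * (4 + 2 * s + (5 + s) * p\<^sup>2)" by (intro mult_left_mono) auto
    have "green_density ?R z = 2 * (m\<^sup>2 * I) + a\<^sup>2 * (E + m\<^sup>2 * (t - p\<^sup>2))"
      by (simp add: green_density_def m_def I_def a_def E_def t_def p_def)
    hence "\<bar>green_density ?R z\<bar> \<le> \<bar>2 * (m\<^sup>2 * I)\<bar> + \<bar>a\<^sup>2 * (E + m\<^sup>2 * (t - p\<^sup>2))\<bar>" by simp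
    hence "\<bar>green_density ?R z\<bar> \<le> 2 * (m\<^sup>2 * \<bar>I\<bar>) + a\<^sup>2 * \<bar>E + m\<^sup>2 * (t - p\<^sup>2)\<bar>" by (simp add: abs_mult)
    also have "\<dots> \<le> 2 * (p\<^sup>2 * a\<^sup>2 + b\<^sup>2) + a\<^sup>2 * (4 + 2 * s + (5 + s) * p\<^sup>2)"
      using I by (intro add_mono 1) simp
    finally have "\<bar>green_density ?R z\<bar> \<le> 2 * (p\<^sup>2 * a\<^sup>2 + b\<^sup>2) + a\<^sup>2 * (4 + 2 * s + (5 + s) * p\<^sup>2)" .
    thus ?thesis by (simp add: D_def p_def a_def b_def algebra_simps)
  qed
  have lim: "(\<lambda>n. green_density (real (Suc n)) z) \<longlonglongrightarrow> full_density z" for z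
  proof -
    have "(\<lambda>n. green_density (real (Suc n)) z) \<longlonglongrightarrow> 2 * 1\<^sup>2 * (g z \<bullet> (Gx z *v DV (snd z)))
       + (norm (g z))\<^sup>2 * (- 4 * 1 * (snd z \<bullet> DV (snd z)) * 0\<^sup>2
        + 1\<^sup>2 * ((\<Sum>j\<in>UNIV. HV (snd z) $ j $ j) - (norm (DV (snd z)))\<^sup>2))"
      unfolding green_density_def divide_inverse power_inverse[symmetric]
      by (intro tendsto_intros bump_tendsto LIMSEQ_inverse_real_of_nat)
    thus ?thesis by (simp add: full_density_def)
  qed
  have m1: "full_density \<in> borel_measurable (mu V)" "\<And>n. green_density (real (Suc n)) \<in> borel_measurable (mu V)"
    by measurable
  have ae1: "AE z in mu V. (\<lambda>n. green_density (real (Suc n)) z) \<longlonglongrightarrow> full_density z" using lim by simp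
  have ae2: "\<And>n. AE z in mu V. norm (green_density (real (Suc n)) z) \<le> D z" using dom by simp
  show "integrable (mu V) full_density"
    by (rule integrable_dominated_convergence[OF m1 iD ae1 ae2])
  have L1: "(\<lambda>n. LINT z|mu V. green_density (real (Suc n)) z) \<longlonglongrightarrow> (LINT z|mu V. full_density z)"
    by (rule integral_dominated_convergence[OF m1 iD ae1 ae2])
  have "(\<lambda>n. LINT z|nu V. (bump (real (Suc n)) z)\<^sup>2 * jump_density z) \<longlonglongrightarrow> (LINT z|nu V. jump_density z)"
  proof (rule integral_dominated_convergence)
    show "integrable (nu V) (\<lambda>z. \<bar>jump_density z\<bar>)" using integrable_jump_density by (rule integrable_abs)
    have "(\<lambda>n. (bump (real (Suc n)) z)\<^sup>2 * jump_density z) \<longlonglongrightarrow> 1\<^sup>2 * jump_density z" for z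
      by (intro tendsto_intros bump_tendsto)
    thus "AE z in nu V. (\<lambda>n. (bump (real (Suc n)) z)\<^sup>2 * jump_density z) \<longlonglongrightarrow> jump_density z" by simp
    show "AE z in nu V. norm ((bump (real (Suc n)) z)\<^sup>2 * jump_density z) \<le> \<bar>jump_density z\<bar>" for n
      by (intro AE_I2) (simp only: real_norm_def bump_square_mult_le)
  qed measurable
  hence "(\<lambda>n. 2 * (LINT z|nu V. (bump (real (Suc n)) z)\<^sup>2 * jump_density z)) \<longlonglongrightarrow> 2 * (LINT z|nu V. jump_density z)"
    by (intro tendsto_intros)
  hence "(\<lambda>n. LINT z|mu V. green_density (real (Suc n)) z) \<longlonglongrightarrow> 2 * (LINT z|nu V. jump_density z)"
    using green_identity(2) by simp
  thus "(LINT z|mu V. full_density z) = 2 * (LINT z|nu V. jump_density z)"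
    by (rule LIMSEQ_unique[OF L1])
qed

text \<open>A pointwise inequality is integrated. The integral of \<open>full_density\<close> is
  twice the jump integral, so the multiplier 4 c appears as 8 c in front of the jumps.\<close>

lemma L2_bound:
  assumes pt: "\<And>z. (norm (HV (snd z) *v g z))\<^sup>2 \<le> K * ((norm (g z))\<^sup>2 + (norm (Gx z))\<^sup>2) - 4 * c * full_density z"
    and K: "0 \<le> K"
  shows "enn2ereal (L2_sq (mu V) (\<lambda>z. HV (snd z) *v g z))
    \<le> ereal K * enn2ereal (L2_sq (mu V) g + L2_sq (mu V) Gx) - ereal (8 * c * (LINT z|nu V. jump_density z))"
proof -
  let ?h = "\<lambda>z. K * ((norm (g z))\<^sup>2 + (norm (Gx z))\<^sup>2) - 4 * c * full_density z"
  have ih: "integrable (mu V) ?h" using integrable_g integrable_Gx full_identity(1) by simp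
  have i: "integrable (mu V) (\<lambda>z. (norm (HV (snd z) *v g z))\<^sup>2)"
  proof (rule Bochner_Integration.integrable_bound[OF ih])
    show "AE z in mu V. norm ((norm (HV (snd z) *v g z))\<^sup>2) \<le> norm (?h z)"
      using pt by (intro AE_I2) (simp add: order_trans[OF _ abs_ge_self])
  qed measurable
  have "(LINT z|mu V. (norm (HV (snd z) *v g z))\<^sup>2) \<le> (LINT z|mu V. ?h z)"
    using i ih pt by (rule integral_mono)
  also have "\<dots> = K * ((LINT z|mu V. (norm (g z))\<^sup>2) + (LINT z|mu V. (norm (Gx z))\<^sup>2)) - 8 * c * (LINT z|nu V. jump_density z)"
    using integrable_g integrable_Gx full_identity by simp
  finally show ?thesis
    unfolding L2_sq_eq_integral[OF i] L2_sq_eq_integral[OF integrable_g] L2_sq_eq_integral[OF integrable_Gx]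
    by (simp add: ennreal_plus[symmetric] enn2ereal_ennreal del: ennreal_plus)
qed

end

section \<open>The weighted estimate\<close>


text \<open>With p for |DV|, the coefficient of C0^2 a^2 on the left is (1 + p)^2 + 4 s (1 + p) - 3
  p^2, once the cross term has cost 16 b^2 and one p^2 a^2. This is a concave parabola in p, bounded
  by its maximum 3 / 2 + 6 s + 2 s^2. The coefficients of a^2 and b^2 are bounded separately, hence
  the maximum in the constant.\<close>

lemma pointwise_growth_bound:
  fixes C0 p a b s d q t I :: real
  assumes C0: "0 < C0" and p: "0 \<le> p" and d: "1 \<le> d" and s: "s = sqrt d * C0"
    and q: "q \<le> C0 * (1 + p) * a" "0 \<le> q" and t: "\<bar>t\<bar> \<le> s * (1 + p)" and I: "\<bar>I\<bar> \<le> a * b * p"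
  shows "q\<^sup>2 \<le> max (2 * C0\<^sup>2 * (1 + 2 * sqrt d + 2 * d * C0\<^sup>2)) (16 * C0\<^sup>2) * (a\<^sup>2 + b\<^sup>2)
    - 4 * C0\<^sup>2 * (2 * I + a\<^sup>2 * (t - p\<^sup>2))"
proof -
  let ?K = "max (2 * C0\<^sup>2 * (1 + 2 * sqrt d + 2 * d * C0\<^sup>2)) (16 * C0\<^sup>2)"
  have s2: "s\<^sup>2 = d * C0\<^sup>2" using d by (simp add: s power_mult_distrib)
  have sd: "1 \<le> sqrt d" using d by simp
  have "q\<^sup>2 \<le> (C0 * (1 + p) * a)\<^sup>2" using q by (intro power_mono) auto
  hence 1: "q\<^sup>2 \<le> C0\<^sup>2 * ((1 + p)\<^sup>2 * a\<^sup>2)" by (simp add: power_mult_distrib)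
  have 2: "8 * I \<le> 16 * b\<^sup>2 + p\<^sup>2 * a\<^sup>2"
    using I zero_le_power2[of "p * a - 4 * b"] by (simp add: power2_eq_square algebra_simps)
  have "(1 + p)\<^sup>2 + 4 * t - 3 * p\<^sup>2 \<le> (1 + p)\<^sup>2 + 4 * (s * (1 + p)) - 3 * p\<^sup>2" using t by simp
  also have "(1 + p)\<^sup>2 + 4 * (s * (1 + p)) - 3 * p\<^sup>2 = 3 / 2 + 6 * s + 2 * s\<^sup>2 - 2 * (p - (1 + 2 * s) / 2)\<^sup>2"
    by (simp add: power2_eq_square field_simps)
  also have "\<dots> \<le> 3 / 2 + 6 * s + 2 * s\<^sup>2" by simp
  \<comment> \<open>The term 6 s is traded for 2 s^2 + 9 / 2, which leaves the constant 6; it fits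
    below 2 + 4 sqrt d because d is at least 1.\<close>
  also have "\<dots> \<le> 2 + 4 * sqrt d + 4 * s\<^sup>2"
  proof -
    have "3 * s \<le> s\<^sup>2 + 9 / 4" using zero_le_power2[of "s - 3 / 2"] by (simp add: power2_eq_square algebra_simps)
    thus ?thesis using sd by linarith
  qed
  finally have "a\<^sup>2 * ((1 + p)\<^sup>2 + 4 * t - 3 * p\<^sup>2) \<le> a\<^sup>2 * (2 + 4 * sqrt d + 4 * s\<^sup>2)"
    by (intro mult_left_mono) auto
  hence 3: "a\<^sup>2 * ((1 + p)\<^sup>2 + 4 * (t - p\<^sup>2)) + p\<^sup>2 * a\<^sup>2 \<le> a\<^sup>2 * (2 + 4 * sqrt d + 4 * s\<^sup>2)"
    by (simp add: algebra_simps)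
  have "C0\<^sup>2 * ((1 + p)\<^sup>2 * a\<^sup>2) + 4 * C0\<^sup>2 * (2 * I + a\<^sup>2 * (t - p\<^sup>2))
      = C0\<^sup>2 * (a\<^sup>2 * ((1 + p)\<^sup>2 + 4 * (t - p\<^sup>2)) + 8 * I)" by (simp add: algebra_simps)
  also have "\<dots> \<le> C0\<^sup>2 * (a\<^sup>2 * (2 + 4 * sqrt d + 4 * s\<^sup>2) + 16 * b\<^sup>2)"
    using 2 3 by (intro mult_left_mono) auto
  also have "\<dots> = 2 * C0\<^sup>2 * (1 + 2 * sqrt d + 2 * d * C0\<^sup>2) * a\<^sup>2 + 16 * C0\<^sup>2 * b\<^sup>2"
    by (simp add: s2 algebra_simps)
  also have "\<dots> \<le> ?K * a\<^sup>2 + ?K * b\<^sup>2" by (intro add_mono mult_right_mono) auto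
  finally show ?thesis using 1 by (simp add: algebra_simps)
qed

lemma gradient_unique:
  assumes "GDERIV f x :> D" "GDERIV f x :> D'"
  shows "D = D'"
proof -
  have "(\<lambda>h. h \<bullet> D) = (\<lambda>h. h \<bullet> D')"
    using assms unfolding gderiv_def by (rule has_derivative_unique)
  hence "(D - D') \<bullet> (D - D') = 0" by (metis inner_diff_right right_minus_eq)
  thus ?thesis by simp
qed

lemma gaussian_derivatives:
  assumes "C2_function (\<lambda>x :: real ^ 'd. (norm x)\<^sup>2 / 2) DV HV"
  shows "DV x = x" "HV x = mat 1"
proof -
  have "((\<lambda>x :: real ^ 'd. (x \<bullet> x) / 2) has_derivative (\<lambda>h. h \<bullet> x)) (at x)" for x
    by (auto intro!: derivative_eq_intros simp: inner_commute)
  hence "GDERIV (\<lambda>x :: real ^ 'd. (norm x)\<^sup>2 / 2) x :> x" for x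
    by (simp add: gderiv_def power2_norm_eq_inner)
  hence DV: "DV x = x" for x
    using assms gradient_unique unfolding C2_function_def by blast
  thus "DV x = x" .
  have "DV = (\<lambda>x. x)" using DV by auto
  moreover have "(DV has_derivative (\<lambda>h. HV x *v h)) (at x)" using assms by (simp add: C2_function_def)
  ultimately have "(\<lambda>h. HV x *v h) = (\<lambda>h. h)"
    using has_derivative_unique has_derivative_ident by blast
  hence "HV x *v h = mat 1 *v h" for h by (metis matrix_vector_mul_lid)
  thus "HV x = mat 1" by (simp add: matrix_eq)
qed

context broken_field
begin

lemma jump_integral_eq:
  "(LINT z:skeleton \<T>|nu V. avg \<T> tr z \<bullet> (jump_x \<T> tr z *v DV (snd z))) = (LINT z|nu V. jump_density z)"
  by (simp add: set_lebesgue_integral_def jump_density_def)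

text \<open>If the gradient norm is infinite, K > 0 makes the right-hand side infinite and the
  subtracted real number changes nothing. Growth of the Hessian serves only integrability; the
  constants K and c come from the pointwise inequality and are free.\<close>

lemma weighted_bound:
  assumes C0: "0 < C0" and growth: "\<And>x. norm (HV x) \<le> C0 * (1 + norm (DV x))"
    and pt: "\<And>z. (norm (HV (snd z) *v g z))\<^sup>2 \<le> K * ((norm (g z))\<^sup>2 + (norm (Gx z))\<^sup>2) - 4 * c * full_density z"
    and K: "0 < K"
  shows "enn2ereal (L2_sq (mu V) (\<lambda>z. HV (snd z) *v g z))
    \<le> ereal K * enn2ereal (L2_sq (mu V) g + L2_sq (mu V) Gx)
      - ereal (8 * c * (LINT z:skeleton \<T>|nu V. avg \<T> tr z \<bullet> (jump_x \<T> tr z *v DV (snd z))))"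
proof (cases "L2_sq (mu V) Gx < \<infinity>")
  case True
  interpret broken_field_growth V DV HV \<T> g tr C0 "sqrt (real CARD('d)) * C0"
    by unfold_locales (use True C0 growth in auto)
  show ?thesis unfolding jump_integral_eq by (rule L2_bound[OF pt]) (use K in simp)
next
  case False
  hence "L2_sq (mu V) Gx = \<infinity>" by (simp add: less_top[symmetric])
  thus ?thesis using K by simp
qed

end

text \<open>The squared norms may be infinite, which is why the estimate is stated in
  \<open>ereal\<close>. The jump term is a real number, so the right-hand side never has the form
  infinity minus infinity.\<close>

theorem lemma6p1:
  fixes V :: "real ^ 'd::finite \<Rightarrow> real"
    and DV :: "real ^ 'd \<Rightarrow> real ^ 'd"
    and HV :: "real ^ 'd \<Rightarrow> real ^ 'd ^ 'd"
    and C0 :: real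
    and \<T> :: "'d phase set set"
    and g :: "'d phase \<Rightarrow> real ^ 'd"
    and tr :: "'d phase set \<Rightarrow> 'd phase \<Rightarrow> real ^ 'd"
  assumes "mesh \<T>"
    and "C2_function V DV HV"
    and "C0 > 0"
    and "\<forall>x. norm (HV x) \<le> C0 * (1 + norm (DV x))"
    and "\<forall>i. (\<lambda>z. g z $ i) \<in> H1_broken V \<T>"
    and "\<forall>T\<in>\<T>. \<forall>i. is_trace T (\<lambda>z. g z $ i) (hgrad \<T> (\<lambda>z. g z $ i)) (\<lambda>z. tr T z $ i)"
    and "set_integrable (nu V) (skeleton \<T>)
           (\<lambda>z. avg \<T> tr z \<bullet> (jump_x \<T> tr z *v DV (snd z)))"
  shows
    "enn2ereal (L2_sq (mu V) (\<lambda>z. HV (snd z) *v g z))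
       \<le> ereal (C1_const CARD('d) C0)
            * enn2ereal (L2_sq (mu V) g + L2_sq (mu V) (hgrad_x \<T> g))
          - ereal (8 * C0\<^sup>2
              * (LINT z:skeleton \<T>|nu V. avg \<T> tr z \<bullet> (jump_x \<T> tr z *v DV (snd z))))
     \<and> (V = (\<lambda>x. (norm x)\<^sup>2 / 2) \<longrightarrow>
          (CARD('d) = 1 \<longrightarrow> (\<forall>x. norm (HV x) \<le> 1 * (1 + norm (DV x)))) \<and>
          (CARD('d) \<le> 2 \<longrightarrow> C1_const CARD('d) 1 = 16) \<and>
          (CARD('d) \<le> 3 \<longrightarrow>
             enn2ereal (L2_sq (mu V) (\<lambda>z. HV (snd z) *v g z))
               \<le> ereal 16
                    * enn2ereal (L2_sq (mu V) g + L2_sq (mu V) (hgrad_x \<T> g))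
                  - ereal (8 * 1\<^sup>2
                      * (LINT z:skeleton \<T>|nu V. avg \<T> tr z \<bullet> (jump_x \<T> tr z *v DV (snd z))))))"
proof (intro conjI impI allI)
  interpret broken_field V DV HV \<T> g tr
    using assms by unfold_locales auto
  have growth: "norm (HV x) \<le> C0 * (1 + norm (DV x))" for x using assms(4) by blast
  have d: "1 \<le> real CARD('d)" using zero_less_card_finite[where 'a = 'd] by linarith
  have "(norm (HV (snd z) *v g z))\<^sup>2
      \<le> C1_const CARD('d) C0 * ((norm (g z))\<^sup>2 + (norm (Gx z))\<^sup>2) - 4 * C0\<^sup>2 * full_density z" for z
    unfolding C1_const_def full_density_def
  proof (rule pointwise_growth_bound[OF \<open>C0 > 0\<close> _ d refl])
    show "norm (HV (snd z) *v g z) \<le> C0 * (1 + norm (DV (snd z))) * norm (g z)"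
      by (rule order_trans[OF norm_matrix_vec_le]) (intro mult_right_mono growth norm_ge_zero)
    show "\<bar>\<Sum>j\<in>UNIV. HV (snd z) $ j $ j\<bar> \<le> sqrt (real CARD('d)) * C0 * (1 + norm (DV (snd z)))"
      using mult_left_mono[OF growth[of "snd z"], of "sqrt (real CARD('d))"]
      by (intro order_trans[OF abs_trace_le]) (simp add: mult.assoc)
    show "\<bar>g z \<bullet> (Gx z *v DV (snd z))\<bar> \<le> norm (g z) * norm (Gx z) * norm (DV (snd z))"
      by (rule inner_Gx_le)
  qed simp_all
  moreover have "0 < C1_const CARD('d) C0" using \<open>C0 > 0\<close> by (simp add: C1_const_def less_max_iff_disj)
  ultimately show "enn2ereal (L2_sq (mu V) (\<lambda>z. HV (snd z) *v g z))
       \<le> ereal (C1_const CARD('d) C0)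
            * enn2ereal (L2_sq (mu V) g + L2_sq (mu V) (hgrad_x \<T> g))
          - ereal (8 * C0\<^sup>2
              * (LINT z:skeleton \<T>|nu V. avg \<T> tr z \<bullet> (jump_x \<T> tr z *v DV (snd z))))"
    by (rule weighted_bound[OF \<open>C0 > 0\<close> growth])

  assume "V = (\<lambda>x. (norm x)\<^sup>2 / 2)"
  hence gauss: "DV x = x" "HV x = mat 1" for x
    using gaussian_derivatives assms(2) by blast+
  \<comment> \<open>The identity matrix has Frobenius norm sqrt d, so at x = 0 the growth condition
    with constant 1 reads sqrt d \<le> 1.\<close>
  show "norm (HV x) \<le> 1 * (1 + norm (DV x))" if "CARD('d) = 1" for x
  proof -
    have "(norm (HV x))\<^sup>2 = real CARD('d)"
      unfolding gauss norm_matrix_square norm_vec_square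
      by (simp add: mat_def if_distrib[of "\<lambda>u. u\<^sup>2"] cong: if_cong)
    hence "norm (HV x) = 1" using that by (simp add: power2_eq_1_iff) (smt (verit) norm_ge_zero)
    thus ?thesis by simp
  qed
  \<comment> \<open>Replacing sqrt 2 by 3 / 2 gives exactly 2 (1 + 3 + 4) = 16. For d = 3 the first
    entry of the maximum exceeds 16.\<close>
  show "C1_const CARD('d) 1 = 16" if "CARD('d) \<le> 2"
  proof -
    have "sqrt (real CARD('d)) \<le> 3 / 2" using that by (intro real_le_lsqrt) (auto simp: power2_eq_square)
    hence "2 * (1 + 2 * sqrt (real CARD('d)) + 2 * real CARD('d)) \<le> 16" using that by simp
    thus ?thesis by (simp add: C1_const_def max_absorb2)
  qed
  assume d3: "CARD('d) \<le> 3"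
  \<comment> \<open>With the identity as Hessian, |HV g| = |g| and the trace is d, with no loss
    through the Frobenius norm. The coefficient of |g|^2 is 1 + 4 d, at most 13 for d \<le> 3, and
    16 is dictated by the cross term. The given \<open>C0\<close> enters through
    \<open>weighted_bound\<close>, for integrability.\<close>
  have "(norm (HV (snd z) *v g z))\<^sup>2
      \<le> 16 * ((norm (g z))\<^sup>2 + (norm (Gx z))\<^sup>2) - 4 * 1\<^sup>2 * full_density z" for z
  proof -
    let ?a = "norm (g z)" and ?b = "norm (Gx z)" and ?p = "norm (snd z)" and ?I = "g z \<bullet> (Gx z *v snd z)"
    have "?I \<le> ?a * ?b * ?p" using inner_Gx_le[of z] by (simp add: gauss)
    moreover have "8 * (?a * ?b * ?p) \<le> 16 * ?b\<^sup>2 + ?p\<^sup>2 * ?a\<^sup>2"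
      using zero_le_power2[of "?p * ?a - 4 * ?b"] by (simp add: power2_eq_square algebra_simps)
    moreover have "0 \<le> ?p\<^sup>2 * ?a\<^sup>2" by simp
    ultimately have "8 * ?I \<le> 16 * ?b\<^sup>2 + 4 * (?p\<^sup>2 * ?a\<^sup>2)" by linarith
    moreover have "real CARD('d) * ?a\<^sup>2 \<le> 3 * ?a\<^sup>2" using d3 by (intro mult_right_mono) auto
    hence "?a\<^sup>2 + 4 * (real CARD('d) * ?a\<^sup>2) \<le> 16 * ?a\<^sup>2" using zero_le_power2[of ?a] by linarith
    moreover have "full_density z = 2 * ?I + ?a\<^sup>2 * (real CARD('d) - ?p\<^sup>2)"
      by (simp add: full_density_def gauss mat_def)
    ultimately show ?thesis by (simp add: gauss algebra_simps)
  qed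
  thus "enn2ereal (L2_sq (mu V) (\<lambda>z. HV (snd z) *v g z))
       \<le> ereal 16 * enn2ereal (L2_sq (mu V) g + L2_sq (mu V) (hgrad_x \<T> g))
          - ereal (8 * 1\<^sup>2
              * (LINT z:skeleton \<T>|nu V. avg \<T> tr z \<bullet> (jump_x \<T> tr z *v DV (snd z))))"
    by (rule weighted_bound[OF \<open>C0 > 0\<close> growth]) simp
qed

end
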